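(* Let $k\geqslant 1$ and let $Z=(X^+,X^-)_{\Sigma}$ be a Filippov system satisfying hypothesis (A) of the context. Let $n\geqslant 2k-1$, let $\Phi\in C^{n-1}_{ST}$, and let $Z^{\Phi}_{\varepsilon}$ be the regularized system. Put $\lambda^*=\frac{n}{2k(n-1)+1}$. Then there exist $\rho_0,\theta_0>0$ and constants $c,r>0$, together with $\eta$, $x_\varepsilon$, $y^{\varepsilon}_{\theta}$ of the form described in the context, such that for every $\lambda\in(0,\lambda^* )$, with $q=1-\frac{\lambda}{\lambda^*}\in(0,1)$, every sufficiently small $\varepsilon>0$, every $\rho\in(\varepsilon^{\lambda},\rho_0]$ and every $\theta\in[x_\varepsilon+re^{-c/\varepsilon^q},\theta_0]$ the following hold. (a) The vertical segment $$\check V^{\varepsilon}_{\theta}=\{\theta\}\times[y^{\varepsilon}_{\theta}-re^{-c/\varepsilon^{q}},\,y^{\varepsilon}_{\theta}]$$ and the horizontal segments $$\check H^{\varepsilon}_{\rho,\lambda}=[-\rho,-\varepsilon^{\lambda}]\times\{-\varepsilon\},\qquad \overrightarrow{H}_{\varepsilon}=[x_\varepsilon,\,x_\varepsilon+re^{-c/\varepsilon^{q}}]\times\{\varepsilon\}$$ are transversal sections for $Z^{\Phi}_{\varepsilon}$. (b) The (forward) flow of $Z^{\Phi}_{\varepsilon}$ defines a map $L_{\varepsilon}:\check H^{\varepsilon}_{\rho,\lambda}\to\check V^{\varepsilon}_{\theta}$.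
   Context: Setting. $X^{\pm}=(X^\pm_1,X^\pm_2)$ are $C^{2k}$ vector fields on an open set $V\subset\mathbb{R}^2$ containing the origin, $\Sigma$ is a $C^{2k}$ embedded codimension one submanifold, locally $\Sigma=h^{-1}(0)$ with $0$ a regular value of $h$; $Z=(X^+,X^-)_\Sigma$ equals $X^+$ where $h>0$ and $X^-$ where $h<0$. Lie derivatives: $Xh=\langle\nabla h,X\rangle$, $X^ih=X(X^{i-1}h)$. The vector field $X^+$ has a visible $2k$-multiplicity contact with $\Sigma$ at $p$ if $X^+h(p)=\dots=(X^+)^{2k-1}h(p)=0$ and $(X^+)^{2k}h(p)>0$. Hypothesis (A): $X^+$ has a visible $2k$-multiplicity contact with $\Sigma$ at $(0,0)$, $X^+_1(0,0)>0$, and there is a neighborhood $U$ of $(0,0)$ with $X^-|_U=(0,1)$ and $\Sigma\cap U=\{(x,0):x\in(-x_U,x_U)\}$; here $h(x,y)=y$. Transition functions: $C^{n-1}_{ST}$ is the set of functions $\Phi:\mathbb{R}\to\mathbb{R}$ with $\Phi(s)=\phi(s)$ for $|s|\leqslant1$ and $\Phi(s)=\operatorname{sign}(s)$ for $|s|\geqslant 1$, where $\phi:\mathbb{R}\to\mathbb{R}$ is $C^\infty$, $\phi(\pm1)=\pm1$, $\phi'(s)>0$ on $(-1,1)$, $\phi^{(i)}(\pm1)=0$ for $i=1,\dots,n-1$, and $\phi^{(n)}(\pm1)\neq0$. Regularization: $Z^{\Phi}_{\varepsilon}(p)=\frac{1+\Phi(h(p)/\varepsilon)}{2}X^+(p)+\frac{1-\Phi(h(p)/\varepsilon)}{2}X^-(p)$.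 Constants and functions. Let $f=X_2^+/X_1^+$ near the origin and $\alpha=\frac{1}{(2k-1)!}\frac{\partial^{2k-1}f}{\partial x^{2k-1}}(0,0)>0$. For $|x|$ small, $\overline y_x=\frac{\alpha x^{2k}}{2k}+\mathcal{O}(x^{2k+1})$ is the ordinate at which the trajectory of $X^+$ through $(0,0)$ meets the vertical line of abscissa $x$. Further, $$x_\varepsilon=\varepsilon^{\lambda^*}\eta+\mathcal{O}\big(\varepsilon^{\lambda^*+\frac1{1+2k(n-1)}}\big),$$ where $\eta$ is a constant with $\eta>0$ if $n>2k-1$, and $\eta>-\big(\partial_yf(0,0)/\alpha\big)^{\frac1{2k-1}}$ (real odd root) if $n=2k-1$ and $k\neq1$; $$y^{\varepsilon}_{\theta}=\overline y_\theta+\varepsilon+\mathcal{O}(\varepsilon\theta)+\sum_{i=1}^{2k-1}\mathcal{O}(\theta^{2k+1-i}x_\varepsilon^i)+\mathcal{O}(x_\varepsilon^{2k}).$$ The parameters $\rho,\theta$ may depend on $\varepsilon$. A segment is a transversal section for a vector field if the vector field is nowhere tangent to it along the segment. *)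

theory Defs
  imports "HOL-Analysis.Analysis"
begin

(* Intended for open D only, where the derivatives (at p) are unrestricted ones. *)
primrec Ck_on ::
  "nat \<Rightarrow> ('a::real_normed_vector \<Rightarrow> 'b::real_normed_vector) \<Rightarrow> 'a set \<Rightarrow> bool" where
  "Ck_on 0 g D \<longleftrightarrow> continuous_on D g"
| "Ck_on (Suc m) g D \<longleftrightarrow>
     (\<forall>p\<in>D. g differentiable (at p)) \<and>
     (\<forall>v. Ck_on m (\<lambda>p. frechet_derivative g (at p) v) D)"

definition grad :: "('a::real_inner \<Rightarrow> real) \<Rightarrow> 'a \<Rightarrow> 'a" where
  "grad h p = (THE D. GDERIV h p :> D)"

definition lie :: "('a::real_inner \<Rightarrow> 'a) \<Rightarrow> ('a \<Rightarrow> real) \<Rightarrow> 'a \<Rightarrow> real" where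
  "lie X h p = grad h p \<bullet> X p"

definition zero_regular_value_on :: "('a::real_inner \<Rightarrow> real) \<Rightarrow> 'a set \<Rightarrow> bool" where
  "zero_regular_value_on h D \<longleftrightarrow> (\<forall>p\<in>D. h p = 0 \<longrightarrow> grad h p \<noteq> 0)"

definition local_defining_function ::
  "nat \<Rightarrow> 'a::real_inner set \<Rightarrow> 'a set \<Rightarrow> ('a \<Rightarrow> real) \<Rightarrow> bool" where
  "local_defining_function m S N h \<longleftrightarrow>
     open N \<and> Ck_on m h N \<and> zero_regular_value_on h N \<and> S \<inter> N = {p \<in> N. h p = 0}"

definition embedded_hypersurface :: "nat \<Rightarrow> 'a::real_inner set \<Rightarrow> 'a set \<Rightarrow> bool" where
  "embedded_hypersurface m V S \<longleftrightarrow>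
     S \<subseteq> V \<and> (\<forall>p\<in>S. \<exists>N h. p \<in> N \<and> N \<subseteq> V \<and> local_defining_function m S N h)"

(* W is the neighbourhood of the origin on which the switching manifold S is described by h;
   the regularized vector field is therefore only considered on W. *)
definition filippov_system ::
  "nat \<Rightarrow> (real \<times> real) set \<Rightarrow> (real \<times> real) set \<Rightarrow> (real \<times> real) set \<Rightarrow> (real \<times> real \<Rightarrow> real) \<Rightarrow>
   (real \<times> real \<Rightarrow> real \<times> real) \<Rightarrow> (real \<times> real \<Rightarrow> real \<times> real) \<Rightarrow> bool" where
  "filippov_system m V S W h Xp Xm \<longleftrightarrow>
     open V \<and> Ck_on m Xp V \<and> Ck_on m Xm V \<and> embedded_hypersurface m V S \<and>
     (0, 0) \<in> W \<and> W \<subseteq> V \<and> local_defining_function m S W h"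

definition visible_contact ::
  "nat \<Rightarrow> ('a::real_inner \<Rightarrow> 'a) \<Rightarrow> ('a \<Rightarrow> real) \<Rightarrow> 'a \<Rightarrow> bool" where
  "visible_contact k X h p \<longleftrightarrow>
     (\<forall>i\<in>{1..2 * k - 1}. (lie X ^^ i) h p = 0) \<and> (lie X ^^ (2 * k)) h p > 0"

definition hypothesis_A ::
  "nat \<Rightarrow> (real \<times> real) set \<Rightarrow> (real \<times> real) set \<Rightarrow> (real \<times> real \<Rightarrow> real) \<Rightarrow>
   (real \<times> real \<Rightarrow> real \<times> real) \<Rightarrow> (real \<times> real \<Rightarrow> real \<times> real) \<Rightarrow> bool" where
  "hypothesis_A k S W h Xp Xm \<longleftrightarrow>
     visible_contact k Xp h (0, 0) \<and> fst (Xp (0, 0)) > 0 \<and>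
     (\<exists>U xU. open U \<and> (0, 0) \<in> U \<and> U \<subseteq> W \<and> xU > 0 \<and>
        (\<forall>p\<in>U. Xm p = (0, 1)) \<and>
        S \<inter> U = {-xU<..<xU} \<times> {0} \<and>
        (\<forall>p\<in>U. h p = snd p))"

(* transition_functions n is the class of C^(n-1), in general not C^n, transition functions. *)
definition transition_functions :: "nat \<Rightarrow> (real \<Rightarrow> real) set" where
  "transition_functions n = {\<Phi>. \<exists>\<phi> :: real \<Rightarrow> real.
     (\<forall>s. \<bar>s\<bar> \<le> 1 \<longrightarrow> \<Phi> s = \<phi> s) \<and> (\<forall>s. \<bar>s\<bar> \<ge> 1 \<longrightarrow> \<Phi> s = sgn s) \<and>
     (\<forall>m. Ck_on m \<phi> UNIV) \<and> \<phi> 1 = 1 \<and> \<phi> (-1) = -1 \<and>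
     (\<forall>s\<in>{-1<..<1}. deriv \<phi> s > 0) \<and>
     (\<forall>i\<in>{1..n - 1}. (deriv ^^ i) \<phi> 1 = 0 \<and> (deriv ^^ i) \<phi> (-1) = 0) \<and>
     (deriv ^^ n) \<phi> 1 \<noteq> 0 \<and> (deriv ^^ n) \<phi> (-1) \<noteq> 0}"

definition regularization ::
  "(real \<Rightarrow> real) \<Rightarrow> ('a \<Rightarrow> real) \<Rightarrow> ('a \<Rightarrow> 'a::real_vector) \<Rightarrow> ('a \<Rightarrow> 'a) \<Rightarrow> real \<Rightarrow> 'a \<Rightarrow> 'a" where
  "regularization \<Phi> h Xp Xm \<epsilon> p =
     ((1 + \<Phi> (h p / \<epsilon>)) / 2) *\<^sub>R Xp p + ((1 - \<Phi> (h p / \<epsilon>)) / 2) *\<^sub>R Xm p"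

definition slope :: "(real \<times> real \<Rightarrow> real \<times> real) \<Rightarrow> real \<times> real \<Rightarrow> real" where
  "slope X p = snd (X p) / fst (X p)"

definition alpha :: "nat \<Rightarrow> (real \<times> real \<Rightarrow> real \<times> real) \<Rightarrow> real" where
  "alpha k X = (deriv ^^ (2 * k - 1)) (\<lambda>x. slope X (x, 0)) 0 / fact (2 * k - 1)"

definition trajectory_on ::
  "real set \<Rightarrow> 'a set \<Rightarrow> ('a::real_normed_vector \<Rightarrow> 'a) \<Rightarrow> (real \<Rightarrow> 'a) \<Rightarrow> bool" where
  "trajectory_on I D X \<gamma> \<longleftrightarrow>
     (\<forall>t\<in>I. \<gamma> t \<in> D \<and> (\<gamma> has_vector_derivative X (\<gamma> t)) (at t within I))"

(* The abscissa increases along the arcs considered here, so that later returns of the trajectory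
   to the same vertical line are excluded and the ordinate is unique; the description is
   meaningful for x near 0. Negative times t give the ordinates for x < 0. *)
definition ybar ::
  "(real \<times> real) set \<Rightarrow> (real \<times> real \<Rightarrow> real \<times> real) \<Rightarrow> real \<Rightarrow> real" where
  "ybar V X x = (THE y. \<exists>t \<gamma>.
     trajectory_on (closed_segment 0 t) {p \<in> V. fst (X p) > 0} X \<gamma> \<and>
     \<gamma> 0 = (0, 0) \<and> \<gamma> t = (x, y))"

definition lambda_star :: "nat \<Rightarrow> nat \<Rightarrow> real" where
  "lambda_star k n = real n / (2 * real k * (real n - 1) + 1)"

(* No condition on eta is imposed for n = k = 1. *)
definition abscissa_form ::
  "nat \<Rightarrow> nat \<Rightarrow> (real \<times> real \<Rightarrow> real \<times> real) \<Rightarrow> real \<Rightarrow> (real \<Rightarrow> real) \<Rightarrow> bool" where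
  "abscissa_form k n X \<eta> x \<longleftrightarrow>
     (n > 2 * k - 1 \<longrightarrow> \<eta> > 0) \<and>
     (n = 2 * k - 1 \<and> k \<noteq> 1 \<longrightarrow>
        \<eta> > - root (2 * k - 1) (deriv (\<lambda>y. slope X (0, y)) 0 / alpha k X)) \<and>
     (\<lambda>\<epsilon>. x \<epsilon> - \<epsilon> powr lambda_star k n * \<eta>)
       \<in> O[at_right 0](\<lambda>\<epsilon>. \<epsilon> powr (lambda_star k n + 1 / (1 + 2 * real k * (real n - 1))))"

(* The O-terms are uniform in theta, since theta may depend on epsilon; theta and x epsilon may
   be negative, hence the absolute values. *)
definition ordinate_form ::
  "nat \<Rightarrow> (real \<times> real) set \<Rightarrow> (real \<times> real \<Rightarrow> real \<times> real) \<Rightarrow> real \<Rightarrow> (real \<Rightarrow> real) \<Rightarrow>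
   (real \<Rightarrow> real \<Rightarrow> real) \<Rightarrow> bool" where
  "ordinate_form k V X \<theta>0 x y \<longleftrightarrow>
     (\<exists>C. \<forall>\<^sub>F \<epsilon> in at_right 0. \<forall>\<theta>\<in>{x \<epsilon>..\<theta>0}.
        \<bar>y \<epsilon> \<theta> - (ybar V X \<theta> + \<epsilon>)\<bar> \<le>
          C * (\<epsilon> * \<bar>\<theta>\<bar> + (\<Sum>i=1..2 * k - 1. \<bar>\<theta>\<bar> ^ (2 * k + 1 - i) * \<bar>x \<epsilon>\<bar> ^ i) + \<bar>x \<epsilon>\<bar> ^ (2 * k)))"

(* A zero of Z on the segment counts as a tangency. *)
definition transversal_section ::
  "'a set \<Rightarrow> ('a::real_vector \<Rightarrow> 'a) \<Rightarrow> 'a \<Rightarrow> 'a \<Rightarrow> bool" where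
  "transversal_section D Z a b \<longleftrightarrow>
     a \<noteq> b \<and> closed_segment a b \<subseteq> D \<and> (\<forall>p\<in>closed_segment a b. Z p \<notin> span {b - a})"

definition first_hit ::
  "'a set \<Rightarrow> ('a::real_normed_vector \<Rightarrow> 'a) \<Rightarrow> 'a set \<Rightarrow> 'a \<Rightarrow> 'a \<Rightarrow> bool" where
  "first_hit D Z B p q \<longleftrightarrow>
     (\<exists>T>0. \<exists>\<gamma>. trajectory_on {0..T} D Z \<gamma> \<and> \<gamma> 0 = p \<and> \<gamma> T = q \<and> q \<in> B \<and>
        (\<forall>t\<in>{0<..<T}. \<gamma> t \<notin> B))"

definition flow_defines_map ::
  "'a set \<Rightarrow> ('a::real_normed_vector \<Rightarrow> 'a) \<Rightarrow> 'a set \<Rightarrow> 'a set \<Rightarrow> ('a \<Rightarrow> 'a) \<Rightarrow> bool" where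
  "flow_defines_map D Z A B L \<longleftrightarrow>
     L ` A \<subseteq> B \<and> (\<forall>p\<in>A. \<forall>q. first_hit D Z B p q \<longleftrightarrow> q = L p)"

end

theory Submission
  imports Defs
begin

text \<open>
  Where \<open>P = (1 + \<Phi>(y/\<epsilon>))/2\<close> is positive, trajectories of the regularized field are graphs solving
  \<open>dy/dx = f + (1 - P)/(P X\<^sub>1)\<close>. The graph \<open>Y\<close> starting at abscissa \<open>-\<rho>\<^sub>0\<close> slightly above
  \<open>y = -\<epsilon>\<close> lies above every trajectory starting on \<open>y = -\<epsilon>\<close> to the right of \<open>-\<rho>\<^sub>0\<close>, so that
  \<open>y\<^sup>\<epsilon>\<^sub>\<theta> = Y \<theta>\<close> can serve as the upper end of the target section. All estimates of \<open>Y\<close> are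
  comparison arguments: it stays at a distance of at least order \<open>\<epsilon> |x|\<^bsup>(2k-1)/n\<^esup>\<close> below \<open>y = \<epsilon>\<close> for
  \<open>x \<le> -\<epsilon>\<^sup>\<lambda>/2\<close>, leaves the strip \<open>|y| \<le> \<epsilon>\<close> before \<open>x = \<eta> \<epsilon>\<^bsup>\<lambda>*\<^esup>\<close> if \<open>\<eta>\<close> is large, and afterwards
  follows the trajectory of the upper field through the fold. The asymptotic form of \<open>x\<^sub>\<epsilon>\<close> and
  \<open>y\<^sup>\<epsilon>\<^sub>\<theta>\<close> leaves room for such a large \<open>\<eta>\<close>, hence the sharp exit abscissa is not needed.

  On \<open>[-\<epsilon>\<^sup>\<lambda>, -\<epsilon>\<^sup>\<lambda>/2]\<close> the distance of any trajectory below \<open>Y\<close> decays at a rate of order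
  \<open>\<epsilon>\<^bsup>-q-\<lambda>\<^esup>\<close>, which produces the factor \<open>exp(-c/\<epsilon>\<^sup>q)\<close>; elsewhere it grows at most by a bounded factor.
\<close>

text \<open>At y = -\<epsilon> the profile \<open>P\<close> vanishes and the slope blows up. Hence
  only the upper curve is handled as a graph, started at a height \<open>\<epsilon> * v1\<close>
  below which its slope is provably positive; the other trajectories are kept in time and measured
  by \<open>Y (x t) - y t\<close>. One starting abscissa for \<open>Y\<close> makes the end of the
  target section independent of \<lambda> and \<rho>. The exponents are balances. With u =
  (\<epsilon> - y) / \<epsilon> and j = 2k - 1 the equation near the upper edge is \<epsilon> u' =
  -f - c u^n, with f of order x^j. A length N and a thickness s balance if s^(n-1) N = \<epsilon>
  and s^n = N^j, that is N = \<epsilon>^(n / (2k(n-1) + 1)). From n >= j follows \<epsilon> <= N^j,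
  so the variation of f across the strip does not dominate. At distance \<xi> = \<epsilon>^\<lambda>
  left of the fold u has order \<xi>^(j/n), the linearized decay rate is u^(n-1) / \<epsilon>, and
  the exponent collected over a length \<xi> is \<xi>^(1 + j(n-1)/n) / \<epsilon> =
  \<epsilon>^(-q).\<close>

section \<open>Ordinary differential equations\<close>

text \<open>After the last time before \<open>t\<close> at which \<open>G\<close> is nonpositive,
  \<open>G\<close> is positive and at first smaller than \<open>d\<close>, so by the mean value
  theorem it cannot have increased. The sign of \<open>D\<close> is required only in the strip
  between 0 and \<open>d\<close>, since many comparison estimates below hold only close to the
  barrier curve.\<close>

lemma barrier:
  fixes G D :: "real \<Rightarrow> real"
  assumes der: "\<And>t. t \<in> {a..b} \<Longrightarrow> (G has_real_derivative D t) (at t within {a..b})"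
    and start: "G a \<le> 0" and "0 < d"
    and neg: "\<And>t. t \<in> {a..b} \<Longrightarrow> 0 < G t \<Longrightarrow> G t < d \<Longrightarrow> D t \<le> 0"
    and t: "t \<in> {a..b}"
  shows "G t \<le> 0"
proof (rule ccontr)
  assume pos: "\<not> G t \<le> 0"
  have cont: "continuous_on {a..b} G"
    using der by (meson DERIV_continuous continuous_on_eq_continuous_within)
  define S where "S = {s \<in> {a..t}. G s \<le> 0}"
  have "S = {a..t} \<inter> G -` {..0}" by (auto simp: S_def)
  moreover have "continuous_on {a..t} G" using cont t by (auto intro: continuous_on_subset)
  ultimately have "closed S"
    by (metis Int_commute closed_atMost closed_atLeastAtMost continuous_on_closed_vimage)
  moreover have "bounded S" by (rule bounded_subset[of "{a..t}"]) (auto simp: S_def)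
  moreover have "a \<in> S" using start t by (auto simp: S_def)
  ultimately obtain s where s: "s \<in> S" "\<And>u. u \<in> S \<Longrightarrow> u \<le> s"
    using compact_attains_sup[of S] compact_eq_bounded_closed by blast
  have gt: "G u > 0" if "u \<in> {s<..t}" for u
  proof (rule ccontr)
    assume "\<not> G u > 0"
    then have "u \<in> S" using that s(1) by (auto simp: S_def)
    then show False using s(2)[of u] that by auto
  qed
  have st: "s < t" "a \<le> s" "G s \<le> 0" using s pos by (auto simp: S_def less_le)
  have "(G \<longlongrightarrow> G s) (at s within {a..b})"
    using cont st t by (simp add: continuous_on)
  then have "\<forall>\<^sub>F u in at s within {a..b}. G u < d"
    using st \<open>0 < d\<close> by (auto intro: order_tendstoD(2))
  then obtain e where e: "e > 0" "\<And>u. u \<in> {a..b} \<Longrightarrow> u \<noteq> s \<Longrightarrow> dist u s < e \<Longrightarrow> G u < d"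
    by (auto simp: eventually_at)
  define v where "v = min t (s + e / 2)"
  have v: "s < v" "v \<le> t" "v < s + e" using st e by (auto simp: v_def)
  have "(G has_derivative (*) (D x)) (at x within {s..v})" if "s \<le> x" "x \<le> v" for x
    by (rule has_derivative_subset[OF der[of x, unfolded has_field_derivative_def]])
       (use that v st t in auto)
  from mvt_simple[OF v(1) this] obtain x where x: "s < x" "x < v" "G v - G s = (v - s) * D x"
    by (auto simp: mult.commute)
  have "D x \<le> 0"
    using x v st t by (intro neg gt e(2)) (auto simp: dist_real_def)
  then have "G v \<le> G s" using x v mult_nonneg_nonpos[of "v - s" "D x"] by linarith
  moreover have "G v > 0" using gt v by auto
  ultimately show False using st by linarith
qed

text \<open>The contraction argument runs on bounded continuous functions on the whole line, a
  complete space. The step \<open>h\<close> depends on \<open>L\<close> alone, so that it can be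
  repeated from any point.\<close>

lemma picard_local:
  fixes F :: "'a::banach \<Rightarrow> 'a"
  assumes "L-lipschitz_on UNIV F"
  shows "\<exists>h>0. \<forall>p. \<exists>\<gamma>. \<gamma> 0 = p \<and>
    (\<forall>t\<in>{-h..h}. (\<gamma> has_vector_derivative F (\<gamma> t)) (at t within {-h..h}))"
proof -
  have L: "L \<ge> 0" using assms lipschitz_on_nonneg by blast
  \<comment> \<open>The iteration contains two integrals, each of Lipschitz constant
    \<open>2 * L * h\<close>; with this \<open>h\<close> the contraction factor
    \<open>4 * L * h\<close> is at most 2/3.\<close>
  define h where "h = 1 / (6 * L + 1)"
  have h: "h > 0" "6 * L * h \<le> 1" using L by (auto simp: h_def field_simps)
  have contF: "continuous_on UNIV F"
    using assms lipschitz_on_continuous_on by blast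
  have "\<exists>\<gamma>. \<gamma> 0 = p \<and>
    (\<forall>t\<in>{-h..h}. (\<gamma> has_vector_derivative F (\<gamma> t)) (at t within {-h..h}))" for p
  proof -
    \<comment> \<open>Freezing time outside the interval makes the iterates globally defined and
      bounded.\<close>
    define c where "c = (\<lambda>t. max (-h) (min h t))"
    have c: "c t \<in> {-h..h}" "t \<in> {-h..h} \<Longrightarrow> c t = t" for t using h by (auto simp: c_def)
    define I where "I = (\<lambda>(u :: real \<Rightarrow> 'a) t. integral {-h..t} (\<lambda>s. F (u s)))"
    \<comment> \<open>The integral starts at the left end; its value at 0 is subtracted because the
      initial time is interior.\<close>
    define K where "K = (\<lambda>u t. p + (I u (c t) - I u 0))"
    have cF: "continuous_on T (\<lambda>s. F (apply_bcontfun u s))" for u :: "real \<Rightarrow>\<^sub>C 'a" and T :: "real set"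
      by (rule continuous_on_compose2[OF contF]) auto
    have int: "(\<lambda>s. F (apply_bcontfun u s)) integrable_on {-h..t}" for u :: "real \<Rightarrow>\<^sub>C 'a" and t
      by (rule integrable_continuous_real[OF cF])
    have der: "((\<lambda>t. I u t) has_vector_derivative F (apply_bcontfun u t)) (at t within {-h..h})"
      if "t \<in> {-h..h}" for u :: "real \<Rightarrow>\<^sub>C 'a" and t
      unfolding I_def using integral_has_vector_derivative[OF cF that] .
    have contI: "continuous_on {-h..h} (I u)" for u :: "real \<Rightarrow>\<^sub>C 'a"
      using der by (meson continuous_on_eq_continuous_within has_vector_derivative_continuous)
    have Kb: "K u \<in> bcontfun" for u :: "real \<Rightarrow>\<^sub>C 'a"
    proof -
      have "bounded (I u ` {-h..h})"
        by (intro compact_imp_bounded compact_continuous_image contI compact_Icc)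
      then obtain B where B: "\<And>t. t \<in> {-h..h} \<Longrightarrow> norm (I u t) \<le> B"
        unfolding bounded_iff by blast
      show ?thesis
      proof (rule bcontfun_normI)
        show "continuous_on UNIV (K u)"
          unfolding K_def c_def
          by (intro continuous_intros continuous_on_compose2[OF contI]) (use h in auto)
        show "norm (K u t) \<le> norm p + (B + B)" for t
          unfolding K_def
          by (intro norm_triangle_mono norm_triangle_le_diff add_mono B order_refl)
             (use c h B in auto)
      qed
    qed
    define KK where "KK = (\<lambda>u :: real \<Rightarrow>\<^sub>C 'a. Bcontfun (K u))"
    have KK: "apply_bcontfun (KK u) = K u" for u
      by (simp add: KK_def Bcontfun_inverse Kb)
    have Id: "norm (I u t - I v t) \<le> L * dist u v * (2 * h)" if "t \<in> {-h..h}"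
      for u v :: "real \<Rightarrow>\<^sub>C 'a" and t
    proof -
      have "norm (I u t - I v t) = norm (integral {-h..t} (\<lambda>s. F (u s) - F (v s)))"
        unfolding I_def by (simp add: integral_diff int)
      also have "\<dots> \<le> L * dist u v * (t - (-h))"
      proof (rule integral_bound)
        show "continuous_on {-h..t} (\<lambda>s. F (u s) - F (v s))" by (intro continuous_intros cF)
        show "norm (F (u s) - F (v s)) \<le> L * dist u v" for s
        proof -
          have "norm (F (u s) - F (v s)) \<le> L * dist (u s) (v s)"
            using lipschitz_onD[OF assms, of "u s" "v s"] by (simp add: dist_norm)
          also have "\<dots> \<le> L * dist u v"
            using L dist_bounded by (intro mult_left_mono) auto
          finally show ?thesis .
        qed
      qed (use that in auto)
      also have "\<dots> \<le> L * dist u v * (2 * h)"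
        using that L by (intro mult_left_mono) auto
      finally show ?thesis .
    qed
    have "dist (KK u) (KK v) \<le> (2 / 3) * dist u v" for u v
    proof (rule dist_bound)
      fix t
      have "dist (K u t) (K v t) = norm ((I u (c t) - I v (c t)) - (I u 0 - I v 0))"
        by (simp add: K_def dist_norm algebra_simps)
      also have "\<dots> \<le> L * dist u v * (2 * h) + L * dist u v * (2 * h)"
        by (rule norm_triangle_le_diff, rule add_mono; rule Id) (use c h in auto)
      also have "\<dots> = (2 / 3) * (6 * L * h) * dist u v" by simp
      also have "\<dots> \<le> (2 / 3) * 1 * dist u v"
        by (intro mult_right_mono mult_left_mono h) auto
      finally show "dist (apply_bcontfun (KK u) t) (apply_bcontfun (KK v) t) \<le> (2 / 3) * dist u v"
        by (simp add: KK)
    qed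
    then obtain u where "KK u = u"
      using banach_fix_type[of "2/3" KK] by auto
    then have u: "apply_bcontfun u = K u" using KK by metis
    have "(apply_bcontfun u has_vector_derivative F (u t)) (at t within {-h..h})"
      if t: "t \<in> {-h..h}" for t
    proof (rule has_vector_derivative_transform[OF t])
      show "apply_bcontfun u s = p + (I u s - I u 0)" if "s \<in> {-h..h}" for s
        using c(2)[OF that] by (subst u) (simp add: K_def)
      show "((\<lambda>s. p + (I u s - I u 0)) has_vector_derivative F (u t)) (at t within {-h..h})"
        using der[OF t] by (auto intro!: derivative_eq_intros)
    qed
    moreover have "u 0 = p" using c(2)[of 0] h by (subst u) (simp add: K_def)
    ultimately show ?thesis by blast
  qed
  with h(1) show ?thesis by blast
qed

text \<open>Steps of the uniform length \<open>h\<close> are glued. A little negative time is kept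
  so that the solution has a two-sided derivative at 0, as the Taylor expansion along the trajectory
  through the fold requires.\<close>

theorem picard_global:
  fixes F :: "'a::banach \<Rightarrow> 'a"
  assumes "L-lipschitz_on UNIV F"
  shows "\<exists>h>0. \<forall>T\<ge>0. \<exists>\<gamma>. \<gamma> 0 = p \<and>
    (\<forall>t\<in>{-h..T}. (\<gamma> has_vector_derivative F (\<gamma> t)) (at t within {-h..T}))"
proof -
  from picard_local[OF assms] obtain h where h: "h > 0"
    and loc: "\<And>p. \<exists>\<gamma>. \<gamma> 0 = p \<and>
      (\<forall>t\<in>{-h..h}. (\<gamma> has_vector_derivative F (\<gamma> t)) (at t within {-h..h}))" by blast
  have step: "\<exists>\<gamma>. \<gamma> 0 = p \<and> (\<forall>t\<in>{-h..real j * h}.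
      (\<gamma> has_vector_derivative F (\<gamma> t)) (at t within {-h..real j * h}))" for j
  proof (induction j)
    case 0
    from loc[of p] obtain \<gamma> where \<gamma>: "\<gamma> 0 = p"
      "\<And>t. t \<in> {-h..h} \<Longrightarrow> (\<gamma> has_vector_derivative F (\<gamma> t)) (at t within {-h..h})" by blast
    show ?case
      by (rule exI[of _ \<gamma>]) (use \<gamma> h in \<open>auto intro: has_vector_derivative_within_subset[OF \<gamma>(2)]\<close>)
  next
    case (Suc j)
    then obtain \<gamma> where \<gamma>: "\<gamma> 0 = p"
      "\<And>t. t \<in> {-h..real j * h} \<Longrightarrow> (\<gamma> has_vector_derivative F (\<gamma> t)) (at t within {-h..real j * h})"
      by blast
    define T where "T = real j * h"
    have T: "T \<ge> 0" "real (Suc j) * h = T + h" using h by (auto simp: T_def algebra_simps)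
    from loc[of "\<gamma> T"] obtain \<delta> where \<delta>: "\<delta> 0 = \<gamma> T"
      "\<And>t. t \<in> {-h..h} \<Longrightarrow> (\<delta> has_vector_derivative F (\<delta> t)) (at t within {-h..h})" by blast
    have \<delta>': "((\<lambda>t. \<delta> (t - T)) has_vector_derivative F (\<delta> (t - T))) (at t within {T..T + h})"
      if "t \<in> {T..T + h}" for t
    proof -
      have "((\<lambda>t. t - T) has_vector_derivative 1) (at t within {T..T + h})"
        by (auto intro!: derivative_eq_intros)
      moreover have "(\<delta> has_vector_derivative F (\<delta> (t - T)))
          (at (t - T) within (\<lambda>t. t - T) ` {T..T + h})"
        by (rule has_vector_derivative_within_subset[OF \<delta>(2)]) (use that h in auto)
      ultimately show ?thesis
        using vector_diff_chain_within[of "\<lambda>t. t - T" 1 t "{T..T + h}" \<delta> "F (\<delta> (t - T))"]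
        by (simp add: o_def)
    qed
    define \<sigma> where "\<sigma> = (\<lambda>t. if t \<in> {-h..T} then \<gamma> t else \<delta> (t - T))"
    have 1: "{-h..T} \<union> (closure {-h..T} \<inter> closure {T..T + h}) = {-h..T}"
      and 2: "{T..T + h} \<union> (closure {-h..T} \<inter> closure {T..T + h}) = {T..T + h}"
      using T h by auto
    have "(\<sigma> has_vector_derivative F (\<sigma> t)) (at t within {-h..T + h})" if "t \<in> {-h..T + h}" for t
    proof -
      have "(\<sigma> has_vector_derivative (if t \<in> {-h..T} then F (\<gamma> t) else F (\<delta> (t - T))))
          (at t within {-h..T + h})"
        unfolding \<sigma>_def
        by (rule has_vector_derivative_If_within_closures[where T = "{T..T + h}"])
           (use that T h \<gamma>(2) \<delta>' \<delta>(1) 1 2 in \<open>auto simp: T_def[symmetric] Int_absorb1 max_def min_def split: if_splits\<close>)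
      then show ?thesis by (simp add: \<sigma>_def if_distrib cong: if_cong)
    qed
    then show ?case
      unfolding T using \<gamma>(1) h T by (intro exI[of _ \<sigma>]) (auto simp: \<sigma>_def)
  qed
  have "\<exists>\<gamma>. \<gamma> 0 = p \<and> (\<forall>t\<in>{-h..T}. (\<gamma> has_vector_derivative F (\<gamma> t)) (at t within {-h..T}))"
    if "T \<ge> 0" for T
  proof -
    obtain j :: nat where "T / h \<le> real j" using real_arch_simple by blast
    then have j: "T \<le> real j * h" using h by (simp add: field_simps)
    from step[of j] obtain \<gamma> where \<gamma>: "\<gamma> 0 = p"
      "\<And>t. t \<in> {-h..real j * h} \<Longrightarrow> (\<gamma> has_vector_derivative F (\<gamma> t)) (at t within {-h..real j * h})"
      by blast
    show ?thesis
      by (rule exI[of _ \<gamma>]) (use \<gamma> j in \<open>auto intro: has_vector_derivative_within_subset[OF \<gamma>(2)]\<close>)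
  qed
  with h show ?thesis by blast
qed

text \<open>Gronwall for the squared distance. \<open>\<delta>\<close> is not assumed to stay in
  \<open>Q\<close>: the orbit of \<open>\<gamma>\<close> is compact and has a tube of radius
  \<open>e\<close> inside \<open>Q\<close>, and the barrier argument needs the equation of
  \<open>\<delta>\<close> only inside that tube.\<close>

lemma ode_unique_on_open:
  fixes F G :: "'a::real_inner \<Rightarrow> 'a"
  assumes lip: "L-lipschitz_on UNIV F" and Q: "open Q" and FG: "\<And>p. p \<in> Q \<Longrightarrow> G p = F p"
    and \<gamma>: "\<And>t. t \<in> {0..T} \<Longrightarrow> (\<gamma> has_vector_derivative F (\<gamma> t)) (at t within {0..T})"
    and \<gamma>Q: "\<And>t. t \<in> {0..T} \<Longrightarrow> \<gamma> t \<in> Q"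
    and \<delta>: "\<And>t. t \<in> {0..T} \<Longrightarrow> (\<delta> has_vector_derivative G (\<delta> t)) (at t within {0..T})"
    and init: "\<delta> 0 = \<gamma> 0" and t: "t \<in> {0..T}"
  shows "\<delta> t = \<gamma> t"
proof -
  have "continuous_on {0..T} \<gamma>"
    using \<gamma> by (meson continuous_on_eq_continuous_within has_vector_derivative_continuous)
  then have "compact (\<gamma> ` {0..T})" by (intro compact_continuous_image compact_Icc)
  then obtain e where e: "e > 0" "(\<Union>p\<in>\<gamma> ` {0..T}. cball p e) \<subseteq> Q"
    using compact_subset_open_imp_cball_epsilon_subset[OF _ Q, of "\<gamma> ` {0..T}"] \<gamma>Q by blast
  have L: "L \<ge> 0" using lip lipschitz_on_nonneg by blast
  define D where "D = (\<lambda>t. \<delta> t - \<gamma> t)"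
  define g where "g = (\<lambda>t. (D t \<bullet> D t) * exp (- (2 * L) * t))"
  define g' where "g' = (\<lambda>t. 2 * (D t \<bullet> (G (\<delta> t) - F (\<gamma> t))) * exp (- (2 * L) * t)
      - 2 * L * (D t \<bullet> D t) * exp (- (2 * L) * t))"
  have "g t \<le> 0"
  \<comment> \<open>With this width, \<open>g t\<close> inside the strip forces
    \<open>\<delta> t\<close> to lie within \<open>e\<close> of \<open>\<gamma> t\<close>, at any
    time up to \<open>T\<close>.\<close>
  proof (rule barrier[where G = g and t = t and a = 0 and b = T and D = g' and d = "e^2 * exp (- (2 * L) * T)"])
    fix t assume t: "t \<in> {0..T}"
    have "(D has_vector_derivative (G (\<delta> t) - F (\<gamma> t))) (at t within {0..T})"
      unfolding D_def by (intro derivative_intros \<gamma> \<delta> t)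
    then have "((\<lambda>t. D t \<bullet> D t) has_real_derivative 2 * (D t \<bullet> (G (\<delta> t) - F (\<gamma> t)))) (at t within {0..T})"
      unfolding has_vector_derivative_def has_field_derivative_def
      by (auto intro!: derivative_eq_intros simp: inner_commute algebra_simps)
    then show "(g has_real_derivative g' t) (at t within {0..T})"
      unfolding g_def g'_def by (auto intro!: derivative_eq_intros simp: algebra_simps)
    assume "g t < e^2 * exp (- (2 * L) * T)"
    also have "\<dots> \<le> e^2 * exp (- (2 * L) * t)"
      using t L by (intro mult_left_mono) (auto intro: mult_left_mono)
    finally have "(norm (D t))^2 < e^2" by (simp add: g_def dot_square_norm)
    then have "norm (D t) < e" using e(1) by (simp add: power2_less_imp_less)
    then have "\<delta> t \<in> cball (\<gamma> t) e" by (simp add: D_def dist_norm norm_minus_commute)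
    then have "\<delta> t \<in> Q" using e(2) t by blast
    then have "D t \<bullet> (G (\<delta> t) - F (\<gamma> t)) = D t \<bullet> (F (\<delta> t) - F (\<gamma> t))" by (simp add: FG)
    also have "\<dots> \<le> norm (D t) * norm (F (\<delta> t) - F (\<gamma> t))" by (rule norm_cauchy_schwarz)
    also have "\<dots> \<le> norm (D t) * (L * norm (D t))"
      using lipschitz_onD[OF lip, of "\<delta> t" "\<gamma> t"] by (intro mult_left_mono) (auto simp: dist_norm D_def)
    also have "\<dots> = L * (D t \<bullet> D t)" by (simp add: dot_square_norm power2_eq_square)
    finally show "g' t \<le> 0"
      unfolding g'_def by (simp add: mult_right_mono)
  qed (use t init e in \<open>auto simp: g_def D_def\<close>)
  then have "D t \<bullet> D t \<le> 0" unfolding g_def by (simp add: mult_le_0_iff)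
  then have "D t = 0" using inner_gt_zero_iff[of "D t"] by (meson not_le)
  then show ?thesis by (simp add: D_def)
qed

section \<open>Functions of class \<open>C\<^sup>m\<close> and Lie derivatives\<close>

lemma Ck_on_SucD: "Ck_on (Suc m) g D \<Longrightarrow> Ck_on m g D"
proof (induction m arbitrary: g)
  case 0
  then show ?case
    by (auto intro!: continuous_at_imp_continuous_on differentiable_imp_continuous_within)
next
  case (Suc m)
  then show ?case by (metis Ck_on.simps(2))
qed

lemma Ck_on_le: "Ck_on m' g D \<Longrightarrow> m \<le> m' \<Longrightarrow> Ck_on m g D"
proof (induction m')
  case (Suc m')
  then show ?case using Ck_on_SucD le_Suc_eq by metis
qed auto

lemma Ck_on_subset: "Ck_on m g D \<Longrightarrow> E \<subseteq> D \<Longrightarrow> Ck_on m g E"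
  by (induction m arbitrary: g) (auto intro: continuous_on_subset)

lemma Ck_on_imp_continuous_on: "Ck_on m g D \<Longrightarrow> continuous_on D g"
  using Ck_on_le[of m g D 0] by auto

lemma Ck_on_imp_differentiable: "Ck_on m g D \<Longrightarrow> 0 < m \<Longrightarrow> p \<in> D \<Longrightarrow> g differentiable (at p)"
  by (cases m) auto

lemma frechet_derivative_cong_open:
  assumes "open D" "p \<in> D" "\<And>q. q \<in> D \<Longrightarrow> g q = g' q"
  shows "frechet_derivative g (at p) = frechet_derivative g' (at p)"
proof -
  have "(g has_derivative g1) (at p) \<longleftrightarrow> (g' has_derivative g1) (at p)" for g1
    using has_derivative_transform_within_open[OF _ assms(1,2), of g g1 UNIV g']
      has_derivative_transform_within_open[OF _ assms(1,2), of g' g1 UNIV g] assms(3) by auto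
  then show ?thesis by (simp add: frechet_derivative_def)
qed

lemma Ck_on_cong:
  assumes "open D" "\<And>q. q \<in> D \<Longrightarrow> g q = g' q" "Ck_on m g D"
  shows "Ck_on m g' D"
  using assms(2,3)
proof (induction m arbitrary: g g')
  case 0
  then show ?case using continuous_on_cong by force
next
  case (Suc m)
  have "g' differentiable (at p)" if "p \<in> D" for p
    using that Suc.prems has_derivative_transform_within_open[OF _ assms(1) that, of g _ UNIV g']
    unfolding differentiable_def by (metis Ck_on.simps(2) differentiable_def)
  moreover have "Ck_on m (\<lambda>p. frechet_derivative g' (at p) v) D" for v
  proof (rule Suc.IH)
    show "Ck_on m (\<lambda>p. frechet_derivative g (at p) v) D" using Suc.prems by auto
    show "frechet_derivative g (at q) v = frechet_derivative g' (at q) v" if "q \<in> D" for q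
      using frechet_derivative_cong_open[OF assms(1) that] Suc.prems(1) by metis
  qed
  ultimately show ?case by auto
qed

section \<open>Algebra of functions of class C^m\<close>

lemma Ck_on_const: "Ck_on m (\<lambda>_. c) D"
  by (induction m arbitrary: c) auto

lemma Ck_on_bounded_linear: "bounded_linear g \<Longrightarrow> Ck_on m g D"
  by (cases m)
     (auto simp: linear_continuous_on bounded_linear_imp_differentiable Ck_on_const
        frechet_derivative_at[OF bounded_linear_imp_has_derivative, symmetric])

lemma Ck_on_add:
  assumes "open D" "Ck_on m f D" "Ck_on m g D"
  shows "Ck_on m (\<lambda>p. f p + g p) D"
  using assms(2,3)
proof (induction m arbitrary: f g)
  case (Suc m)
  have "Ck_on m (\<lambda>p. frechet_derivative (\<lambda>p. f p + g p) (at p) v) D" for v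
  proof (rule Ck_on_cong[OF assms(1)])
    show "Ck_on m (\<lambda>p. frechet_derivative f (at p) v + frechet_derivative g (at p) v) D"
      by (rule Suc.IH) (use Suc.prems in auto)
    show "frechet_derivative f (at q) v + frechet_derivative g (at q) v
        = frechet_derivative (\<lambda>p. f p + g p) (at q) v" if "q \<in> D" for q
    proof -
      have "((\<lambda>p. f p + g p) has_derivative
          (\<lambda>v. frechet_derivative f (at q) v + frechet_derivative g (at q) v)) (at q)"
        by (intro has_derivative_add) (use Suc.prems that in \<open>auto simp: frechet_derivative_works[symmetric]\<close>)
      from frechet_derivative_at[OF this] show ?thesis by metis
    qed
  qed
  then show ?case using Suc.prems by (auto intro: differentiable_add)
qed (auto intro: continuous_on_add)

lemma Ck_on_mult:
  fixes f g :: "'a::real_normed_vector \<Rightarrow> real"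
  assumes "open D" "Ck_on m f D" "Ck_on m g D"
  shows "Ck_on m (\<lambda>p. f p * g p) D"
  using assms(2,3)
proof (induction m arbitrary: f g)
  case (Suc m)
  have "Ck_on m (\<lambda>p. frechet_derivative (\<lambda>p. f p * g p) (at p) v) D" for v
  proof (rule Ck_on_cong[OF assms(1)])
    show "Ck_on m (\<lambda>p. f p * frechet_derivative g (at p) v + frechet_derivative f (at p) v * g p) D"
      by (intro Ck_on_add assms(1) Suc.IH Ck_on_SucD[OF Suc.prems(1)] Ck_on_SucD[OF Suc.prems(2)])
         (use Suc.prems in auto)
    show "f q * frechet_derivative g (at q) v + frechet_derivative f (at q) v * g q
        = frechet_derivative (\<lambda>p. f p * g p) (at q) v" if "q \<in> D" for q
    proof -
      have "((\<lambda>p. f p * g p) has_derivative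
          (\<lambda>v. f q * frechet_derivative g (at q) v + frechet_derivative f (at q) v * g q)) (at q)"
        by (intro has_derivative_mult) (use Suc.prems that in \<open>auto simp: frechet_derivative_works[symmetric]\<close>)
      from frechet_derivative_at[OF this] show ?thesis by metis
    qed
  qed
  then show ?case using Suc.prems by (auto intro: differentiable_mult)
qed (auto intro: continuous_on_mult)

lemma Ck_on_bounded_linear_compose:
  assumes "open D" "bounded_linear l" "Ck_on m g D"
  shows "Ck_on m (\<lambda>p. l (g p)) D"
  using assms(3)
proof (induction m arbitrary: g)
  case 0
  then show ?case using bounded_linear.continuous_on[OF assms(2)] by auto
next
  case (Suc m)
  have der: "((\<lambda>p. l (g p)) has_derivative (\<lambda>v. l (frechet_derivative g (at q) v))) (at q)"
    if "q \<in> D" for q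
    by (rule bounded_linear.has_derivative[OF assms(2)])
       (use Suc.prems that in \<open>auto simp: frechet_derivative_works[symmetric]\<close>)
  have "Ck_on m (\<lambda>p. frechet_derivative (\<lambda>p. l (g p)) (at p) v) D" for v
  proof (rule Ck_on_cong[OF assms(1)])
    show "Ck_on m (\<lambda>p. l (frechet_derivative g (at p) v)) D"
      by (rule Suc.IH) (use Suc.prems in auto)
    show "l (frechet_derivative g (at q) v) = frechet_derivative (\<lambda>p. l (g p)) (at q) v"
      if "q \<in> D" for q using frechet_derivative_at[OF der[OF that]] by metis
  qed
  then show ?case using der by (auto simp: differentiable_def)
qed

section \<open>Gradients and iterated Lie derivatives in the plane\<close>

lemma has_derivative_Pair_eq:
  fixes g :: "real \<times> real \<Rightarrow> 'b::real_normed_vector"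
  assumes "(g has_derivative g') F"
  shows "g' v = fst v *\<^sub>R g' (1, 0) + snd v *\<^sub>R g' (0, 1)"
proof -
  interpret bounded_linear g' using assms by (rule has_derivative_bounded_linear)
  have "v = fst v *\<^sub>R (1, 0) + snd v *\<^sub>R (0, 1)" by (simp add: prod_eq_iff)
  then show ?thesis by (metis add scaleR)
qed

text \<open>In the plane the partial derivatives are the coordinates of the gradient; exhibiting it
  shows that the definite description in \<open>grad\<close> is proper.\<close>

lemma lie_eq_frechet_derivative:
  fixes g :: "real \<times> real \<Rightarrow> real"
  assumes "g differentiable (at p)"
  shows "lie X g p = frechet_derivative g (at p) (X p)"
proof -
  let ?g' = "frechet_derivative g (at p)"
  have g': "(g has_derivative ?g') (at p)" using assms frechet_derivative_works by blast
  define D where "D = (?g' (1, 0), ?g' (0, 1))"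
  have D: "v \<bullet> D = ?g' v" for v
    by (subst has_derivative_Pair_eq[OF g']) (simp add: D_def inner_prod_def)
  have "grad g p = D"
    unfolding grad_def
  proof (rule the_equality)
    show "GDERIV g p :> D" using g' by (simp add: gderiv_def D)
    show "E = D" if "GDERIV g p :> E" for E
    proof -
      have "(\<lambda>v. v \<bullet> E) = ?g'"
        using that g' has_derivative_unique unfolding gderiv_def by blast
      then have "v \<bullet> E = v \<bullet> D" for v using D by metis
      then show ?thesis using vector_eq_ldot by blast
    qed
  qed
  then show ?thesis by (simp add: lie_def inner_commute[of D] D)
qed

lemma Ck_on_lie:
  fixes g :: "real \<times> real \<Rightarrow> real"
  assumes "open D" "Ck_on m X D" "Ck_on (Suc m) g D"
  shows "Ck_on m (lie X g) D"
proof (rule Ck_on_cong[OF assms(1)])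
  show "Ck_on m (\<lambda>p. fst (X p) * frechet_derivative g (at p) (1, 0)
      + snd (X p) * frechet_derivative g (at p) (0, 1)) D"
    by (intro Ck_on_add Ck_on_mult assms(1) Ck_on_bounded_linear_compose[OF _ bounded_linear_fst]
        Ck_on_bounded_linear_compose[OF _ bounded_linear_snd]) (use assms in auto)
  fix q assume q: "q \<in> D"
  then have g: "g differentiable (at q)" using assms by auto
  show "fst (X q) * frechet_derivative g (at q) (1, 0)
      + snd (X q) * frechet_derivative g (at q) (0, 1) = lie X g q"
    unfolding lie_eq_frechet_derivative[OF g]
    by (subst (3) has_derivative_Pair_eq[OF frechet_derivative_works[THEN iffD1, OF g]]) simp
qed

text \<open>One order is lost per Lie derivative. \<open>h\<close> may be assumed one class better
  than \<open>X\<close> because near the fold it is a coordinate.\<close>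

lemma Ck_on_funpow_lie:
  fixes h :: "real \<times> real \<Rightarrow> real"
  assumes "open D" "Ck_on m X D" "Ck_on (Suc m) h D" "i \<le> m"
  shows "Ck_on (Suc m - i) ((lie X ^^ i) h) D"
  using assms(4)
proof (induction i)
  case (Suc i)
  then have "Ck_on (Suc (m - i)) ((lie X ^^ i) h) D" by (simp add: Suc_diff_le)
  then have "Ck_on (m - i) (lie X ((lie X ^^ i) h)) D"
    by (intro Ck_on_lie assms Ck_on_le[OF assms(2)]) auto
  then show ?case by simp
qed (use assms in auto)

text \<open>The iterated Lie derivatives are the successive time derivatives of \<open>h\<close>
  along a trajectory, so a contact of multiplicity \<open>2 * k\<close> becomes a statement about
  Taylor coefficients in time.\<close>

lemma funpow_lie_along_trajectory:
  fixes h :: "real \<times> real \<Rightarrow> real"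
  assumes "open D" "Ck_on m X D" "Ck_on (Suc m) h D" "i \<le> m" "\<gamma> t \<in> D"
    and "(\<gamma> has_vector_derivative X (\<gamma> t)) (at t)"
  shows "((\<lambda>t. (lie X ^^ i) h (\<gamma> t)) has_real_derivative (lie X ^^ Suc i) h (\<gamma> t)) (at t)"
proof -
  let ?g = "(lie X ^^ i) h"
  have d: "?g differentiable (at (\<gamma> t))"
    using Ck_on_funpow_lie[OF assms(1-4)] assms(4,5) by (auto intro: Ck_on_imp_differentiable)
  have "(?g has_derivative frechet_derivative ?g (at (\<gamma> t))) (at (\<gamma> t))"
    using d frechet_derivative_works by blast
  moreover from this interpret bounded_linear "frechet_derivative ?g (at (\<gamma> t))"
    by (rule has_derivative_bounded_linear)
  have "((\<lambda>t. ?g (\<gamma> t)) has_derivative (\<lambda>s. frechet_derivative ?g (at (\<gamma> t)) (s *\<^sub>R X (\<gamma> t)))) (at t)"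
    using has_derivative_compose[OF assms(6)[unfolded has_vector_derivative_def]] calculation by blast
  then show ?thesis
    by (simp add: has_field_derivative_def lie_eq_frechet_derivative[OF d] scaleR mult.commute[of "frechet_derivative _ _ _"]
        mult_commute_abs)
qed

text \<open>Nearest point retraction onto a square: composing with it extends a field from the
  square to a globally Lipschitz one.\<close>

definition box_clamp :: "real \<Rightarrow> real \<times> real \<Rightarrow> real \<times> real" where
  "box_clamp R p = (max (-R) (min R (fst p)), max (-R) (min R (snd p)))"

lemma box_clamp_in: "0 \<le> R \<Longrightarrow> box_clamp R p \<in> {-R..R} \<times> {-R..R}"
  by (auto simp: box_clamp_def)

lemma box_clamp_id: "p \<in> {-R..R} \<times> {-R..R} \<Longrightarrow> box_clamp R p = p"
  by (auto simp: box_clamp_def)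

lemma lipschitz_box_clamp: "1-lipschitz_on UNIV (box_clamp R)"
proof (rule lipschitz_onI)
  fix p q :: "real \<times> real"
  have "dist (box_clamp R p) (box_clamp R q) = sqrt ((dist (max (-R) (min R (fst p))) (max (-R) (min R (fst q))))\<^sup>2
      + (dist (max (-R) (min R (snd p))) (max (-R) (min R (snd q))))\<^sup>2)"
    by (simp add: box_clamp_def dist_Pair_Pair)
  also have "\<dots> \<le> sqrt ((dist (fst p) (fst q))\<^sup>2 + (dist (snd p) (snd q))\<^sup>2)"
    by (intro real_sqrt_le_mono add_mono power_mono) (auto simp: dist_real_def)
  also have "\<dots> = 1 * dist p q" by (simp add: dist_prod_def)
  finally show "dist (box_clamp R p) (box_clamp R q) \<le> 1 * dist p q" .
qed auto

lemma Ck_on_lipschitz_box: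
  fixes X :: "real \<times> real \<Rightarrow> 'b::real_normed_vector"
  assumes "Ck_on m X V" "0 < m" "{-R..R} \<times> {-R..R} \<subseteq> V"
  shows "\<exists>L. L-lipschitz_on ({-R..R} \<times> {-R..R}) X"
proof -
  let ?Q = "{-R..R} \<times> {-R..R}"
  have C1: "Ck_on (Suc 0) X V" using Ck_on_le[OF assms(1), of "Suc 0"] assms(2) by (simp del: Ck_on.simps)
  have "\<exists>B. \<forall>p\<in>?Q. norm (frechet_derivative X (at p) v) \<le> B" for v
  proof -
    have "continuous_on ?Q (\<lambda>p. frechet_derivative X (at p) v)"
      by (rule continuous_on_subset[OF _ assms(3)]) (use C1 in \<open>cases v, auto\<close>)
    then have "bounded ((\<lambda>p. frechet_derivative X (at p) v) ` ?Q)"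
      by (intro compact_imp_bounded compact_continuous_image compact_Times compact_Icc)
    then show ?thesis by (auto simp: bounded_iff)
  qed
  then obtain B where B: "\<And>v p. p \<in> ?Q \<Longrightarrow> norm (frechet_derivative X (at p) v) \<le> B v" by metis
  have "norm (X p - X q) \<le> (\<bar>B (1, 0)\<bar> + \<bar>B (0, 1)\<bar>) * norm (p - q)" if "p \<in> ?Q" "q \<in> ?Q" for p q
  proof (rule differentiable_bound[OF _ _ _ that])
    show "convex ?Q" by (intro convex_Times convex_real_interval)
    fix p assume p: "p \<in> ?Q"
    then have d: "(X has_derivative frechet_derivative X (at p)) (at p)"
      using C1 assms(3) frechet_derivative_works by auto
    then show "(X has_derivative frechet_derivative X (at p)) (at p within ?Q)"
      by (rule has_derivative_at_withinI)
    show "onorm (frechet_derivative X (at p)) \<le> \<bar>B (1, 0)\<bar> + \<bar>B (0, 1)\<bar>"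
    proof (rule onorm_le)
      fix v
      have "norm (frechet_derivative X (at p) v)
          \<le> \<bar>fst v\<bar> * norm (frechet_derivative X (at p) (1, 0)) + \<bar>snd v\<bar> * norm (frechet_derivative X (at p) (0, 1))"
        by (subst has_derivative_Pair_eq[OF d]) (rule norm_triangle_le, simp)
      also have "\<dots> \<le> norm v * \<bar>B (1, 0)\<bar> + norm v * \<bar>B (0, 1)\<bar>"
        using B[OF p, of "(1, 0)"] B[OF p, of "(0, 1)"] norm_fst_le[of "fst v" "snd v"] norm_snd_le[of "snd v" "fst v"]
        by (intro add_mono mult_mono) auto
      finally show "norm (frechet_derivative X (at p) v) \<le> (\<bar>B (1, 0)\<bar> + \<bar>B (0, 1)\<bar>) * norm v"
        by (simp add: algebra_simps)
    qed
  qed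
  then show ?thesis
    by (intro exI[of _ "\<bar>B (1, 0)\<bar> + \<bar>B (0, 1)\<bar>"] lipschitz_onI) (auto simp: dist_norm)
qed

text \<open>The contact conditions are read along the trajectory through the origin, where Taylor's
  formula gives a vertical speed of exact order \<open>t ^ (2 * k - 1)\<close>, while the abscissa
  is of order \<open>t\<close> and the ordinate of order \<open>t ^ (2 * k)\<close>. Moving
  vertically from the trajectory to the axis changes the field by at most \<open>L\<close> times the
  ordinate, which is one order smaller, so the estimate carries over to the axis.\<close>

lemma fold_contact_estimate:
  fixes X F :: "real \<times> real \<Rightarrow> real \<times> real" and h :: "real \<times> real \<Rightarrow> real"
  assumes "open D" "Ck_on (2 * k) X D" and k: "1 \<le> k" and "(0, 0) \<in> D"
    and h: "\<And>p. p \<in> D \<Longrightarrow> h p = snd p"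
    and contact: "visible_contact k X h (0, 0)" and X1: "0 < fst (X (0, 0))"
    and lip: "L-lipschitz_on UNIV F" and F: "\<And>p. p \<in> D \<Longrightarrow> F p = X p"
  shows "\<exists>a>0. \<exists>A r. 0 < r \<and> (\<forall>x. \<bar>x\<bar> \<le> r \<longrightarrow>
    a * \<bar>x\<bar> ^ (2 * k - 1) \<le> sgn x * snd (F (x, 0)) \<and> \<bar>snd (F (x, 0))\<bar> \<le> A * \<bar>x\<bar> ^ (2 * k - 1))"
proof -
  define j where "j = 2 * k - 1"
  have j: "odd j" "2 * k = Suc j" using k by (auto simp: j_def)
  have Ckh: "Ck_on (Suc (2 * k)) h D"
    by (rule Ck_on_cong[OF \<open>open D\<close> _ Ck_on_bounded_linear[OF bounded_linear_snd]]) (simp add: h)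
  \<comment> \<open>Shifted by one, so that \<open>g 0\<close> is the vertical speed and
    \<open>g j\<close> the first Lie derivative that does not vanish at the origin.\<close>
  define g where "g = (\<lambda>i. (lie X ^^ Suc i) h)"
  have lie1: "g 0 p = snd (X p)" if "p \<in> D" for p
  proof -
    have der: "(h has_derivative snd) (at p)"
      by (rule has_derivative_transform_within_open[OF _ \<open>open D\<close> that, of snd snd])
         (auto simp: h intro!: derivative_eq_intros)
    then have "h differentiable (at p)" by (auto simp: differentiable_def)
    from lie_eq_frechet_derivative[OF this] show ?thesis
      using frechet_derivative_at[OF der] by (simp add: g_def)
  qed
  have L: "L \<ge> 0" using lip lipschitz_on_nonneg by blast
  define f where "f = (fact j :: real)"
  have f: "f > 0" by (simp add: f_def)
  define b where "b = g j (0, 0)"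
  have b: "b > 0" using contact j by (simp add: visible_contact_def b_def g_def)
  define m where "m = fst (X (0, 0)) / 2"
  define M where "M = 2 * fst (X (0, 0))"
  have m: "0 < m" "0 < M" using X1 by (auto simp: m_def M_def)
  from picard_global[OF lip, of "(0, 0)"] obtain e \<gamma> where e: "e > 0" and \<gamma>0: "\<gamma> 0 = (0, 0)"
    and \<gamma>: "\<And>t. t \<in> {-e..e} \<Longrightarrow> (\<gamma> has_vector_derivative F (\<gamma> t)) (at t within {-e..e})"
    by (metis less_imp_le)
  have \<gamma>': "(\<gamma> has_vector_derivative F (\<gamma> t)) (at t)" if "\<bar>t\<bar> < e" for t
    using \<gamma>[of t] that by (simp add: at_within_Icc_at abs_less_iff)
  have isc: "continuous (at p) (g j)" "continuous (at p) (\<lambda>p. fst (X p))" if "p \<in> D" for p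
    using Ck_on_imp_continuous_on[OF Ck_on_funpow_lie[OF \<open>open D\<close> assms(2) Ckh, of "2 * k"]]
      Ck_on_imp_continuous_on[OF assms(2)] that j \<open>open D\<close>
    by (auto simp: g_def continuous_on_eq_continuous_at intro!: continuous_intros)
  have tg: "(g j \<longlongrightarrow> b) (nhds (0, 0))"
    and tx: "((\<lambda>p. fst (X p)) \<longlongrightarrow> fst (X (0, 0))) (nhds (0, 0))"
    using isc[OF \<open>(0, 0) \<in> D\<close>] tendsto_at_iff_tendsto_nhds[of "\<lambda>p. fst (X p)" "(0, 0)"]
    by (auto simp: isCont_def b_def tendsto_at_iff_tendsto_nhds)
  have "\<forall>\<^sub>F p in nhds (0, 0). p \<in> D \<and> m < fst (X p) \<and> fst (X p) < M \<and> b / 2 < g j p \<and> g j p < 2 * b"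
    using m b by (intro eventually_conj eventually_nhds_in_open \<open>open D\<close> \<open>(0, 0) \<in> D\<close>
        order_tendstoD[OF tx] order_tendstoD[OF tg]) (auto simp: m_def M_def)
  moreover have "filterlim \<gamma> (nhds (0, 0)) (nhds 0)"
    using has_vector_derivative_continuous[OF \<gamma>'[of 0]] e \<gamma>0 tendsto_at_iff_tendsto_nhds[of \<gamma> 0]
    by (simp add: isCont_def)
  ultimately have "\<forall>\<^sub>F t in nhds 0. \<gamma> t \<in> D \<and> m < fst (X (\<gamma> t)) \<and> fst (X (\<gamma> t)) < M \<and>
      b / 2 < g j (\<gamma> t) \<and> g j (\<gamma> t) < 2 * b"
    by (rule eventually_compose_filterlim)
  then obtain d where d: "d > 0" "\<And>t. \<bar>t\<bar> < d \<Longrightarrow> \<gamma> t \<in> D \<and> m < fst (X (\<gamma> t)) \<and> fst (X (\<gamma> t)) < M \<and>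
      b / 2 < g j (\<gamma> t) \<and> g j (\<gamma> t) < 2 * b"
    unfolding eventually_nhds_metric by (auto simp: dist_real_def)
  \<comment> \<open>As \<open>g j\<close> stays between \<open>b / 2\<close> and
    \<open>2 * b\<close>, the Taylor coefficient \<open>g j / fact j\<close> lies between
    \<open>\<beta>\<close> and \<open>4 * \<beta>\<close>.\<close>
  define \<beta> where "\<beta> = b / (2 * f)"
  have \<beta>: "\<beta> > 0" "b / f = 2 * \<beta>" using b f by (auto simp: \<beta>_def field_simps)
  \<comment> \<open>The second bound makes the vertical correction
    \<open>L * (4 * \<beta> * \<bar>t\<bar> ^ j * t1)\<close> at most half of the main term
    \<open>\<beta> * \<bar>t\<bar> ^ j\<close>.\<close>
  define t1 where "t1 = min (min e d / 2) (\<beta> / (8 * L * \<beta> + 1))"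
  have den: "8 * L * \<beta> + 1 > 0" using L \<beta> by (smt (verit) mult_nonneg_nonneg)
  have t1: "0 < t1" "t1 < e" "t1 < d" proof -
    have "0 < \<beta> / (8 * L * \<beta> + 1)" using \<beta>(1) den by (rule divide_pos_pos)
    then show "0 < t1" using e d(1) by (auto simp: t1_def)
    have "t1 \<le> min e d / 2" unfolding t1_def by (rule min.cobounded1)
    then show "t1 < e" "t1 < d" using e d(1) by auto
  qed
  have "t1 \<le> \<beta> / (8 * L * \<beta> + 1)" by (simp add: t1_def)
  then have "t1 * (8 * L * \<beta> + 1) \<le> \<beta>" using den by (simp add: field_simps)
  then have t1L: "8 * L * \<beta> * t1 \<le> \<beta>" using t1(1) by (simp add: algebra_simps)
  define x where "x = (\<lambda>t. fst (\<gamma> t))"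
  define y where "y = (\<lambda>t. snd (\<gamma> t))"
  have XD: "F (\<gamma> t) = X (\<gamma> t)" if "\<bar>t\<bar> \<le> t1" for t using d(2)[of t] that t1 F by auto
  have \<gamma>X: "(\<gamma> has_vector_derivative X (\<gamma> t)) (at t)" if "\<bar>t\<bar> \<le> t1" for t
    using \<gamma>'[of t] XD[of t] that t1 by auto
  have x': "(x has_real_derivative fst (X (\<gamma> t))) (at t)"
    and y': "(y has_real_derivative snd (X (\<gamma> t))) (at t)" if "\<bar>t\<bar> \<le> t1" for t
    using \<gamma>X[OF that] unfolding x_def y_def has_real_derivative_iff_has_vector_derivative has_vector_derivative_def
    by (auto intro!: derivative_eq_intros)
  have X2: "\<exists>B. \<beta> \<le> B \<and> B \<le> 4 * \<beta> \<and> snd (X (\<gamma> t)) = B * t ^ j" if t: "\<bar>t\<bar> \<le> t1" for t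
  proof -
    have "\<exists>s. \<bar>s\<bar> \<le> \<bar>t\<bar> \<and> g 0 (\<gamma> t) =
        (\<Sum>i<j. g i (\<gamma> 0) / fact i * t ^ i) + g j (\<gamma> s) / fact j * t ^ j"
    proof (rule Maclaurin_bi_le[where diff = "\<lambda>i t. g i (\<gamma> t)"], simp, intro allI impI)
      fix i s assume si: "i < j \<and> \<bar>s\<bar> \<le> \<bar>t\<bar>"
      show "((\<lambda>t. g i (\<gamma> t)) has_real_derivative g (Suc i) (\<gamma> s)) (at s)"
        unfolding g_def
        by (rule funpow_lie_along_trajectory[OF \<open>open D\<close> assms(2) Ckh])
           (use si t t1 j d(2)[of s] \<gamma>X[of s] in auto)
    qed
    moreover have "g i (\<gamma> 0) = 0" if "i < j" for i
      using contact that j by (simp add: visible_contact_def g_def \<gamma>0 del: funpow.simps)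
    ultimately obtain s where s: "\<bar>s\<bar> \<le> \<bar>t\<bar>" "g 0 (\<gamma> t) = g j (\<gamma> s) / f * t ^ j"
      by (auto simp: f_def)
    have "\<beta> \<le> g j (\<gamma> s) / f" "g j (\<gamma> s) / f \<le> 4 * \<beta>"
      using d(2)[of s] s t t1 f by (auto simp: \<beta>_def field_simps)
    then show ?thesis using s lie1[of "\<gamma> t"] d(2)[of t] t t1 by auto
  qed
  have xt: "\<exists>B. m \<le> B \<and> B \<le> M \<and> x t = B * t" if t: "\<bar>t\<bar> \<le> t1" for t
  proof -
    have "\<exists>s. \<bar>s\<bar> \<le> \<bar>t\<bar> \<and> x t = (\<Sum>i<1. (if i = 0 then x else (\<lambda>s. fst (X (\<gamma> s)))) 0 / fact i * t ^ i)
        + (if (1::nat) = 0 then x else (\<lambda>s. fst (X (\<gamma> s)))) s / fact 1 * t ^ 1"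
      by (rule Maclaurin_bi_le) (use x' t in auto)
    then obtain s where "\<bar>s\<bar> \<le> \<bar>t\<bar>" "x t = fst (X (\<gamma> s)) * t" by (auto simp: x_def \<gamma>0)
    then show ?thesis using d(2)[of s] t t1 by (intro exI[of _ "fst (X (\<gamma> s))"]) auto
  qed
  have yt: "\<bar>y t\<bar> \<le> 4 * \<beta> * \<bar>t\<bar> ^ j * \<bar>t\<bar>" if t: "\<bar>t\<bar> \<le> t1" for t
  proof -
    have "\<exists>s. \<bar>s\<bar> \<le> \<bar>t\<bar> \<and> y t = (\<Sum>i<1. (if i = 0 then y else (\<lambda>s. snd (X (\<gamma> s)))) 0 / fact i * t ^ i)
        + (if (1::nat) = 0 then y else (\<lambda>s. snd (X (\<gamma> s)))) s / fact 1 * t ^ 1"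
      by (rule Maclaurin_bi_le) (use y' t in auto)
    then obtain s where s: "\<bar>s\<bar> \<le> \<bar>t\<bar>" "y t = snd (X (\<gamma> s)) * t" by (auto simp: y_def \<gamma>0)
    from X2[of s] s t obtain B where B: "\<beta> \<le> B" "B \<le> 4 * \<beta>" "snd (X (\<gamma> s)) = B * s ^ j" by auto
    have "\<bar>y t\<bar> = B * \<bar>s\<bar> ^ j * \<bar>t\<bar>" using s(2) B \<beta> by (simp add: abs_mult power_abs)
    also have "\<dots> \<le> 4 * \<beta> * \<bar>t\<bar> ^ j * \<bar>t\<bar>"
      using B \<beta> s(1) by (intro mult_mono power_mono) auto
    finally show ?thesis .
  qed
  \<comment> \<open>Half of \<open>\<beta>\<close> is left after the vertical move, and
    \<open>4 * \<beta> + \<beta> / 2\<close> is below \<open>5 * \<beta>\<close>; the powers of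
    \<open>M\<close> and \<open>m\<close> convert time into abscissa.\<close>
  define a where "a = \<beta> / 2 / M ^ j"
  define A where "A = 5 * \<beta> / m ^ j"
  have "a * \<bar>z\<bar> ^ j \<le> sgn z * snd (F (z, 0)) \<and> \<bar>snd (F (z, 0))\<bar> \<le> A * \<bar>z\<bar> ^ j" if z: "\<bar>z\<bar> \<le> m * t1" for z
  proof -
    have cx: "continuous_on {-t1..t1} x"
      by (intro continuous_at_imp_continuous_on ballI DERIV_isCont[OF x']) auto
    obtain B1 where "m \<le> B1" "x t1 = B1 * t1" using xt[of t1] t1 by auto
    then have "z \<le> x t1" using z t1 mult_right_mono[of m B1 t1] by linarith
    moreover obtain B2 where "m \<le> B2" "x (-t1) = - (B2 * t1)" using xt[of "-t1"] t1 by auto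
    then have "x (-t1) \<le> z" using z t1 mult_right_mono[of m B2 t1] by linarith
    ultimately obtain t where t: "-t1 \<le> t" "t \<le> t1" "x t = z"
      using IVT'[of x "-t1" z t1] cx t1 by auto
    then have t': "\<bar>t\<bar> \<le> t1" by auto
    obtain B where B: "m \<le> B" "B \<le> M" "z = B * t" using xt[OF t'] t by auto
    have sg: "sgn z = sgn t" using B m by (simp add: sgn_mult)
    have lo: "m * \<bar>t\<bar> \<le> \<bar>z\<bar>" and hi: "\<bar>z\<bar> \<le> M * \<bar>t\<bar>"
      using B m by (auto simp: abs_mult intro!: mult_right_mono)
    obtain C where C: "\<beta> \<le> C" "C \<le> 4 * \<beta>" "snd (X (\<gamma> t)) = C * t ^ j" using X2[OF t'] by blast
    have tj: "sgn t * t ^ j = \<bar>t\<bar> ^ j"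
      using j(1) by (cases "t \<ge> 0") (auto simp: sgn_if power_minus_odd zero_power odd_pos power_abs)
    have "dist (F (z, 0)) (F (\<gamma> t)) \<le> L * dist (z, 0) (\<gamma> t)"
      using lipschitz_onD[OF lip] by auto
    also have "dist (z, 0) (\<gamma> t) = \<bar>y t\<bar>"
      using t(3) by (cases "\<gamma> t") (simp add: x_def y_def dist_Pair_Pair dist_real_def)
    also have "L * \<bar>y t\<bar> \<le> L * (4 * \<beta> * \<bar>t\<bar> ^ j * \<bar>t\<bar>)"
      by (intro mult_left_mono yt t' L)
    also have "\<dots> \<le> L * (4 * \<beta> * \<bar>t\<bar> ^ j * t1)"
      using t' L \<beta> by (intro mult_left_mono) auto
    also have "\<dots> = (8 * L * \<beta> * t1) / 2 * \<bar>t\<bar> ^ j" by simp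
    also have "\<dots> \<le> \<beta> / 2 * \<bar>t\<bar> ^ j" using t1L by (intro mult_right_mono) auto
    finally have "dist (F (z, 0)) (F (\<gamma> t)) \<le> \<beta> / 2 * \<bar>t\<bar> ^ j" .
    then have df: "\<bar>snd (F (z, 0)) - C * t ^ j\<bar> \<le> \<beta> / 2 * \<bar>t\<bar> ^ j"
      using dist_snd_le[of "F (z, 0)" "F (\<gamma> t)"] XD[OF t'] C(3) by (simp add: dist_real_def)
    have "a * \<bar>z\<bar> ^ j \<le> a * (M * \<bar>t\<bar>) ^ j"
      using hi \<beta> m by (intro mult_left_mono power_mono) (auto simp: a_def)
    also have "\<dots> = \<beta> / 2 * \<bar>t\<bar> ^ j" using m by (simp add: a_def power_mult_distrib)
    also have "\<dots> = \<beta> * \<bar>t\<bar> ^ j - \<beta> / 2 * \<bar>t\<bar> ^ j" by simp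
    also have "\<dots> \<le> C * \<bar>t\<bar> ^ j - \<bar>snd (F (z, 0)) - C * t ^ j\<bar>"
      using C df by (intro diff_mono mult_right_mono) auto
    also have "\<dots> \<le> sgn t * snd (F (z, 0))"
    proof -
      let ?w = "snd (F (z, 0)) - C * t ^ j"
      have "sgn t * snd (F (z, 0)) = C * (sgn t * t ^ j) + sgn t * ?w" by (simp add: algebra_simps)
      also have "\<dots> = C * \<bar>t\<bar> ^ j + sgn t * ?w" by (simp only: tj)
      finally have "sgn t * snd (F (z, 0)) = C * \<bar>t\<bar> ^ j + sgn t * ?w" .
      moreover have "- \<bar>?w\<bar> \<le> sgn t * ?w" by (auto simp: sgn_if)
      ultimately show ?thesis by linarith
    qed
    finally have 1: "a * \<bar>z\<bar> ^ j \<le> sgn z * snd (F (z, 0))" by (simp add: sg)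
    have "\<bar>snd (F (z, 0))\<bar> \<le> C * \<bar>t\<bar> ^ j + \<beta> / 2 * \<bar>t\<bar> ^ j"
    proof -
      have "\<bar>C * t ^ j\<bar> = C * \<bar>t\<bar> ^ j" using C \<beta> by (simp add: abs_mult power_abs)
      then show ?thesis using df by linarith
    qed
    also have "\<dots> \<le> 5 * \<beta> * \<bar>t\<bar> ^ j"
    proof -
      have "C * \<bar>t\<bar> ^ j \<le> 4 * \<beta> * \<bar>t\<bar> ^ j" using C by (intro mult_right_mono) auto
      moreover have "0 \<le> \<beta> * \<bar>t\<bar> ^ j" using \<beta> by auto
      ultimately show ?thesis by linarith
    qed
    also have "\<dots> = A * (m * \<bar>t\<bar>) ^ j" using m by (simp add: A_def power_mult_distrib)
    also have "\<dots> \<le> A * \<bar>z\<bar> ^ j"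
      using lo \<beta> m by (intro mult_left_mono power_mono) (auto simp: A_def)
    finally show ?thesis using 1 by blast
  qed
  moreover have "a > 0" "m * t1 > 0" using \<beta> m t1 by (auto simp: a_def)
  ultimately show ?thesis unfolding j_def[symmetric] by blast
qed

section \<open>Transition functions\<close>

text \<open>\<open>Ck_on\<close> speaks of Frechet derivatives, the transition class of iterated
  \<open>deriv\<close>; smoothness lets one pass from the first to the second at every
  order.\<close>

lemma deriv_funpow_smooth:
  fixes \<phi> :: "real \<Rightarrow> real"
  assumes "\<And>m. Ck_on m \<phi> UNIV"
  shows "((deriv ^^ i) \<phi> has_real_derivative (deriv ^^ Suc i) \<phi> t) (at t)"
proof -
  have D: "(f has_real_derivative deriv f t) (at t)" if "f differentiable (at t)" for f :: "real \<Rightarrow> real" and t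
    using that real_differentiable_def DERIV_imp_deriv by metis
  have "\<forall>m. Ck_on m ((deriv ^^ i) \<phi>) UNIV"
  proof (induction i)
    case (Suc i)
    let ?f = "(deriv ^^ i) \<phi>"
    have d: "?f differentiable (at t)" for t using Suc[rule_format, of "Suc 0"] by auto
    have "frechet_derivative ?f (at t) 1 = deriv ?f t" for t
      using frechet_derivative_at[OF D[OF d, unfolded has_field_derivative_def]] by (metis mult.right_neutral)
    moreover have "Ck_on m (\<lambda>t. frechet_derivative ?f (at t) 1) UNIV" for m
      using Suc[rule_format, of "Suc m"] by auto
    ultimately show ?case by (simp add: fun_eq_iff[symmetric])
  qed (use assms in auto)
  then have "(deriv ^^ i) \<phi> differentiable (at t)" by (metis Ck_on.simps(2) UNIV_I)
  from D[OF this] show ?thesis by simp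
qed

locale transition =
  fixes n :: nat and \<Phi> \<phi> :: "real \<Rightarrow> real"
  assumes n: "1 \<le> n"
    and inside: "\<bar>s\<bar> \<le> 1 \<Longrightarrow> \<Phi> s = \<phi> s" and outside: "\<bar>s\<bar> \<ge> 1 \<Longrightarrow> \<Phi> s = sgn s"
    and smooth: "Ck_on m \<phi> UNIV" and ends: "\<phi> 1 = 1" "\<phi> (-1) = -1"
    and pos: "s \<in> {-1<..<1} \<Longrightarrow> deriv \<phi> s > 0"
    and flat: "i \<in> {1..n - 1} \<Longrightarrow> (deriv ^^ i) \<phi> 1 = 0"
    and nflat: "(deriv ^^ n) \<phi> 1 \<noteq> 0"
begin

lemma D: "(\<phi> has_real_derivative deriv \<phi> t) (at t)"
  using deriv_funpow_smooth[OF smooth, of 0] by simp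

lemma cont_funpow: "continuous_on A ((deriv ^^ i) \<phi>)"
  using deriv_funpow_smooth[OF smooth, of i]
  by (intro continuous_at_imp_continuous_on ballI) (rule DERIV_isCont)

lemma cont_deriv: "continuous_on A (deriv \<phi>)"
  using cont_funpow[of A 1] by simp

lemma strict: "-1 \<le> s \<Longrightarrow> s < t \<Longrightarrow> t \<le> 1 \<Longrightarrow> \<phi> s < \<phi> t"
  using D pos DERIV_isCont[OF D]
  by (intro DERIV_pos_imp_increasing_open[of s t \<phi>]) (auto intro!: continuous_at_imp_continuous_on exI[of _ "deriv \<phi> _"])

lemma \<Phi>_clamp: "\<Phi> s = \<phi> (max (-1) (min 1 s))"
  using inside[of s] outside[of s] ends by (auto simp: max_def min_def sgn_if split: if_splits)

lemma mono_\<Phi>: "s \<le> t \<Longrightarrow> \<Phi> s \<le> \<Phi> t"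
  unfolding \<Phi>_clamp using strict[of "max (-1) (min 1 s)" "max (-1) (min 1 t)"]
  by (cases "max (-1) (min 1 s) = max (-1) (min 1 t)") (auto simp: max_def min_def split: if_splits)

lemma \<Phi>_gt: "-1 < s \<Longrightarrow> -1 < \<Phi> s"
  unfolding \<Phi>_clamp using strict[of "-1" "max (-1) (min 1 s)"] ends by (auto simp: max_def min_def)

lemma lipschitz_\<Phi>: "\<exists>L. L-lipschitz_on UNIV \<Phi>"
proof -
  have "bounded (deriv \<phi> ` {-1..1})"
    by (intro compact_imp_bounded compact_continuous_image compact_Icc cont_deriv)
  then obtain B where B: "\<And>t. t \<in> {-1..1} \<Longrightarrow> norm (deriv \<phi> t) \<le> B"
    unfolding bounded_iff by blast
  have "\<bar>\<Phi> s - \<Phi> t\<bar> \<le> \<bar>B\<bar> * \<bar>s - t\<bar>" for s t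
  proof -
    let ?s = "max (-1) (min 1 s)" and ?t = "max (-1) (min 1 t)"
    have "norm (\<phi> ?s - \<phi> ?t) \<le> B * norm (?s - ?t)"
      by (rule field_differentiable_bound[of "{-1..1}" _ "deriv \<phi>"])
         (use B D in \<open>auto intro: has_field_derivative_at_within\<close>)
    also have "\<dots> \<le> \<bar>B\<bar> * \<bar>s - t\<bar>" by (intro mult_mono) auto
    finally show ?thesis by (simp add: \<Phi>_clamp)
  qed
  then have "\<bar>B\<bar>-lipschitz_on UNIV \<Phi>" by (intro lipschitz_onI) (auto simp: dist_real_def)
  then show ?thesis by blast
qed

text \<open>Lagrange coefficient of order \<open>n - 1\<close> for \<open>deriv \<phi>\<close>
  expanded backwards from the endpoint 1; flatness removes all lower Taylor coefficients.\<close>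

definition E where "E t = (-1) ^ (n - 1) * (deriv ^^ n) \<phi> (1 - t) / fact (n - 1)"

lemma deriv_taylor: "\<exists>t. \<bar>t\<bar> \<le> \<bar>s\<bar> \<and> deriv \<phi> (1 - s) = E t * s ^ (n - 1)"
proof -
  define d where "d = (\<lambda>i s. (-1) ^ i * (deriv ^^ Suc i) \<phi> (1 - s))"
  have "\<exists>t. \<bar>t\<bar> \<le> \<bar>s\<bar> \<and> deriv \<phi> (1 - s) = (\<Sum>i<n - 1. d i 0 / fact i * s ^ i) + d (n - 1) t / fact (n - 1) * s ^ (n - 1)"
  proof (rule Maclaurin_bi_le)
    show "d 0 = (\<lambda>s. deriv \<phi> (1 - s))" by (simp add: d_def)
    have "(d i has_real_derivative d (Suc i) t) (at t)" for i t
    proof -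
      have "((\<lambda>s. (deriv ^^ Suc i) \<phi> (1 - s)) has_real_derivative (deriv ^^ Suc (Suc i)) \<phi> (1 - t) * (-1)) (at t)"
        by (rule DERIV_chain2[OF deriv_funpow_smooth[OF smooth]]) (auto intro!: derivative_eq_intros)
      from DERIV_cmult[OF this, of "(-1) ^ i"] show ?thesis by (simp add: d_def mult_ac)
    qed
    then show "\<forall>i t. i < n - 1 \<and> \<bar>t\<bar> \<le> \<bar>s\<bar> \<longrightarrow> (d i has_real_derivative d (Suc i) t) (at t)" by blast
  qed
  moreover have "d i 0 = 0" if "i < n - 1" for i
    using flat[of "Suc i"] that by (simp add: d_def del: funpow.simps)
  ultimately obtain t where "\<bar>t\<bar> \<le> \<bar>s\<bar>" "deriv \<phi> (1 - s) = d (n - 1) t / fact (n - 1) * s ^ (n - 1)"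
    by auto
  moreover have "d (n - 1) t / fact (n - 1) = E t"
    using n by (simp add: d_def E_def del: funpow.simps)
  ultimately show ?thesis by metis
qed

lemma cont_E: "continuous_on A E"
  unfolding E_def by (intro continuous_intros continuous_on_compose2[OF cont_funpow[of UNIV]]) auto

text \<open>\<open>E 0\<close> is nonzero by the assumption on the \<open>n\<close>-th derivative,
  and its sign is that of \<open>deriv \<phi>\<close> just below 1, which is positive.\<close>

lemma E_near: "\<exists>d>0. d < 1 \<and> E 0 > 0 \<and> (\<forall>t. \<bar>t\<bar> \<le> d \<longrightarrow> E t > E 0 / 2)"
proof -
  have E0: "E 0 \<noteq> 0" using nflat by (simp add: E_def)
  have "isCont E 0" using cont_E[of UNIV] by (simp add: continuous_on_eq_continuous_at)
  then obtain d where d: "d > 0" "\<And>t. \<bar>t\<bar> < d \<Longrightarrow> \<bar>E t - E 0\<bar> < \<bar>E 0\<bar> / 2"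
    using E0 unfolding continuous_at_eps_delta by (metis abs_ge_zero dist_real_def diff_zero half_gt_zero_iff zero_less_abs_iff)
  define d' where "d' = min d 1 / 2"
  have d': "0 < d'" "d' < d" "d' < 1" using d by (auto simp: d'_def)
  obtain t where t: "\<bar>t\<bar> \<le> \<bar>d'\<bar>" "deriv \<phi> (1 - d') = E t * d' ^ (n - 1)" using deriv_taylor by blast
  then have "E t * d' ^ (n - 1) > 0" using pos[of "1 - d'"] d' by auto
  then have "E t > 0" using d' by (simp add: zero_less_mult_iff)
  then have "E 0 > 0" using d(2)[of t] t d' by (auto simp: abs_if split: if_splits)
  moreover have "E t > E 0 / 2" if "\<bar>t\<bar> \<le> d'" for t
    using d(2)[of t] that d' \<open>E 0 > 0\<close> by (auto simp: abs_if split: if_splits)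
  ultimately show ?thesis using d' by blast
qed

text \<open>Near 1 the Taylor remainder gives the bound; on the remaining compact interval
  positivity of the derivative does.\<close>

lemma deriv_lower:
  assumes "-1 < v0" "v0 < 1"
  shows "\<exists>c>0. \<forall>v\<in>{v0..1}. c * (1 - v) ^ (n - 1) \<le> deriv \<phi> v"
proof -
  obtain d where d: "d > 0" "d < 1" "E 0 > 0" "\<And>t. \<bar>t\<bar> \<le> d \<Longrightarrow> E t > E 0 / 2" using E_near by blast
  have "\<exists>\<mu>>0. \<forall>v\<in>{v0..1 - d}. \<mu> \<le> deriv \<phi> v"
  proof (cases "v0 \<le> 1 - d")
    case True
    then obtain u where "u \<in> {v0..1 - d}" "\<And>v. v \<in> {v0..1 - d} \<Longrightarrow> deriv \<phi> u \<le> deriv \<phi> v"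
      using continuous_attains_inf[OF compact_Icc _ cont_deriv, of v0 "1 - d"] by auto
    then show ?thesis using pos[of u] d assms by (intro exI[of _ "deriv \<phi> u"]) auto
  qed (auto intro: exI[of _ 1])
  then obtain \<mu> where \<mu>: "\<mu> > 0" "\<And>v. v \<in> {v0..1 - d} \<Longrightarrow> \<mu> \<le> deriv \<phi> v" by blast
  \<comment> \<open>\<open>1 - v\<close> is at most 2, hence the division by
    \<open>2 ^ (n - 1)\<close> for the part away from 1.\<close>
  define c where "c = min (E 0 / 2) (\<mu> / 2 ^ (n - 1))"
  have "c * (1 - v) ^ (n - 1) \<le> deriv \<phi> v" if v: "v \<in> {v0..1}" for v
  proof (cases "v \<le> 1 - d")
    case True
    have "c * (1 - v) ^ (n - 1) \<le> (\<mu> / 2 ^ (n - 1)) * 2 ^ (n - 1)"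
      using v assms \<mu> by (intro mult_mono power_mono) (auto simp: c_def)
    then show ?thesis using \<mu>(2)[of v] True v by auto
  next
    case False
    obtain t where t: "\<bar>t\<bar> \<le> \<bar>1 - v\<bar>" "deriv \<phi> (1 - (1 - v)) = E t * (1 - v) ^ (n - 1)"
      using deriv_taylor by blast
    have "E t > E 0 / 2" using t(1) False v by (intro d) auto
    then have "c * (1 - v) ^ (n - 1) \<le> E t * (1 - v) ^ (n - 1)"
      using v by (intro mult_right_mono) (auto simp: c_def)
    then show ?thesis using t by simp
  qed
  moreover have "c > 0" using d \<mu> by (auto simp: c_def)
  ultimately show ?thesis by blast
qed

text \<open>Integrated form of the derivative bounds. It is wanted across the whole strip, so the
  lower bound on [0, 1] is extended to [0, 2] by monotonicity, at the price of \<open>2 ^ n\<close>;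
  adding 1 to the upper constant makes it positive.\<close>

lemma \<Phi>_tangency_order:
  "\<exists>c>0. \<exists>C>0. \<forall>s\<in>{0..2}. c * s ^ n \<le> 1 - \<Phi> (1 - s) \<and> 1 - \<Phi> (1 - s) \<le> C * s ^ n"
proof -
  obtain c where c: "c > 0" "\<And>v. v \<in> {0..1} \<Longrightarrow> c * (1 - v) ^ (n - 1) \<le> deriv \<phi> v"
    using deriv_lower[of 0] by auto
  have "bounded (E ` {-2..2})"
    by (intro compact_imp_bounded compact_continuous_image compact_Icc cont_E)
  then obtain B where B: "\<And>t. t \<in> {-2..2} \<Longrightarrow> norm (E t) \<le> B" unfolding bounded_iff by blast
  have D': "((\<lambda>s. 1 - \<phi> (1 - s) - K / n * s ^ n) has_real_derivative (deriv \<phi> (1 - s) - K * s ^ (n - 1))) (at s)"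
    for K s
    using n by (auto intro!: derivative_eq_intros DERIV_chain2[OF D, of "\<lambda>s. 1 - s"])
  have lo: "c / n * s ^ n \<le> 1 - \<phi> (1 - s)" if "s \<in> {0..1}" for s
  proof -
    have "1 - \<phi> (1 - 0) - c / n * 0 ^ n \<le> 1 - \<phi> (1 - s) - c / n * s ^ n"
    proof (rule DERIV_nonneg_imp_nondecreasing[where f = "\<lambda>s. 1 - \<phi> (1 - s) - c / n * s ^ n"])
      fix u assume "0 \<le> u" "u \<le> s"
      then have "0 \<le> deriv \<phi> (1 - u) - c * u ^ (n - 1)" using that c(2)[of "1 - u"] by auto
      then show "\<exists>y. ((\<lambda>s. 1 - \<phi> (1 - s) - c / n * s ^ n) has_real_derivative y) (at u) \<and> 0 \<le> y"
        using D'[of c u] by blast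
    qed (use that in auto)
    then show ?thesis using n ends by (simp add: zero_power)
  qed
  have hi: "1 - \<phi> (1 - s) \<le> \<bar>B\<bar> / n * s ^ n" if "s \<in> {0..2}" for s
  proof -
    have "deriv \<phi> (1 - u) \<le> \<bar>B\<bar> * u ^ (n - 1)" if "u \<in> {0..2}" for u
    proof -
      obtain t where t: "\<bar>t\<bar> \<le> \<bar>u\<bar>" "deriv \<phi> (1 - u) = E t * u ^ (n - 1)" using deriv_taylor by blast
      have "E t \<le> \<bar>B\<bar>" using B[of t] t that by (auto simp: abs_le_iff)
      then show ?thesis unfolding t(2) using that by (intro mult_right_mono) auto
    qed
    then have *: "u \<in> {0..2} \<Longrightarrow> deriv \<phi> (1 - u) \<le> \<bar>B\<bar> * u ^ (n - 1)" for u .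
    have "1 - \<phi> (1 - s) - \<bar>B\<bar> / n * s ^ n \<le> 1 - \<phi> (1 - 0) - \<bar>B\<bar> / n * 0 ^ n"
    proof (rule DERIV_nonpos_imp_nonincreasing[where f = "\<lambda>s. 1 - \<phi> (1 - s) - \<bar>B\<bar> / n * s ^ n"])
      fix u assume "0 \<le> u" "u \<le> s"
      then have "deriv \<phi> (1 - u) - \<bar>B\<bar> * u ^ (n - 1) \<le> 0"
        using that *[of u] by auto
      then show "\<exists>y. ((\<lambda>s. 1 - \<phi> (1 - s) - \<bar>B\<bar> / n * s ^ n) has_real_derivative y) (at u) \<and> y \<le> 0"
        using D'[of "\<bar>B\<bar>" u] by blast
    qed (use that in auto)
    then show ?thesis using n ends by (simp add: zero_power)
  qed
  have "c / n / 2 ^ n * s ^ n \<le> 1 - \<Phi> (1 - s) \<and> 1 - \<Phi> (1 - s) \<le> (\<bar>B\<bar> / n + 1) * s ^ n" if s: "s \<in> {0..2}" for s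
  proof -
    have \<Phi>: "\<Phi> (1 - s) = \<phi> (1 - s)" using s by (intro inside) auto
    have "c / n / 2 ^ n * s ^ n = c / n * (s / 2) ^ n" by (simp add: power_divide)
    also have "\<dots> \<le> c / n * min s 1 ^ n"
      using s c n by (intro mult_left_mono power_mono) auto
    also have "\<dots> \<le> 1 - \<phi> (1 - min s 1)" using s by (intro lo) auto
    also have "\<dots> \<le> 1 - \<phi> (1 - s)" using strict[of "1 - s" 0] s by (cases "s \<le> 1") auto
    finally have "c / n / 2 ^ n * s ^ n \<le> 1 - \<phi> (1 - s)" .
    moreover have "0 \<le> s ^ n" using s by simp
    ultimately show ?thesis using hi[OF s] unfolding \<Phi> distrib_right by linarith
  qed
  moreover have "c / n / 2 ^ n > 0" "\<bar>B\<bar> / n + 1 > 0" using c n by (auto intro: add_nonneg_pos)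
  ultimately show ?thesis by blast
qed

text \<open>Source of the contraction between a trajectory at height \<open>v'\<close> and the upper
  curve at height \<open>v\<close>. The derivative may vanish at -1, so the mean value theorem is
  used only above the midpoint \<open>v0\<close> of -1 and \<open>v1\<close>. The increase below
  \<open>v0\<close> is dropped; the part above it keeps at least the fraction
  \<open>(v1 + 1) / 4\<close> of the length, because \<open>v - v0 \<ge> (v1 + 1) / 2\<close> and
  \<open>v - v' \<le> 2\<close>.\<close>

lemma \<Phi>_increment:
  assumes "-1 < v1" "v1 \<le> 0"
  shows "\<exists>c>0. \<forall>w\<in>{0..1}. \<forall>v\<in>{v1..1 - w}. \<forall>v'\<in>{-1..v}. c * w ^ (n - 1) * (v - v') \<le> \<Phi> v - \<Phi> v'"
proof -
  define v0 where "v0 = (v1 - 1) / 2"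
  have v0: "-1 < v0" "v0 < v1" "v0 < 1" using assms by (auto simp: v0_def)
  obtain c where c: "c > 0" "\<And>v. v \<in> {v0..1} \<Longrightarrow> c * (1 - v) ^ (n - 1) \<le> deriv \<phi> v"
    using deriv_lower[of v0] v0 by blast
  have near: "c * w ^ (n - 1) * (v - v') \<le> \<phi> v - \<phi> v'" if "w \<in> {0..1}" "v \<in> {v1..1 - w}" "v' \<in> {v0..v}" for w v v'
  proof (cases "v' = v")
    case False
    then have "v' < v" using that by auto
    then obtain z where z: "v' < z" "z < v" "\<phi> v - \<phi> v' = (v - v') * deriv \<phi> z"
      using MVT2[of v' v \<phi> "deriv \<phi>"] D by blast
    have "c * w ^ (n - 1) \<le> c * (1 - z) ^ (n - 1)"
      using c that z by (intro mult_left_mono power_mono) auto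
    also have "\<dots> \<le> deriv \<phi> z" using that z by (intro c) auto
    finally show ?thesis using z that by (simp add: mult.commute mult_left_mono)
  qed simp
  define c1 where "c1 = c * ((v1 + 1) / 4)"
  have "c1 * w ^ (n - 1) * (v - v') \<le> \<Phi> v - \<Phi> v'"
    if w: "w \<in> {0..1}" and v: "v \<in> {v1..1 - w}" and v': "v' \<in> {-1..v}" for w v v'
  proof -
    have \<Phi>: "\<Phi> v = \<phi> v" "\<Phi> v' = \<phi> v'" using w v v' assms by (auto intro!: inside)
    define u where "u = max v' v0"
    have u: "u \<in> {v0..v}" "v' \<le> u" using v v' v0 by (auto simp: u_def)
    have "(v1 + 1) / 4 * (v - v') \<le> v - u"
    proof (cases "v' \<le> v0")
      case True
      have "(v1 + 1) / 4 * (v - v') \<le> (v1 + 1) / 4 * 2"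
        using w v v' assms by (intro mult_left_mono) auto
      also have "\<dots> \<le> v - u" using True v by (simp add: u_def v0_def field_simps)
      finally show ?thesis .
    next
      case False
      have "(v1 + 1) / 4 * (v - v') \<le> 1 * (v - v')" using v' assms by (intro mult_right_mono) auto
      then show ?thesis using False by (simp add: u_def)
    qed
    then have "c * w ^ (n - 1) * ((v1 + 1) / 4 * (v - v')) \<le> c * w ^ (n - 1) * (v - u)"
      using c w by (intro mult_left_mono) auto
    also have "\<dots> \<le> \<phi> v - \<phi> u" by (rule near[OF w v u(1)])
    also have "\<dots> \<le> \<phi> v - \<phi> v'" using strict[of v' u] u v' v w by (cases "v' = u") auto
    finally show ?thesis by (simp add: \<Phi> c1_def mult_ac)
  qed
  moreover have "c1 > 0" using c assms by (simp add: c1_def)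
  ultimately show ?thesis by blast
qed

lemma \<Phi>_near_minus_one: "0 < e \<Longrightarrow> \<exists>v\<in>{-1<..0}. \<Phi> v < -1 + e"
proof -
  assume "0 < e"
  have "isCont \<phi> (-1)" by (rule DERIV_isCont[OF D])
  then obtain d where d: "d > 0" "\<And>v. \<bar>v + 1\<bar> < d \<Longrightarrow> \<bar>\<phi> v + 1\<bar> < e"
    using \<open>0 < e\<close> ends unfolding continuous_at_eps_delta dist_real_def by (metis diff_minus_eq_add)
  define v where "v = -1 + min d 1 / 2"
  have v: "-1 < v" "v \<le> 0" "\<bar>v + 1\<bar> < d" using d by (auto simp: v_def)
  then show ?thesis using d(2)[of v] inside[of v] by (intro bexI[of _ v]) auto
qed

end

lemma transitionI:
  assumes "\<Phi> \<in> transition_functions n" "1 \<le> n"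
  shows "\<exists>\<phi>. transition n \<Phi> \<phi>"
  using assms unfolding transition_functions_def transition_def by blast

section \<open>Slow passage through the fold\<close>

lemma barrier_antimono:
  fixes H D :: "real \<Rightarrow> real"
  assumes "s \<le> t" "\<And>u. u \<in> {s..t} \<Longrightarrow> (H has_real_derivative D u) (at u within {s..t})"
    and "\<And>u. u \<in> {s..t} \<Longrightarrow> D u \<le> 0"
  shows "H t \<le> H s"
proof -
  have "H t - H s \<le> 0"
    by (rule barrier[where G = "\<lambda>u. H u - H s" and a = s and b = t and D = D and d = 1])
       (use assms in \<open>auto intro!: derivative_eq_intros\<close>)
  then show ?thesis by simp
qed

lemma power_le_exp:
  fixes c x :: real
  assumes "0 < c" "0 \<le> x"
  shows "x ^ j \<le> fact j / c ^ j * exp (c * x)"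
proof -
  have "(c * x) ^ j / fact j \<le> exp (c * x)"
    using sum_le_suminf[OF summable_exp[of "c * x"], of "{j}"] assms
    by (simp add: exp_def divide_inverse mult.commute)
  then show ?thesis using assms by (simp add: field_simps power_mult_distrib)
qed

text \<open>Here \<open>j = 2k - 1\<close>, \<open>P = (1 + \<Phi>)/2\<close>, and \<open>X1\<close> and \<open>f\<close> are the abscissa speed and the slope of the
  upper field, cut off outside a box of radius \<open>R\<close> so that the bounds hold globally.\<close>

locale sliding =
  fixes j n :: nat and X1 f :: "real \<Rightarrow> real \<Rightarrow> real" and P :: "real \<Rightarrow> real"
    and m M L a A R c0 C0 c1 v1 :: real
  assumes j: "1 \<le> j" and n: "1 \<le> n"
    and m: "0 < m" and X1: "m \<le> X1 x y" "X1 x y \<le> M"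
    and f: "\<bar>f x y\<bar> \<le> 1 / 2"
    and L: "0 \<le> L" and X1_lip: "\<bar>X1 x y - X1 x z\<bar> \<le> L * \<bar>y - z\<bar>"
    and f_lip: "\<bar>f x y - f x z\<bar> \<le> L * \<bar>y - z\<bar>"
    and a: "0 < a" and A: "0 \<le> A"
    and f_pos: "0 \<le> x \<Longrightarrow> x \<le> R \<Longrightarrow> a * x ^ j \<le> f x 0"
    and f_neg: "-R \<le> x \<Longrightarrow> x \<le> 0 \<Longrightarrow> f x 0 \<le> - (a * \<bar>x\<bar> ^ j)"
    and f_abs: "\<bar>x\<bar> \<le> R \<Longrightarrow> \<bar>f x 0\<bar> \<le> A * \<bar>x\<bar> ^ j"
    and P_mono: "v \<le> v' \<Longrightarrow> P v \<le> P v'"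
    and P_lo: "v \<le> -1 \<Longrightarrow> P v = 0" and P_hi: "1 \<le> v \<Longrightarrow> P v = 1" and P_pos: "-1 < v \<Longrightarrow> 0 < P v"
    and c0: "0 < c0" and C0: "0 < C0"
    and P_order: "0 \<le> s \<Longrightarrow> s \<le> 2 \<Longrightarrow> c0 * s ^ n \<le> 1 - P (1 - s)"
      "0 \<le> s \<Longrightarrow> s \<le> 2 \<Longrightarrow> 1 - P (1 - s) \<le> C0 * s ^ n"
    and v1: "-1 < v1" "v1 \<le> 0" "P v1 \<le> 1 / 4" "P v1 * M \<le> 1"
    and c1: "0 < c1"
    and P_incr: "\<lbrakk>0 \<le> w; w \<le> 1; v1 \<le> v; v \<le> 1 - w; -1 \<le> v'; v' \<le> v\<rbrakk>
      \<Longrightarrow> c1 * w ^ (n - 1) * (v - v') \<le> P v - P v'"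
begin

abbreviation "p0 \<equiv> P v1"

text \<open>The maximum keeps \<open>slow\<close> Lipschitz; \<open>Y\<close> never enters the region where it exceeds \<open>P\<close>.\<close>

definition g where "g v = (1 - P v) / max (P v) p0"

definition slow where "slow \<epsilon> x y = f x y + g (y / \<epsilon>) / X1 x y"

lemma P01: "0 \<le> P v" "P v \<le> 1"
  using P_mono[of "min v (-1)" v] P_lo[of "min v (-1)"] P_mono[of v "max v 1"] P_hi[of "max v 1"] by auto

lemma p0: "0 < p0" using P_pos v1 by auto

lemma mM: "m \<le> M" "0 < M" using X1[of 0 0] m by auto

lemma X1_pos: "0 < X1 x y" using X1(1)[of x y] m by auto

lemma g_nonneg: "0 \<le> g v" using P01[of v] p0 by (auto simp: g_def)

lemma f_le_slow: "f x y \<le> slow \<epsilon> x y"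
  using g_nonneg[of "y / \<epsilon>"] X1_pos[of x y] by (simp add: slow_def)

lemma slow_eq_f: "0 < \<epsilon> \<Longrightarrow> \<epsilon> \<le> y \<Longrightarrow> slow \<epsilon> x y = f x y"
  using P_hi[of "y / \<epsilon>"] by (simp add: slow_def g_def)

lemma f_le: "f x y \<le> f x 0 + L * \<bar>y\<bar>" and f_ge: "f x 0 - L * \<bar>y\<bar> \<le> f x y"
  using f_lip[of x y 0] by auto

end

section \<open>The upper curve from its start to its exit through the fold\<close>

locale sliding_top = sliding +
  fixes \<epsilon> \<rho> x1 :: real and Y :: "real \<Rightarrow> real"
  assumes \<epsilon>: "0 < \<epsilon>" and \<rho>: "0 < \<rho>" "\<rho> \<le> R" and x1: "0 \<le> x1" "x1 \<le> R"
    and Y0: "Y (-\<rho>) = \<epsilon> * v1"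
    and Y: "x \<in> {-\<rho>..x1} \<Longrightarrow> (Y has_real_derivative slow \<epsilon> x (Y x)) (at x within {-\<rho>..x1})"
begin

lemma Y_within: "{b..c} \<subseteq> {-\<rho>..x1} \<Longrightarrow> x \<in> {b..c} \<Longrightarrow>
    (Y has_real_derivative slow \<epsilon> x (Y x)) (at x within {b..c})"
  using Y by (meson has_field_derivative_subset subsetD)

text \<open>Below \<open>\<epsilon> * v1\<close> the term \<open>g / X1\<close> is at least
  \<open>(3 / 4) / p0 / M\<close>, hence at least 3/4, and outweighs the slope bound 1/2. The two
  upper bounds on \<open>P v1\<close> in the locale serve this.\<close>

lemma Y_lower:
  assumes "x \<in> {-\<rho>..x1}"
  shows "\<epsilon> * v1 \<le> Y x"
proof -
  have "\<epsilon> * v1 - Y x \<le> 0"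
  proof (rule barrier[where G = "\<lambda>x. \<epsilon> * v1 - Y x" and a = "-\<rho>" and b = x1 and d = 1
        and D = "\<lambda>x. - slow \<epsilon> x (Y x)" and t = x])
    fix x assume x: "x \<in> {-\<rho>..x1}" "0 < \<epsilon> * v1 - Y x"
    then have "P (Y x / \<epsilon>) \<le> p0" using \<epsilon> by (intro P_mono) (auto simp: field_simps)
    then have "(3 / 4) / p0 \<le> g (Y x / \<epsilon>)"
      unfolding g_def using p0 v1 by (intro divide_right_mono frac_le) (auto simp: max_absorb2)
    then have "(3 / 4) / p0 / M \<le> g (Y x / \<epsilon>) / X1 x (Y x)"
      using p0 X1 X1_pos g_nonneg by (intro frac_le) auto
    moreover have "3 / 4 \<le> (3 / 4) / p0 / M" using v1(4) p0 mM by (simp add: field_simps)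
    ultimately show "- slow \<epsilon> x (Y x) \<le> 0"
      using f[of x "Y x"] unfolding slow_def by linarith
  qed (use assms Y0 in \<open>auto intro!: derivative_eq_intros Y\<close>)
  then show ?thesis by simp
qed

lemma Y_ge: "x \<in> {-\<rho>..x1} \<Longrightarrow> -\<epsilon> \<le> Y x"
proof -
  assume "x \<in> {-\<rho>..x1}"
  then have "\<epsilon> * v1 \<le> Y x" by (rule Y_lower)
  moreover have "\<epsilon> * (-1) \<le> \<epsilon> * v1" using \<epsilon> v1 by (intro mult_left_mono) auto
  ultimately show ?thesis by simp
qed

lemma v1_le: "x \<in> {-\<rho>..x1} \<Longrightarrow> v1 \<le> Y x / \<epsilon>"
  using Y_lower[of x] \<epsilon> by (simp add: field_simps)

lemma PY_ge: "x \<in> {-\<rho>..x1} \<Longrightarrow> p0 \<le> P (Y x / \<epsilon>)"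
  by (intro P_mono v1_le)

text \<open>Above the strip the slope is that of the upper field, at most 1/2. This crude bound
  confines all trajectories below \<open>Y\<close> to the box and bounds their travel time.\<close>

lemma Y_upper:
  assumes "x \<in> {-\<rho>..x1}"
  shows "Y x \<le> \<epsilon> + (x + \<rho>) / 2"
proof -
  have "Y x - (\<epsilon> + (x + \<rho>) / 2) \<le> 0"
  proof (rule barrier[where G = "\<lambda>x. Y x - (\<epsilon> + (x + \<rho>) / 2)" and a = "-\<rho>" and b = x1 and d = 1
        and D = "\<lambda>x. slow \<epsilon> x (Y x) - 1 / 2" and t = x])
    fix x assume x: "x \<in> {-\<rho>..x1}" "0 < Y x - (\<epsilon> + (x + \<rho>) / 2)"
    moreover have "0 \<le> (x + \<rho>) / 2" using x by simp
    ultimately have "\<epsilon> \<le> Y x" by linarith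
    then have "slow \<epsilon> x (Y x) = f x (Y x)" using \<epsilon> by (intro slow_eq_f) auto
    then show "slow \<epsilon> x (Y x) - 1 / 2 \<le> 0" using f[of x "Y x"] by auto
  next
    have "\<epsilon> * v1 \<le> 0" using \<epsilon> v1 by (simp add: mult_nonneg_nonpos)
    then show "Y (-\<rho>) - (\<epsilon> + (-\<rho> + \<rho>) / 2) \<le> 0" using Y0 \<epsilon> v1 by simp
  qed (use assms Y0 in \<open>auto intro!: derivative_eq_intros Y\<close>)
  then show ?thesis by simp
qed

text \<open>Above height \<open>\<epsilon> * (1 - w)\<close> the upward push \<open>g / X1\<close>
  is at most \<open>C0 * w ^ n / (p0 * m)\<close>, while the upper field pulls down by at least
  \<open>a * \<xi> ^ j - 2 * L * \<epsilon>\<close>. The barrier strip has width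
  \<open>\<epsilon>\<close>, which keeps
  \<open>\<bar>Y x\<bar> \<le> 2 * \<epsilon>\<close>.\<close>

lemma Y_below:
  assumes w: "0 \<le> w" "w \<le> 1" and \<xi>: "0 \<le> \<xi>" and *: "C0 * w ^ n / (p0 * m) + 2 * L * \<epsilon> \<le> a * \<xi> ^ j"
    and x: "x \<in> {-\<rho>..-\<xi>}"
  shows "Y x \<le> \<epsilon> * (1 - w)"
proof -
  have sub: "{-\<rho>..-\<xi>} \<subseteq> {-\<rho>..x1}" using \<xi> x1 by auto
  have "Y x - \<epsilon> * (1 - w) \<le> 0"
  proof (rule barrier[where G = "\<lambda>x. Y x - \<epsilon> * (1 - w)" and a = "-\<rho>" and b = "-\<xi>" and d = \<epsilon>
        and D = "\<lambda>x. slow \<epsilon> x (Y x)" and t = x])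
    fix x assume x: "x \<in> {-\<rho>..-\<xi>}" "0 < Y x - \<epsilon> * (1 - w)" "Y x - \<epsilon> * (1 - w) < \<epsilon>"
    have "\<epsilon> * (1 - w) \<le> \<epsilon>" "0 \<le> \<epsilon> * (1 - w)" using w \<epsilon> by (auto simp: mult_left_le)
    then have Yb: "\<bar>Y x\<bar> \<le> 2 * \<epsilon>" using x by linarith
    have "f x (Y x) \<le> - (a * \<bar>x\<bar> ^ j) + L * \<bar>Y x\<bar>"
      using f_le[of x "Y x"] f_neg[of x] x \<rho> \<xi> by auto
    also have "\<dots> \<le> - (a * \<xi> ^ j) + L * (2 * \<epsilon>)"
      using x \<xi> a L Yb by (intro add_mono mult_left_mono power_mono le_imp_neg_le) auto
    finally have 1: "f x (Y x) \<le> - (a * \<xi> ^ j) + 2 * L * \<epsilon>" by simp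
    have "P (1 - w) \<le> P (Y x / \<epsilon>)" using x \<epsilon> by (intro P_mono) (auto simp: field_simps)
    then have "1 - P (Y x / \<epsilon>) \<le> C0 * w ^ n" using P_order(2)[of w] w by auto
    then have "g (Y x / \<epsilon>) \<le> C0 * w ^ n / p0"
      unfolding g_def using P01 p0 w C0 by (intro frac_le) auto
    then have "g (Y x / \<epsilon>) / X1 x (Y x) \<le> C0 * w ^ n / p0 / m"
      using g_nonneg p0 w C0 m X1 by (intro frac_le) auto
    then show "slow \<epsilon> x (Y x) \<le> 0" using 1 * by (simp add: slow_def)
  next
    have "\<epsilon> * v1 \<le> \<epsilon> * (1 - w)" using \<epsilon> v1 w by (intro mult_left_mono) auto
    then show "Y (-\<rho>) - \<epsilon> * (1 - w) \<le> 0" using Y0 by simp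
  qed (use x \<epsilon> in \<open>auto intro!: derivative_eq_intros Y_within[OF sub]\<close>)
  then show ?thesis by simp
qed


text \<open>Lengths are measured in units of \<open>N\<close>, distances to \<open>y = \<epsilon>\<close> in units of
  \<open>\<epsilon> * s\<close>; in these units the slow passage near the fold loses its dependence on \<open>\<epsilon>\<close>.\<close>

lemma Y_entry:
  assumes "0 < N" "0 < s" and sN: "s ^ (n - 1) * N = \<epsilon>" "\<epsilon> * s = N ^ Suc j" "s ^ n = N ^ j" "\<epsilon> \<le> N ^ j"
    and c: "c = c0 / M" and K: "\<And>z. 0 \<le> z \<Longrightarrow> A * z ^ j + L + c \<le> K * exp (c / 2 * z)"
    and start: "exp (- (c * \<rho> / N)) * (1 - v1) / s \<le> 1"
  shows "(\<epsilon> - Y 0) / (\<epsilon> * s) \<le> 1 + 2 * K / c"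
proof -
  have c_pos: "0 < c" using c c0 mM by auto
  have K_pos: "0 \<le> K" using K[of 0] L c_pos j by (simp add: zero_power)
  define u where "u = (\<lambda>x. (\<epsilon> - Y x) / \<epsilon>)"
  \<comment> \<open>The integrating factor \<open>exp (c * x / N)\<close> undoes the decay at rate
    \<open>c / N\<close>; the second term is a primitive of the forcing bound
    \<open>K / N * exp (c * x / (2 * N))\<close>, and 1 dominates the value at the start.\<close>
  define G where "G = (\<lambda>x. exp (c * x / N) * (\<epsilon> - Y x) / (\<epsilon> * s) - 2 * K / c * exp (c * x / (2 * N)) - 1)"
  define D where "D = (\<lambda>x. exp (c * x / N) * (c / N * (\<epsilon> - Y x) / (\<epsilon> * s) - slow \<epsilon> x (Y x) / (\<epsilon> * s))
      - K / N * exp (c * x / (2 * N)))"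
  have "G 0 \<le> 0"
  proof (rule barrier[where G = G and a = "-\<rho>" and b = 0 and d = 1 and D = D and t = 0])
    fix x assume x: "x \<in> {-\<rho>..0}"
    show "(G has_real_derivative D x) (at x within {-\<rho>..0})"
      unfolding G_def D_def using x1 c_pos \<open>0 < N\<close> \<open>0 < s\<close> \<epsilon>
      by (auto intro!: derivative_eq_intros Y_within[OF _ x] simp: field_simps)
    assume "0 < G x"
    then have "0 < exp (c * x / N) * (\<epsilon> - Y x) / (\<epsilon> * s)"
      unfolding G_def using K_pos c_pos by (smt (verit) divide_nonneg_nonneg exp_ge_zero mult_nonneg_nonneg)
    then have "Y x < \<epsilon>"
      using mult_pos_pos[OF \<epsilon> \<open>0 < s\<close>] by (auto simp: zero_less_mult_iff zero_less_divide_iff)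
    then have u: "0 < u x" "u x \<le> 2" "\<bar>Y x\<bar> \<le> \<epsilon>"
      using \<epsilon> Y_ge[of x] x x1 by (auto simp: u_def field_simps)
    have Yu: "Y x / \<epsilon> = 1 - u x" using \<epsilon> by (simp add: u_def field_simps)
    have eu: "\<epsilon> * u x = \<epsilon> - Y x" using \<epsilon> by (simp add: u_def)
    \<comment> \<open>Linear minorant of \<open>u x ^ n\<close> with slope
      \<open>s ^ (n - 1) = \<epsilon> / N\<close>; it yields the decay rate \<open>c / N\<close> of
      the scaled distance.\<close>
    have "s ^ (n - 1) * u x - s ^ n \<le> u x ^ n"
    proof (cases "s \<le> u x")
      case True
      have "s ^ (n - 1) * u x \<le> u x ^ (n - 1) * u x"
        using True u \<open>0 < s\<close> by (intro mult_right_mono power_mono) auto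
      also have "\<dots> = u x ^ n" using n by (metis power_minus_mult less_le_trans zero_less_one)
      finally show ?thesis using \<open>0 < s\<close> by (smt (verit) zero_less_power)
    next
      case False
      have "s ^ (n - 1) * u x \<le> s ^ (n - 1) * s"
        using False \<open>0 < s\<close> by (intro mult_left_mono) auto
      also have "\<dots> = s ^ n" using n by (metis power_minus_mult less_le_trans zero_less_one)
      finally show ?thesis using u by (smt (verit) zero_less_power)
    qed
    then have "c * (s ^ (n - 1) * u x - s ^ n) \<le> c * u x ^ n" using c_pos by (intro mult_left_mono) auto
    also have "\<dots> = c0 * u x ^ n / M" by (simp add: c)
    also have "\<dots> \<le> (1 - P (Y x / \<epsilon>)) / X1 x (Y x)"
      using P_order(1)[of "u x"] u X1 X1_pos P01 unfolding Yu by (intro frac_le) auto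
    also have "\<dots> \<le> g (Y x / \<epsilon>) / X1 x (Y x)"
    proof (rule divide_right_mono)
      have "(1 - P (Y x / \<epsilon>)) / 1 \<le> g (Y x / \<epsilon>)"
        unfolding g_def using P01 p0 v1 by (intro frac_le) auto
      then show "1 - P (Y x / \<epsilon>) \<le> g (Y x / \<epsilon>)" by simp
    qed (use X1_pos less_imp_le in auto)
    finally have 1: "c * (s ^ (n - 1) * u x - s ^ n) \<le> g (Y x / \<epsilon>) / X1 x (Y x)" .
    have 2: "- (A * \<bar>x\<bar> ^ j) - L * \<epsilon> \<le> f x (Y x)"
    proof -
      have "L * \<bar>Y x\<bar> \<le> L * \<epsilon>" using u L by (intro mult_left_mono) auto
      then show ?thesis using f_ge[of x "Y x"] f_abs[of x] x \<rho> by auto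
    qed
    have s1: "s ^ (n - 1) = \<epsilon> / N" using sN \<open>0 < N\<close> by (simp add: field_simps)
    have "c / N * (\<epsilon> - Y x) / (\<epsilon> * s) - slow \<epsilon> x (Y x) / (\<epsilon> * s)
        = (c * (\<epsilon> / N) * u x - slow \<epsilon> x (Y x)) / (\<epsilon> * s)"
      unfolding eu[symmetric] by (simp add: diff_divide_distrib mult_ac)
    also have "\<dots> \<le> (A * \<bar>x\<bar> ^ j + L * \<epsilon> + c * s ^ n) / (\<epsilon> * s)"
      using 1 2 \<epsilon> \<open>0 < s\<close> unfolding slow_def s1 by (intro divide_right_mono) (auto simp: algebra_simps)
    also have "\<dots> \<le> N ^ j * (A * \<bar>x / N\<bar> ^ j + L + c) / (\<epsilon> * s)"
    proof (rule divide_right_mono)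
      have "L * \<epsilon> \<le> L * N ^ j" using sN L by (intro mult_left_mono) auto
      then show "A * \<bar>x\<bar> ^ j + L * \<epsilon> + c * s ^ n \<le> N ^ j * (A * \<bar>x / N\<bar> ^ j + L + c)"
        using \<open>0 < N\<close> by (simp add: sN(3) algebra_simps power_divide)
    qed (use \<epsilon> \<open>0 < s\<close> in auto)
    also have "\<dots> = (A * \<bar>x / N\<bar> ^ j + L + c) / N"
      unfolding sN(2) using \<open>0 < N\<close> by simp
    also have "\<dots> \<le> K * exp (c / 2 * \<bar>x / N\<bar>) / N"
      using K[of "\<bar>x / N\<bar>"] \<open>0 < N\<close> by (intro divide_right_mono) auto
    also have "c / 2 * \<bar>x / N\<bar> = - (c * x / (2 * N))"
      using x \<open>0 < N\<close> by (simp add: abs_of_nonpos divide_nonpos_pos)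
    finally have "exp (c * x / N) * (c / N * (\<epsilon> - Y x) / (\<epsilon> * s) - slow \<epsilon> x (Y x) / (\<epsilon> * s))
        \<le> exp (c * x / N) * (K * exp (- (c * x / (2 * N))) / N)"
      by (intro mult_left_mono) auto
    also have "\<dots> = K / N * (exp (c * x / N) * exp (- (c * x / (2 * N))))" by simp
    also have "exp (c * x / N) * exp (- (c * x / (2 * N))) = exp (c * x / (2 * N))"
      unfolding exp_add[symmetric] using \<open>0 < N\<close> by (simp add: field_simps)
    finally show "D x \<le> 0" by (simp add: D_def)
  next
    have eY: "\<epsilon> - Y (-\<rho>) = \<epsilon> * (1 - v1)" by (simp add: Y0 algebra_simps)
    \<comment> \<open>In scaled units the initial distance is of order \<open>1 / s\<close>; the
      assumption \<open>start\<close> says that the decay over the length \<open>\<rho>\<close>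
      brings it down to at most 1.\<close>
    have "exp (c * - \<rho> / N) * (\<epsilon> - Y (-\<rho>)) / (\<epsilon> * s) = exp (- (c * \<rho> / N)) * (1 - v1) / s"
      using \<epsilon> by (simp add: eY)
    then show "G (-\<rho>) \<le> 0"
      unfolding G_def using start K_pos c_pos by (smt (verit) divide_nonneg_nonneg exp_ge_zero mult_nonneg_nonneg)
  qed (use \<rho> in auto)
  then show ?thesis by (simp add: G_def)
qed

text \<open>Right of the fold the upper field rises at least like \<open>a * x ^ j\<close>, so the
  scaled distance to the edge \<open>y = \<epsilon>\<close> drops at least as fast as the primitive
  \<open>\<psi>\<close> of \<open>a * z ^ j - L\<close> grows; \<open>\<eta>\<close> is so large
  that \<open>\<psi> \<eta>\<close> covers the entry distance \<open>K0\<close>. Beyond that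
  abscissa the slope below the edge is nonnegative, which prevents a return.\<close>

lemma Y_exit:
  assumes "0 < N" "0 < s" and sN: "\<epsilon> * s = N ^ Suc j" "\<epsilon> \<le> N ^ j"
    and entry: "(\<epsilon> - Y 0) / (\<epsilon> * s) \<le> K0" and K0: "0 \<le> K0"
    and \<eta>: "1 \<le> \<eta>" "K0 + L \<le> a * \<eta> ^ j / Suc j" and x: "x \<in> {\<eta> * N..x1}"
  shows "\<epsilon> \<le> Y x"
proof -
  have \<eta>N: "0 < \<eta> * N" "\<eta> * N \<le> x1" using \<eta> \<open>0 < N\<close> x by auto
  have slow_ge: "N ^ j * (a * (x / N) ^ j - L) \<le> slow \<epsilon> x (Y x)" if "x \<in> {0..x1}" "Y x < \<epsilon>" for x
  proof -
    have "\<bar>Y x\<bar> \<le> \<epsilon>" using that Y_ge[of x] \<rho> by auto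
    then have "L * \<bar>Y x\<bar> \<le> L * N ^ j" using sN L by (intro mult_left_mono) auto
    moreover have "N ^ j * (a * (x / N) ^ j - L) = a * x ^ j - L * N ^ j"
      using \<open>0 < N\<close> by (simp add: algebra_simps power_divide)
    ultimately show ?thesis
      using f_le_slow[of x "Y x" \<epsilon>] f_ge[of x "Y x"] f_pos[of x] that x1 by auto
  qed
  define \<psi> where "\<psi> = (\<lambda>z. a * z ^ Suc j / Suc j - L * z)"
  have \<psi>: "\<psi> z = z * (a * z ^ j / Suc j - L)" for z by (simp add: \<psi>_def algebra_simps)
  have \<psi>': "(\<psi> has_real_derivative (a * z ^ j - L)) (at z)" for z
    unfolding \<psi>_def by (auto intro!: derivative_eq_intros simp del: of_nat_Suc power_Suc)
  \<comment> \<open>\<open>\<psi>\<close> may decrease near 0, but on this interval it never exceeds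
    its value at \<open>\<eta>\<close>; hence \<open>G\<close> can be positive only where
    \<open>Y\<close> is below the edge.\<close>
  have \<psi>_le: "\<psi> z \<le> \<psi> \<eta>" if "z \<in> {0..\<eta>}" for z
  proof -
    have "z * (a * z ^ j / Suc j - L) \<le> z * (a * \<eta> ^ j / Suc j - L)"
      using that a by (intro mult_left_mono diff_mono divide_right_mono power_mono) auto
    also have "\<dots> \<le> \<eta> * (a * \<eta> ^ j / Suc j - L)"
      using that \<eta> K0 by (intro mult_right_mono) auto
    finally show ?thesis unfolding \<psi> .
  qed
  have \<psi>\<eta>: "K0 \<le> \<psi> \<eta>"
    using mult_mono[of 1 \<eta> "K0" "a * \<eta> ^ j / Suc j - L"] \<eta> K0 by (simp add: \<psi>)
  define G where "G = (\<lambda>x. (\<epsilon> - Y x) / (\<epsilon> * s) - (\<psi> \<eta> - \<psi> (x / N)))"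
  define D where "D = (\<lambda>x. - slow \<epsilon> x (Y x) / (\<epsilon> * s) + (a * (x / N) ^ j - L) / N)"
  have "G (\<eta> * N) \<le> 0"
  proof (rule barrier[where G = G and a = 0 and b = "\<eta> * N" and d = 1 and D = D and t = "\<eta> * N"])
    fix x assume x: "x \<in> {0..\<eta> * N}"
    have sub: "{0..\<eta> * N} \<subseteq> {-\<rho>..x1}" using \<eta>N \<rho> by auto
    have *: "((\<lambda>x. \<psi> (x / N)) has_real_derivative (a * (x / N) ^ j - L) * (1 / N)) (at x within {0..\<eta> * N})"
      by (rule DERIV_chain2[OF \<psi>']) (use \<open>0 < N\<close> in \<open>auto intro!: derivative_eq_intros\<close>)
    show "(G has_real_derivative D x) (at x within {0..\<eta> * N})"
      using DERIV_diff[OF DERIV_cdivide[OF DERIV_diff[OF DERIV_const Y_within[OF sub x]]] DERIV_diff[OF DERIV_const *]]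
      unfolding G_def D_def by simp
    assume "0 < G x"
    moreover have "\<psi> (x / N) \<le> \<psi> \<eta>" using x \<open>0 < N\<close> by (intro \<psi>_le) (auto simp: field_simps)
    ultimately have "0 < (\<epsilon> - Y x) / (\<epsilon> * s)" by (simp add: G_def)
    then have "Y x < \<epsilon>"
      using mult_pos_pos[OF \<epsilon> \<open>0 < s\<close>] by (auto simp: zero_less_divide_iff)
    then have "N ^ j * (a * (x / N) ^ j - L) / (\<epsilon> * s) \<le> slow \<epsilon> x (Y x) / (\<epsilon> * s)"
      using slow_ge[of x] x \<eta>N \<epsilon> \<open>0 < s\<close> by (intro divide_right_mono) auto
    moreover have "N ^ j * (a * (x / N) ^ j - L) / (\<epsilon> * s) = (a * (x / N) ^ j - L) / N"
      unfolding sN(1) using \<open>0 < N\<close> by simp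
    ultimately show "D x \<le> 0" by (simp add: D_def)
  next
    show "G 0 \<le> 0" using entry \<psi>\<eta> by (simp add: G_def \<psi>)
  qed (use \<eta>N in auto)
  then have "(\<epsilon> - Y (\<eta> * N)) / (\<epsilon> * s) \<le> 0" using \<open>0 < N\<close> by (simp add: G_def)
  then have exit: "\<epsilon> \<le> Y (\<eta> * N)"
    using mult_pos_pos[OF \<epsilon> \<open>0 < s\<close>] by (auto simp: divide_le_0_iff)
  have "\<epsilon> - Y x \<le> 0"
  proof (rule barrier[where G = "\<lambda>x. \<epsilon> - Y x" and a = "\<eta> * N" and b = x1 and d = 1
        and D = "\<lambda>x. - slow \<epsilon> x (Y x)" and t = x])
    fix x assume x: "x \<in> {\<eta> * N..x1}" "0 < \<epsilon> - Y x"
    have "L \<le> a * (x / N) ^ j"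
    proof -
      have "K0 + L \<le> a * \<eta> ^ j / 1"
        using a \<eta>(1) by (intro order_trans[OF \<eta>(2)] divide_left_mono) auto
      also have "a * \<eta> ^ j / 1 \<le> a * (x / N) ^ j"
        using x \<eta> a \<open>0 < N\<close> unfolding div_by_1 by (intro mult_left_mono power_mono) (auto simp: field_simps)
      finally show ?thesis using K0 by simp
    qed
    then have "0 \<le> N ^ j * (a * (x / N) ^ j - L)" using \<open>0 < N\<close> by simp
    also have "\<dots> \<le> slow \<epsilon> x (Y x)" using x \<eta>N by (intro slow_ge) auto
    finally show "- slow \<epsilon> x (Y x) \<le> 0" by simp
  next
    show "((\<lambda>x. \<epsilon> - Y x) has_real_derivative - slow \<epsilon> x (Y x)) (at x within {\<eta> * N..x1})"
      if "x \<in> {\<eta> * N..x1}" for x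
      using \<eta>N \<rho> by (auto intro!: derivative_eq_intros Y_within[OF _ that])
  qed (use x exit in auto)
  then show ?thesis by simp
qed

text \<open>At \<open>- (\<eta> * N)\<close> the curve is not above the edge, by
  \<open>Y_below\<close> with \<open>w = 0\<close>; over the remaining length
  \<open>2 * \<eta> * N\<close> the slope above the edge is of order \<open>N ^ j\<close>. The
  assumption \<open>small\<close> keeps the allowed excess below \<open>\<epsilon> / 2\<close>, so
  that heights in the barrier strip stay below \<open>2 * \<epsilon>\<close>.\<close>

lemma Y_at_exit:
  assumes "0 < N" and N: "\<epsilon> \<le> N ^ j" and \<eta>: "1 \<le> \<eta>" "2 * L \<le> a * \<eta> ^ j" "\<eta> * N \<le> \<rho>" "\<eta> * N \<le> x1"
    and small: "4 * (A * \<eta> ^ j + 2 * L) * \<eta> * N ^ Suc j \<le> \<epsilon>"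
  shows "Y (\<eta> * N) \<le> \<epsilon> + 2 * (A * \<eta> ^ j + 2 * L) * \<eta> * N ^ Suc j"
proof -
  define z where "z = \<eta> * N"
  define C where "C = A * \<eta> ^ j + 2 * L"
  have z: "0 < z" "z \<le> \<rho>" "z \<le> x1" using \<eta> \<open>0 < N\<close> by (auto simp: z_def)
  have C: "0 \<le> C" using A L \<eta> by (simp add: C_def)
  have sub: "{-z..z} \<subseteq> {-\<rho>..x1}" using z by auto
  have Lj: "L * \<epsilon> \<le> L * N ^ j" using N L by (rule mult_left_mono)
  have CN: "C * N ^ j * (2 * z) = 2 * C * \<eta> * N ^ Suc j" by (simp add: z_def)
  have "Y z - (\<epsilon> + C * N ^ j * (z + z)) \<le> 0"
  proof (rule barrier[where G = "\<lambda>x. Y x - (\<epsilon> + C * N ^ j * (x + z))" and a = "-z" and b = z and d = "\<epsilon> / 2"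
        and D = "\<lambda>x. slow \<epsilon> x (Y x) - C * N ^ j" and t = z])
    fix x assume x: "x \<in> {-z..z}" "0 < Y x - (\<epsilon> + C * N ^ j * (x + z))" "Y x - (\<epsilon> + C * N ^ j * (x + z)) < \<epsilon> / 2"
    have "0 \<le> C * N ^ j * (x + z)" using x C \<open>0 < N\<close> by auto
    moreover have "C * N ^ j * (x + z) \<le> C * N ^ j * (2 * z)"
      using x C \<open>0 < N\<close> by (intro mult_left_mono) auto
    then have "C * N ^ j * (x + z) \<le> \<epsilon> / 2" using small unfolding CN C_def[symmetric] by linarith
    ultimately have Yx: "\<epsilon> \<le> Y x" "\<bar>Y x\<bar> \<le> 2 * \<epsilon>" using x \<epsilon> by auto
    have "slow \<epsilon> x (Y x) = f x (Y x)" using Yx \<epsilon> by (intro slow_eq_f) auto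
    also have "\<dots> \<le> A * \<bar>x\<bar> ^ j + L * \<bar>Y x\<bar>"
    proof -
      have "\<bar>x\<bar> \<le> R" using x z \<rho> by auto
      then show ?thesis using f_le[of x "Y x"] f_abs[of x] by linarith
    qed
    also have "\<dots> \<le> A * z ^ j + L * (2 * \<epsilon>)"
      using x A L Yx by (intro add_mono mult_left_mono power_mono) auto
    also have "\<dots> \<le> C * N ^ j" using Lj by (simp add: C_def z_def power_mult_distrib algebra_simps)
    finally show "slow \<epsilon> x (Y x) - C * N ^ j \<le> 0" by simp
  next
    have "2 * L * \<epsilon> \<le> 2 * L * N ^ j" using Lj by simp
    also have "\<dots> \<le> a * \<eta> ^ j * N ^ j" using \<eta> \<open>0 < N\<close> by (intro mult_right_mono) auto
    finally have "2 * L * \<epsilon> \<le> a * z ^ j" by (simp add: z_def power_mult_distrib)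
    then have "Y (-z) \<le> \<epsilon> * (1 - 0)"
      using z n by (intro Y_below[where \<xi> = z]) (auto simp: zero_power)
    then show "Y (-z) - (\<epsilon> + C * N ^ j * (-z + z)) \<le> 0" by simp
  qed (use z \<epsilon> in \<open>auto intro!: derivative_eq_intros Y_within[OF sub]\<close>)
  then show ?thesis using CN by (simp add: z_def C_def mult_ac)
qed


text \<open>At \<open>z\<close> both \<open>Y - \<epsilon>\<close> and \<open>B\<close> are of order
  \<open>z ^ Suc j\<close>. Afterwards \<open>Y\<close> and \<open>B\<close> solve the same
  equation, and the shift by \<open>\<epsilon>\<close> acts as a source of size
  \<open>L * \<epsilon>\<close>, whence the term proportional to
  \<open>\<epsilon> * x\<close>.\<close>

lemma Y_close_to_fold_arc:
  assumes z: "0 < z" "z \<le> x" "x \<le> x1" and B0: "B 0 = 0"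
    and B: "\<And>x. x \<in> {0..x1} \<Longrightarrow> (B has_real_derivative f x (B x)) (at x within {0..x1})"
    and above: "\<And>x. x \<in> {z..x1} \<Longrightarrow> \<epsilon> \<le> Y x" and Yz: "Y z \<le> \<epsilon> + K * z ^ Suc j" and K: "0 \<le> K"
  shows "\<bar>Y x - (B x + \<epsilon>)\<bar> \<le> exp (L * R) * (L * \<epsilon> * x + (A * exp (L * R) + K) * z ^ Suc j)"
proof -
  have zR: "z \<le> R" using z x1 by auto
  \<comment> \<open>The factor \<open>\<sigma>\<close> treats both signs at once, as
    \<open>barrier\<close> gives one-sided bounds.\<close>
  have "B z * \<sigma> \<le> A * exp (L * R) * z ^ Suc j" if \<sigma>: "\<sigma> = 1 \<or> \<sigma> = -1" for \<sigma>
  proof -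
    have sub: "{0..z} \<subseteq> {0..x1}" using z by auto
    have "exp (- (L * z)) * (B z * \<sigma>) - A * z ^ Suc j \<le> 0"
    proof (rule barrier[where G = "\<lambda>x. exp (- (L * x)) * (B x * \<sigma>) - A * x ^ Suc j" and a = 0 and b = z and d = 1
          and t = z and D = "\<lambda>x. exp (- (L * x)) * (f x (B x) * \<sigma> - L * (B x * \<sigma>)) - A * (Suc j * x ^ j)"])
      fix x assume x: "x \<in> {0..z}"
      have "(B has_real_derivative f x (B x)) (at x within {0..z})"
        by (rule has_field_derivative_subset[OF B sub]) (use x z in auto)
      then show "((\<lambda>x. exp (- (L * x)) * (B x * \<sigma>) - A * x ^ Suc j) has_real_derivative
          exp (- (L * x)) * (f x (B x) * \<sigma> - L * (B x * \<sigma>)) - A * (Suc j * x ^ j)) (at x within {0..z})"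
        by (auto intro!: derivative_eq_intros simp: algebra_simps simp del: power_Suc of_nat_Suc)
      assume "0 < exp (- (L * x)) * (B x * \<sigma>) - A * x ^ Suc j"
      moreover have "0 \<le> A * x ^ Suc j" using A x by auto
      ultimately have "0 < exp (- (L * x)) * (B x * \<sigma>)" by linarith
      then have B\<sigma>: "0 < B x * \<sigma>" by (simp add: zero_less_mult_iff)
      then have "\<bar>B x\<bar> = B x * \<sigma>" using \<sigma> by auto
      moreover have "f x (B x) * \<sigma> \<le> A * x ^ j + L * \<bar>B x\<bar>"
      proof -
        have "\<bar>f x 0\<bar> \<le> A * x ^ j" using f_abs[of x] x zR by auto
        then show ?thesis using f_le[of x "B x"] f_ge[of x "B x"] \<sigma> by auto
      qed
      ultimately have "f x (B x) * \<sigma> - L * (B x * \<sigma>) \<le> A * x ^ j" by simp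
      then have "exp (- (L * x)) * (f x (B x) * \<sigma> - L * (B x * \<sigma>)) \<le> exp (- (L * x)) * (A * x ^ j)"
        by (intro mult_left_mono) auto
      also have "\<dots> \<le> 1 * (A * x ^ j)" using A x L by (intro mult_right_mono) auto
      also have "\<dots> \<le> A * (Suc j * x ^ j)"
        using A x mult_right_mono[of 1 "real (Suc j)" "x ^ j"] by (auto intro!: mult_left_mono)
      finally show "exp (- (L * x)) * (f x (B x) * \<sigma> - L * (B x * \<sigma>)) - A * (Suc j * x ^ j) \<le> 0" by simp
    qed (use z B0 in auto)
    then have "exp (L * z) * (exp (- (L * z)) * (B z * \<sigma>)) \<le> exp (L * z) * (A * z ^ Suc j)"
      by (intro mult_left_mono) auto
    moreover have "exp (L * z) * (exp (- (L * z)) * (B z * \<sigma>)) = B z * \<sigma>"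
      by (simp add: exp_minus)
    moreover have "exp (L * z) * (A * z ^ Suc j) \<le> exp (L * R) * (A * z ^ Suc j)"
      using A L z zR by (intro mult_right_mono) (auto intro: mult_left_mono)
    moreover have "exp (L * R) * (A * z ^ Suc j) = A * exp (L * R) * z ^ Suc j" by simp
    ultimately show ?thesis by linarith
  qed
  from this[of 1] this[of "-1"] have Bz: "\<bar>B z\<bar> \<le> A * exp (L * R) * z ^ Suc j" by auto
  define w0 where "w0 = (A * exp (L * R) + K) * z ^ Suc j"
  have "\<bar>Y z - B z - \<epsilon>\<bar> \<le> w0"
  proof -
    have "\<epsilon> \<le> Y z" using above[of z] z by auto
    moreover have "0 \<le> K * z ^ Suc j" using K z by auto
    ultimately show ?thesis using Bz Yz unfolding w0_def distrib_right by linarith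
  qed
  have main: "(Y x - B x - \<epsilon>) * \<sigma> \<le> exp (L * R) * (L * \<epsilon> * x + w0)" if \<sigma>: "\<sigma> = 1 \<or> \<sigma> = -1" for \<sigma>
  proof -
    have sub: "{z..x} \<subseteq> {-\<rho>..x1}" "{z..x} \<subseteq> {0..x1}" using z \<rho> by auto
    define G where "G = (\<lambda>t. exp (- (L * t)) * ((Y t - B t - \<epsilon>) * \<sigma>) - L * \<epsilon> * (t - z) - w0)"
    have "G x \<le> 0"
    proof (rule barrier[where G = G and a = z and b = x and d = 1 and t = x
        and D = "\<lambda>t. exp (- (L * t)) * ((f t (Y t) - f t (B t)) * \<sigma> - L * ((Y t - B t - \<epsilon>) * \<sigma>)) - L * \<epsilon>"])
      fix t assume t: "t \<in> {z..x}"
      have Yt: "(Y has_real_derivative f t (Y t)) (at t within {z..x})"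
        using Y_within[OF sub(1) t] slow_eq_f[OF \<epsilon> above[of t]] t z by simp
      have Bt: "(B has_real_derivative f t (B t)) (at t within {z..x})"
        by (rule has_field_derivative_subset[OF B sub(2)]) (use t z in auto)
      show "(G has_real_derivative exp (- (L * t)) * ((f t (Y t) - f t (B t)) * \<sigma> - L * ((Y t - B t - \<epsilon>) * \<sigma>)) - L * \<epsilon>)
          (at t within {z..x})"
        unfolding G_def by (rule derivative_eq_intros Yt Bt refl)+ (simp add: algebra_simps)
      assume "0 < G t"
      moreover have "0 \<le> L * \<epsilon> * (t - z)" "0 \<le> w0" using L \<epsilon> t z A K by (auto simp: w0_def)
      ultimately have "0 < exp (- (L * t)) * ((Y t - B t - \<epsilon>) * \<sigma>)" unfolding G_def by linarith
      then have pos: "0 < (Y t - B t - \<epsilon>) * \<sigma>" by (simp add: zero_less_mult_iff)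
      have "(f t (Y t) - f t (B t)) * \<sigma> \<le> L * \<bar>Y t - B t\<bar>" using f_lip[of t "Y t" "B t"] \<sigma> by auto
      also have "\<dots> \<le> L * ((Y t - B t - \<epsilon>) * \<sigma> + \<epsilon>)"
        using pos \<sigma> \<epsilon> L by (intro mult_left_mono) auto
      finally have "(f t (Y t) - f t (B t)) * \<sigma> - L * ((Y t - B t - \<epsilon>) * \<sigma>) \<le> L * \<epsilon>"
        by (simp add: algebra_simps)
      then have "exp (- (L * t)) * ((f t (Y t) - f t (B t)) * \<sigma> - L * ((Y t - B t - \<epsilon>) * \<sigma>)) \<le> exp (- (L * t)) * (L * \<epsilon>)"
        by (intro mult_left_mono) auto
      also have "\<dots> \<le> 1 * (L * \<epsilon>)" using L \<epsilon> t z by (intro mult_right_mono) auto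
      finally show "exp (- (L * t)) * ((f t (Y t) - f t (B t)) * \<sigma> - L * ((Y t - B t - \<epsilon>) * \<sigma>)) - L * \<epsilon> \<le> 0" by simp
    next
      have 1: "(Y z - B z - \<epsilon>) * \<sigma> \<le> w0" using \<open>\<bar>Y z - B z - \<epsilon>\<bar> \<le> w0\<close> \<sigma> by auto
      have "0 \<le> w0" using \<open>\<bar>Y z - B z - \<epsilon>\<bar> \<le> w0\<close> by linarith
      then have 2: "exp (- (L * z)) * w0 \<le> 1 * w0" using L z by (intro mult_right_mono) auto
      have "exp (- (L * z)) * ((Y z - B z - \<epsilon>) * \<sigma>) \<le> exp (- (L * z)) * w0"
        using 1 by (intro mult_left_mono) auto
      moreover have "G z = exp (- (L * z)) * ((Y z - B z - \<epsilon>) * \<sigma>) - w0" by (simp add: G_def)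
      ultimately show "G z \<le> 0" using 2 by linarith
    qed (use z in auto)
    then have "exp (- (L * x)) * ((Y x - B x - \<epsilon>) * \<sigma>) \<le> L * \<epsilon> * (x - z) + w0" by (simp add: G_def)
    also have "\<dots> \<le> L * \<epsilon> * x + w0" using L \<epsilon> z by (intro add_right_mono mult_left_mono) auto
    finally have *: "exp (L * x) * (exp (- (L * x)) * ((Y x - B x - \<epsilon>) * \<sigma>)) \<le> exp (L * x) * (L * \<epsilon> * x + w0)"
      by (intro mult_left_mono) auto
    have "(Y x - B x - \<epsilon>) * \<sigma> = exp (L * x) * (exp (- (L * x)) * ((Y x - B x - \<epsilon>) * \<sigma>))" by (simp add: exp_minus)
    also note *
    also have "exp (L * x) * (L * \<epsilon> * x + w0) \<le> exp (L * R) * (L * \<epsilon> * x + w0)"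
      using L \<epsilon> z A K x1 by (intro mult_right_mono) (auto intro: mult_left_mono simp: w0_def)
    finally show ?thesis .
  qed
  show ?thesis using main[of 1] main[of "-1"] by (auto simp: w0_def algebra_simps)
qed

end

section \<open>Trajectories from the lower edge, compared with the upper curve\<close>

locale sliding_flow = sliding_top +
  fixes x y :: "real \<Rightarrow> real" and T r' :: real
  assumes T: "0 \<le> T" and start: "x 0 = - r'" "y 0 = - \<epsilon>" "0 \<le> r'" "r' \<le> \<rho>"
    and x_der: "t \<in> {0..T} \<Longrightarrow> (x has_real_derivative P (y t / \<epsilon>) * X1 (x t) (y t)) (at t within {0..T})"
    and y_der: "t \<in> {0..T} \<Longrightarrow> (y has_real_derivative
      P (y t / \<epsilon>) * X1 (x t) (y t) * f (x t) (y t) + (1 - P (y t / \<epsilon>))) (at t within {0..T})"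
    and x_le: "t \<in> {0..T} \<Longrightarrow> x t \<le> x1"
begin

lemma sub_der: "{s..t} \<subseteq> {0..T} \<Longrightarrow> u \<in> {s..t} \<Longrightarrow> (h has_real_derivative d) (at u within {0..T}) \<Longrightarrow>
    (h has_real_derivative d) (at u within {s..t})"
  by (rule has_field_derivative_subset)

lemma x_mono: "0 \<le> s \<Longrightarrow> s \<le> t \<Longrightarrow> t \<le> T \<Longrightarrow> x s \<le> x t"
proof -
  assume s: "0 \<le> s" "s \<le> t" "t \<le> T"
  have "- x t \<le> - x s"
    by (rule barrier_antimono[where D = "\<lambda>u. - (P (y u / \<epsilon>) * X1 (x u) (y u))"])
       (use s P01 X1_pos in \<open>auto intro!: derivative_intros sub_der[OF _ _ x_der] mult_nonneg_nonneg less_imp_le[OF X1_pos]\<close>)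
  then show ?thesis by simp
qed

lemma x_range: "t \<in> {0..T} \<Longrightarrow> x t \<in> {-\<rho>..x1}"
  using x_mono[of 0 t] x_le[of t] start by auto

lemma y_ge: "t \<in> {0..T} \<Longrightarrow> -\<epsilon> \<le> y t"
proof -
  assume t: "t \<in> {0..T}"
  have "-\<epsilon> - y t \<le> 0"
  proof (rule barrier[where G = "\<lambda>t. -\<epsilon> - y t" and a = 0 and b = T and d = 1 and t = t and
      D = "\<lambda>t. - (P (y t / \<epsilon>) * X1 (x t) (y t) * f (x t) (y t) + (1 - P (y t / \<epsilon>)))"])
    fix u assume "0 < -\<epsilon> - y u"
    then have "P (y u / \<epsilon>) = 0" using \<epsilon> by (intro P_lo) (auto simp: field_simps)
    then show "- (P (y u / \<epsilon>) * X1 (x u) (y u) * f (x u) (y u) + (1 - P (y u / \<epsilon>))) \<le> 0" by simp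
  qed (use t start in \<open>auto intro!: derivative_eq_intros y_der\<close>)
  then show ?thesis by simp
qed

text \<open>On the lower edge the field is (0, 1), so a trajectory on it at a positive time would
  have been below it just before, against \<open>y_ge\<close>. Positivity of \<open>P\<close> along
  the trajectory, and with it strict growth of the abscissa, depends on this.\<close>

lemma y_gt: "t \<in> {0<..T} \<Longrightarrow> -\<epsilon> < y t"
proof (rule ccontr)
  assume t: "t \<in> {0<..T}" and "\<not> -\<epsilon> < y t"
  then have yt: "y t = -\<epsilon>" using y_ge[of t] by auto
  then have "P (y t / \<epsilon>) = 0" using \<epsilon> by (intro P_lo) auto
  then have "(y has_real_derivative 1) (at t within {0..T})" using y_der[of t] t by auto
  from has_real_derivative_pos_inc_left[OF this] obtain d where d: "d > 0"
    "\<And>h. 0 < h \<Longrightarrow> t - h \<in> {0..T} \<Longrightarrow> h < d \<Longrightarrow> y (t - h) < y t" by auto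
  define h where "h = min t (d / 2)"
  have "y (t - h) < y t" using d t by (intro d(2)) (auto simp: h_def)
  moreover have "-\<epsilon> \<le> y (t - h)" using t d by (intro y_ge) (auto simp: h_def)
  ultimately show False using yt by simp
qed

lemma x_cont: "continuous_on {0..T} x"
  using x_der by (meson DERIV_continuous continuous_on_eq_continuous_within)

lemma x_strict: "0 \<le> s \<Longrightarrow> s < t \<Longrightarrow> t \<le> T \<Longrightarrow> x s < x t"
proof -
  assume s: "0 \<le> s" "s < t" "t \<le> T"
  show ?thesis
  proof (rule DERIV_pos_imp_increasing_open[OF s(2)])
    fix u assume u: "s < u" "u < t"
    then have "(x has_real_derivative P (y u / \<epsilon>) * X1 (x u) (y u)) (at u)"
      using x_der[of u] s by (simp add: at_within_Icc_at)
    moreover have "0 < P (y u / \<epsilon>) * X1 (x u) (y u)"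
      using y_gt[of u] u s \<epsilon> by (intro mult_pos_pos P_pos X1_pos) (auto simp: field_simps)
    ultimately show "\<exists>z. (x has_real_derivative z) (at u) \<and> 0 < z" by blast
  next
    show "continuous_on {s..t} x"
      by (rule continuous_on_subset[OF x_cont]) (use s in auto)
  qed
qed

text \<open>The abscissa alone starts with speed 0. In \<open>x + y\<close> the parts weighted by
  \<open>P\<close> and by \<open>1 - P\<close> both contribute: at least \<open>m / 2\<close>, as
  the slope is at least -1/2, and 1.\<close>

lemma speed:
  assumes t: "t \<in> {0..T}"
  shows "min (m / 2) 1 * t - r' - \<epsilon> \<le> x t + y t"
proof -
  define \<sigma> where "\<sigma> = min (m / 2) 1"
  have "\<sigma> * t - (x t + y t) \<le> \<sigma> * 0 - (x 0 + y 0)"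
  proof (rule barrier_antimono[where D = "\<lambda>t. \<sigma> - (P (y t / \<epsilon>) * X1 (x t) (y t) +
      (P (y t / \<epsilon>) * X1 (x t) (y t) * f (x t) (y t) + (1 - P (y t / \<epsilon>))))" and s = 0 and t = t])
    fix u assume u: "u \<in> {0..t}"
    then show "((\<lambda>t. \<sigma> * t - (x t + y t)) has_real_derivative \<sigma> - (P (y u / \<epsilon>) * X1 (x u) (y u) +
      (P (y u / \<epsilon>) * X1 (x u) (y u) * f (x u) (y u) + (1 - P (y u / \<epsilon>))))) (at u within {0..t})"
      using t by (auto intro!: derivative_eq_intros sub_der[OF _ _ x_der] sub_der[OF _ _ y_der])
    let ?p = "P (y u / \<epsilon>)"
    have "?p * X1 (x u) (y u) * (- (1 / 2)) \<le> ?p * X1 (x u) (y u) * f (x u) (y u)"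
      using f[of "x u" "y u"] P01 less_imp_le[OF X1_pos] by (intro mult_left_mono) auto
    moreover have "?p * m \<le> ?p * X1 (x u) (y u)" using P01 X1 by (intro mult_left_mono) auto
    moreover have "\<sigma> * ?p \<le> m / 2 * ?p" "\<sigma> * (1 - ?p) \<le> 1 * (1 - ?p)"
      by (rule mult_right_mono, simp_all only: \<sigma>_def min.cobounded1 min.cobounded2 P01 diff_ge_0_iff_ge)+
    ultimately show "\<sigma> - (?p * X1 (x u) (y u) + (?p * X1 (x u) (y u) * f (x u) (y u) + (1 - ?p))) \<le> 0"
      by (simp add: algebra_simps)
  qed (use t in auto)
  then show ?thesis using start by (simp add: \<sigma>_def)
qed

definition \<Delta> where "\<Delta> t = Y (x t) - y t"

text \<open>The first summand bounds the variation of \<open>f\<close>, the second that of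
  \<open>X1\<close> in the denominator of \<open>slow\<close>.\<close>

definition C' where "C' = L + L / (p0 * m ^ 2)"

lemma C': "0 \<le> C'" using L p0 by (auto simp: C'_def)

definition \<Delta>' where "\<Delta>' t = P (y t / \<epsilon>) * X1 (x t) (y t) * slow \<epsilon> (x t) (Y (x t))
    - (P (y t / \<epsilon>) * X1 (x t) (y t) * f (x t) (y t) + (1 - P (y t / \<epsilon>)))"

lemma \<Delta>_der:
  assumes "t \<in> {0..T}"
  shows "(\<Delta> has_real_derivative \<Delta>' t) (at t within {0..T})"
proof -
  have "(Y has_real_derivative slow \<epsilon> (x t) (Y (x t))) (at (x t) within x ` {0..T})"
    by (rule has_field_derivative_subset[OF Y]) (use x_range assms in auto)
  from DERIV_diff[OF DERIV_image_chain[OF this x_der[OF assms]] y_der[OF assms]]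
  show ?thesis by (simp add: \<Delta>_def[abs_def] \<Delta>'_def o_def mult_ac)
qed

text \<open>Multiplying the field by the abscissa speed removes the singularity of the slope at
  \<open>y = -\<epsilon>\<close>, so that only the profile at the upper curve \<open>Y\<close> has to stay away from 0.\<close>

lemma \<Delta>'_bounds:
  assumes t: "t \<in> {0..T}"
  shows "\<bar>\<Delta>' t - (P (y t / \<epsilon>) - P (Y (x t) / \<epsilon>)) / P (Y (x t) / \<epsilon>)\<bar>
    \<le> C' * (P (y t / \<epsilon>) * X1 (x t) (y t)) * \<bar>\<Delta> t\<bar>"
proof -
  define pB where "pB = P (y t / \<epsilon>)"
  define pT where "pT = P (Y (x t) / \<epsilon>)"
  define XB where "XB = X1 (x t) (y t)"
  define XT where "XT = X1 (x t) (Y (x t))"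
  define df where "df = f (x t) (Y (x t)) - f (x t) (y t)"
  have pT: "p0 \<le> pT" "0 < pT" "pT \<le> 1" using PY_ge[OF x_range[OF t]] p0 P01 by (auto simp: pT_def)
  have pB: "0 \<le> pB" "pB \<le> 1" using P01 by (auto simp: pB_def)
  have X: "m \<le> XB" "m \<le> XT" "0 < XB" "0 < XT" using X1 X1_pos by (auto simp: XB_def XT_def)
  have g: "g (Y (x t) / \<epsilon>) = (1 - pT) / pT" using pT by (simp add: g_def pT_def max_absorb1)
  have "\<Delta>' t = pB * XB * df + pB * XB * ((1 - pT) / pT / XT) - (1 - pB)"
    unfolding \<Delta>'_def slow_def g by (simp add: pB_def XB_def XT_def df_def algebra_simps)
  also have "pB * XB * ((1 - pT) / pT / XT) = pB * ((1 - pT) / pT) * ((XB - XT) / XT) + pB * ((1 - pT) / pT)"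
    using X by (simp add: diff_divide_distrib algebra_simps)
  also have "pB * ((1 - pT) / pT) = (pB - pT) / pT + (1 - pB)" using pT by (simp add: field_simps)
  finally have eq: "\<Delta>' t - (pB - pT) / pT = pB * XB * df + pB * ((1 - pT) / pT) * ((XB - XT) / XT)"
    using pT by (simp add: field_simps)
  have "\<bar>pB * XB * df\<bar> \<le> pB * XB * (L * \<bar>\<Delta> t\<bar>)"
    using f_lip[of "x t" "Y (x t)" "y t"] pB X unfolding abs_mult
    by (intro mult_mono) (auto simp: df_def \<Delta>_def)
  moreover have "\<bar>pB * ((1 - pT) / pT) * ((XB - XT) / XT)\<bar> \<le> pB * XB * (L / (p0 * m ^ 2) * \<bar>\<Delta> t\<bar>)"
  proof -
    have "(1 - pT) / pT \<le> 1 / p0" using pT p0 by (intro frac_le) auto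
    then have 1: "\<bar>pB * ((1 - pT) / pT)\<bar> \<le> pB * (1 / p0)"
      using pT mult_left_mono[OF _ pB(1), of "(1 - pT) / pT" "1 / p0"]
        abs_of_nonneg[OF mult_nonneg_nonneg[OF pB(1), of "(1 - pT) / pT"]] by simp
    have "\<bar>XB - XT\<bar> \<le> L * \<bar>\<Delta> t\<bar>"
      using X1_lip[of "x t" "y t" "Y (x t)"] by (simp add: XB_def XT_def \<Delta>_def abs_minus_commute)
    then have 2: "\<bar>(XB - XT) / XT\<bar> \<le> L * \<bar>\<Delta> t\<bar> / m"
      using X m L by (auto simp: abs_divide intro!: frac_le)
    have "\<bar>pB * ((1 - pT) / pT) * ((XB - XT) / XT)\<bar> \<le> pB * (1 / p0) * (L * \<bar>\<Delta> t\<bar> / m)"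
      unfolding abs_mult[of "pB * ((1 - pT) / pT)"] using 1 2 pB p0 by (intro mult_mono) auto
    also have "\<dots> = pB * m * (L / (p0 * m ^ 2) * \<bar>\<Delta> t\<bar>)" using m by (simp add: power2_eq_square)
    also have "\<dots> \<le> pB * XB * (L / (p0 * m ^ 2) * \<bar>\<Delta> t\<bar>)"
      using X pB p0 L by (intro mult_right_mono mult_left_mono) auto
    finally show ?thesis .
  qed
  ultimately have "\<bar>\<Delta>' t - (pB - pT) / pT\<bar> \<le> pB * XB * (L * \<bar>\<Delta> t\<bar>) + pB * XB * (L / (p0 * m ^ 2) * \<bar>\<Delta> t\<bar>)"
    unfolding eq by linarith
  also have "\<dots> = C' * (pB * XB) * \<bar>\<Delta> t\<bar>" by (simp add: C'_def algebra_simps)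
  finally show ?thesis by (simp add: pB_def pT_def XB_def)
qed

text \<open>Where \<open>\<Delta>\<close> is negative the profile term in
  \<open>\<Delta>'_bounds\<close> pushes it up, and the remainder is linear in
  \<open>\<Delta>\<close> with the abscissa speed as a factor. Hence the integrating factor is an
  exponential of the abscissa, not of time.\<close>

lemma \<Delta>_nonneg:
  assumes "t \<in> {0..T}"
  shows "0 \<le> \<Delta> t"
proof -
  have "- \<Delta> t * exp (- (C' * x t)) \<le> 0"
  proof (rule barrier[where G = "\<lambda>t. - \<Delta> t * exp (- (C' * x t))" and a = 0 and b = T and d = 1 and t = t and
      D = "\<lambda>t. (C' * (P (y t / \<epsilon>) * X1 (x t) (y t)) * \<Delta> t - \<Delta>' t) * exp (- (C' * x t))"])
    fix u assume u: "u \<in> {0..T}"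
    show "((\<lambda>t. - \<Delta> t * exp (- (C' * x t))) has_real_derivative
       (C' * (P (y u / \<epsilon>) * X1 (x u) (y u)) * \<Delta> u - \<Delta>' u) * exp (- (C' * x u))) (at u within {0..T})"
      by (rule derivative_eq_intros \<Delta>_der[OF u] x_der[OF u] refl)+ (simp add: algebra_simps)
    assume "0 < - \<Delta> u * exp (- (C' * x u))"
    then have neg: "\<Delta> u < 0" by (simp add: mult_less_0_iff)
    then have "P (Y (x u) / \<epsilon>) \<le> P (y u / \<epsilon>)" using \<epsilon> by (intro P_mono divide_right_mono) (auto simp: \<Delta>_def)
    then have "0 \<le> (P (y u / \<epsilon>) - P (Y (x u) / \<epsilon>)) / P (Y (x u) / \<epsilon>)" using P01 by auto
    then have "C' * (P (y u / \<epsilon>) * X1 (x u) (y u)) * \<Delta> u - \<Delta>' u \<le> 0"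
      using \<Delta>'_bounds[OF u] neg by auto
    then show "(C' * (P (y u / \<epsilon>) * X1 (x u) (y u)) * \<Delta> u - \<Delta>' u) * exp (- (C' * x u)) \<le> 0"
      by (simp add: mult_le_0_iff)
  next
    have "-\<epsilon> \<le> Y (- r')" using start T x1 by (intro Y_ge) auto
    then show "- \<Delta> 0 * exp (- (C' * x 0)) \<le> 0"
      by (simp add: \<Delta>_def start mult_le_0_iff)
  qed (use assms in auto)
  then show ?thesis by (simp add: zero_le_mult_iff)
qed

text \<open>The profile difference acts as damping and is bounded below by \<open>P_incr\<close>;
  the bound \<open>M\<close> on the abscissa speed turns a rate in time into the rate
  \<open>\<sigma>\<close> per unit of abscissa. The case \<open>\<sigma> = 0\<close> drops the
  damping and records growth by at most the exponential of \<open>C'\<close> times the abscissa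
  covered.\<close>

lemma \<Delta>_contract:
  assumes st: "0 \<le> s" "s \<le> t" "t \<le> T" and w: "0 \<le> w" "w \<le> 1"
    and \<sigma>: "\<sigma> = 0 \<or> (\<sigma> = c1 * w ^ (n - 1) / (\<epsilon> * M) \<and> (\<forall>u\<in>{s..t}. Y (x u) \<le> \<epsilon> * (1 - w)))"
  shows "\<Delta> t * exp ((\<sigma> - C') * x t) \<le> \<Delta> s * exp ((\<sigma> - C') * x s)"
proof (rule barrier_antimono[OF st(2), where D = "\<lambda>u. (\<Delta>' u + (\<sigma> - C') * (P (y u / \<epsilon>) * X1 (x u) (y u)) * \<Delta> u)
    * exp ((\<sigma> - C') * x u)"])
  fix u assume u: "u \<in> {s..t}"
  then have uT: "u \<in> {0..T}" using st by auto
  have sub: "{s..t} \<subseteq> {0..T}" using st by auto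
  show "((\<lambda>u. \<Delta> u * exp ((\<sigma> - C') * x u)) has_real_derivative
     (\<Delta>' u + (\<sigma> - C') * (P (y u / \<epsilon>) * X1 (x u) (y u)) * \<Delta> u) * exp ((\<sigma> - C') * x u)) (at u within {s..t})"
    by (rule derivative_eq_intros sub_der[OF sub u \<Delta>_der[OF uT]] sub_der[OF sub u x_der[OF uT]] refl)+
       (simp add: algebra_simps)
  let ?xd = "P (y u / \<epsilon>) * X1 (x u) (y u)" and ?dp = "P (Y (x u) / \<epsilon>) - P (y u / \<epsilon>)"
  have \<Delta>u: "0 \<le> \<Delta> u" by (rule \<Delta>_nonneg[OF uT])
  then have dp: "0 \<le> ?dp" using P_mono[of "y u / \<epsilon>" "Y (x u) / \<epsilon>"] \<epsilon> by (auto simp: \<Delta>_def field_simps)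
  have pT: "0 < P (Y (x u) / \<epsilon>)" "P (Y (x u) / \<epsilon>) \<le> 1" using PY_ge[OF x_range[OF uT]] p0 P01 by auto
  have "?dp * 1 \<le> ?dp * (1 / P (Y (x u) / \<epsilon>))" using pT dp by (intro mult_left_mono) auto
  then have "\<Delta>' u \<le> C' * ?xd * \<Delta> u - ?dp"
    using \<Delta>'_bounds[OF uT] \<Delta>u by (simp add: diff_divide_distrib abs_le_iff)
  moreover have "\<sigma> * ?xd * \<Delta> u \<le> ?dp"
  proof (cases "\<sigma> = 0")
    case False
    then have \<sigma>: "\<sigma> = c1 * w ^ (n - 1) / (\<epsilon> * M)" "Y (x u) \<le> \<epsilon> * (1 - w)" using \<sigma> u by auto
    have "?xd \<le> 1 * M" using P01 X1 X1_pos mM by (intro mult_mono) (auto intro: less_imp_le)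
    then have "\<sigma> * ?xd * \<Delta> u \<le> \<sigma> * M * \<Delta> u"
      using \<sigma> c1 w \<epsilon> mM \<Delta>u by (intro mult_right_mono mult_left_mono) auto
    also have "\<dots> = c1 * w ^ (n - 1) * (Y (x u) / \<epsilon> - y u / \<epsilon>)"
      using \<sigma>(1) mM by (simp add: \<Delta>_def flip: diff_divide_distrib)
    also have "\<dots> \<le> ?dp"
      using w \<sigma>(2) v1_le[OF x_range[OF uT]] y_ge[OF uT] \<Delta>u \<epsilon>
      by (intro P_incr) (auto simp: \<Delta>_def field_simps)
    finally show ?thesis .
  qed (use dp in auto)
  ultimately have "\<Delta>' u + (\<sigma> - C') * ?xd * \<Delta> u \<le> 0" by (simp add: algebra_simps)
  then show "(\<Delta>' u + (\<sigma> - C') * ?xd * \<Delta> u) * exp ((\<sigma> - C') * x u) \<le> 0"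
    by (simp add: mult_le_0_iff)
qed

text \<open>Damping is used only between \<open>- \<xi>\<close> and \<open>- (\<xi> / 2)\<close>, an
  interval that every start with \<open>\<xi> \<le> r'\<close> crosses; before and after it the
  distance grows by a bounded factor. At time 0 it is at most \<open>2 * \<epsilon>\<close>.\<close>

lemma \<Delta>_exponentially_small:
  assumes w: "0 \<le> w" "w \<le> 1" and \<xi>: "0 < \<xi>" "\<xi> \<le> r'"
    and below: "\<And>z. z \<in> {-\<rho>..- (\<xi> / 2)} \<Longrightarrow> Y z \<le> \<epsilon> * (1 - w)" and xT: "- (\<xi> / 2) \<le> x T"
  shows "\<Delta> T \<le> 2 * \<epsilon> * exp (2 * C' * R) * exp (- (c1 * w ^ (n - 1) / (\<epsilon> * M)) * (\<xi> / 2))"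
proof -
  define \<sigma> where "\<sigma> = c1 * w ^ (n - 1) / (\<epsilon> * M)"
  have cx': "continuous_on {s..T} x" if "0 \<le> s" for s
    by (rule continuous_on_subset[OF x_cont]) (use that in auto)
  obtain t1 where t1: "0 \<le> t1" "t1 \<le> T" "x t1 = - \<xi>"
    using IVT'[of x 0 "-\<xi>" T] start xT \<xi> T x_cont by auto
  obtain t2 where t2: "t1 \<le> t2" "t2 \<le> T" "x t2 = - (\<xi> / 2)"
    using IVT'[of x t1 "- (\<xi> / 2)" T] t1 xT \<xi> cx' by auto
  have Yw: "Y (x u) \<le> \<epsilon> * (1 - w)" if "u \<in> {t1..t2}" for u
    using x_mono[of u t2] x_range[of u] that t1 t2 by (intro below) auto
  have 1: "\<Delta> t1 * exp ((0 - C') * x t1) \<le> \<Delta> 0 * exp ((0 - C') * x 0)"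
    using t1 by (intro \<Delta>_contract[where w = 0]) auto
  have 2: "\<Delta> t2 * exp ((\<sigma> - C') * x t2) \<le> \<Delta> t1 * exp ((\<sigma> - C') * x t1)"
    using t1 t2 w Yw by (intro \<Delta>_contract[where w = w]) (auto simp: \<sigma>_def)
  have 3: "\<Delta> T * exp ((0 - C') * x T) \<le> \<Delta> t2 * exp ((0 - C') * x t2)"
    using t1 t2 by (intro \<Delta>_contract[where w = 0]) auto
  have Y0: "\<Delta> 0 \<le> 2 * \<epsilon>"
  proof -
    have "Y (- r') \<le> \<epsilon> * (1 - w)" using start \<xi> by (intro below) auto
    also have "\<dots> \<le> \<epsilon> * 1" using \<epsilon> w by (intro mult_left_mono) auto
    finally show ?thesis by (simp add: \<Delta>_def start)
  qed
  have "\<Delta> T * exp (- C' * x T) \<le> \<Delta> t2 * exp ((\<sigma> - C') * x t2) * exp (- \<sigma> * x t2)"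
    using 3 by (simp add: mult.assoc exp_add[symmetric] algebra_simps)
  also have "\<dots> \<le> \<Delta> t1 * exp ((\<sigma> - C') * x t1) * exp (- \<sigma> * x t2)"
    using 2 by (intro mult_right_mono) auto
  also have "\<dots> = \<Delta> t1 * exp ((0 - C') * x t1) * exp (- \<sigma> * (\<xi> / 2))"
    unfolding mult.assoc exp_add[symmetric] t1 t2 by (simp add: algebra_simps)
  also have "\<dots> \<le> \<Delta> 0 * exp ((0 - C') * x 0) * exp (- \<sigma> * (\<xi> / 2))"
    using 1 by (intro mult_right_mono) auto
  also have "\<dots> \<le> (2 * \<epsilon>) * exp (C' * R) * exp (- \<sigma> * (\<xi> / 2))"
    using Y0 \<epsilon> start \<rho> C' by (intro mult_right_mono mult_mono) (auto intro: mult_left_mono)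
  finally have "exp (C' * x T) * (\<Delta> T * exp (- C' * x T))
      \<le> exp (C' * x T) * ((2 * \<epsilon>) * exp (C' * R) * exp (- \<sigma> * (\<xi> / 2)))"
    by (intro mult_left_mono) auto
  moreover have "exp (C' * x T) * (\<Delta> T * exp (- C' * x T)) = \<Delta> T" by (simp add: exp_minus)
  moreover have "exp (C' * x T) * ((2 * \<epsilon>) * exp (C' * R) * exp (- \<sigma> * (\<xi> / 2)))
      \<le> exp (C' * R) * ((2 * \<epsilon>) * exp (C' * R) * exp (- \<sigma> * (\<xi> / 2)))"
    using \<epsilon> C' x_le[of T] x1 T by (intro mult_right_mono) (auto intro: mult_left_mono)
  moreover have "exp (C' * R) * ((2 * \<epsilon>) * exp (C' * R) * exp (- \<sigma> * (\<xi> / 2)))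
      = 2 * \<epsilon> * exp (2 * C' * R) * exp (- \<sigma> * (\<xi> / 2))"
  proof -
    have "exp (2 * C' * R) = exp (C' * R) * exp (C' * R)" unfolding exp_add[symmetric] by simp
    then show ?thesis by (simp only: mult_ac)
  qed
  ultimately show ?thesis unfolding \<sigma>_def[symmetric] by linarith
qed

end

section \<open>Existence of the trajectories\<close>

text \<open>Boundedness is included because it makes the class closed under products and, with a
  positive lower bound on the denominator, under quotients; the cut-off fields are assembled by such
  operations.\<close>

definition bounded_lipschitz :: "(real \<times> real \<Rightarrow> real) \<Rightarrow> bool" where
  "bounded_lipschitz h \<longleftrightarrow> (\<exists>K B. \<forall>p q. \<bar>h p - h q\<bar> \<le> K * dist p q \<and> \<bar>h p\<bar> \<le> B)"

lemma bounded_lipschitzD: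
  assumes "bounded_lipschitz h"
  shows "\<exists>K B. 0 \<le> K \<and> 0 \<le> B \<and> (\<forall>p q. \<bar>h p - h q\<bar> \<le> K * dist p q) \<and> (\<forall>p. \<bar>h p\<bar> \<le> B)"
proof -
  obtain K B where KB: "\<And>p q. \<bar>h p - h q\<bar> \<le> K * dist p q" "\<And>p. \<bar>h p\<bar> \<le> B"
    using assms unfolding bounded_lipschitz_def by blast
  have "0 \<le> K" using KB(1)[of "(0, 0)" "(1, 0)"] by (simp add: dist_Pair_Pair)
  moreover have "0 \<le> B" using KB(2)[of "(0, 0)"] by auto
  ultimately show ?thesis using KB by blast
qed

lemma bounded_lipschitz_const: "bounded_lipschitz (\<lambda>_. c)"
  unfolding bounded_lipschitz_def by (intro exI[of _ 0] exI[of _ "\<bar>c\<bar>"]) auto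

lemma bounded_lipschitz_add:
  assumes "bounded_lipschitz h1" "bounded_lipschitz h2"
  shows "bounded_lipschitz (\<lambda>p. h1 p + h2 p)"
proof -
  obtain K1 B1 where 1: "0 \<le> K1" "0 \<le> B1" "\<And>p q. \<bar>h1 p - h1 q\<bar> \<le> K1 * dist p q" "\<And>p. \<bar>h1 p\<bar> \<le> B1"
    using bounded_lipschitzD[OF assms(1)] by metis
  obtain K2 B2 where 2: "0 \<le> K2" "0 \<le> B2" "\<And>p q. \<bar>h2 p - h2 q\<bar> \<le> K2 * dist p q" "\<And>p. \<bar>h2 p\<bar> \<le> B2"
    using bounded_lipschitzD[OF assms(2)] by metis
  have "\<bar>h1 p + h2 p - (h1 q + h2 q)\<bar> \<le> (K1 + K2) * dist p q \<and> \<bar>h1 p + h2 p\<bar> \<le> B1 + B2" for p q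
    using 1(3)[of p q] 2(3)[of p q] 1(4)[of p] 2(4)[of p] unfolding distrib_right by linarith
  then show ?thesis unfolding bounded_lipschitz_def by blast
qed

lemma bounded_lipschitz_mult:
  assumes "bounded_lipschitz h1" "bounded_lipschitz h2"
  shows "bounded_lipschitz (\<lambda>p. h1 p * h2 p)"
proof -
  obtain K1 B1 where 1: "0 \<le> K1" "0 \<le> B1" "\<And>p q. \<bar>h1 p - h1 q\<bar> \<le> K1 * dist p q" "\<And>p. \<bar>h1 p\<bar> \<le> B1"
    using bounded_lipschitzD[OF assms(1)] by metis
  obtain K2 B2 where 2: "0 \<le> K2" "0 \<le> B2" "\<And>p q. \<bar>h2 p - h2 q\<bar> \<le> K2 * dist p q" "\<And>p. \<bar>h2 p\<bar> \<le> B2"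
    using bounded_lipschitzD[OF assms(2)] by metis
  have "\<bar>h1 p * h2 p - h1 q * h2 q\<bar> \<le> (K1 * B2 + B1 * K2) * dist p q \<and> \<bar>h1 p * h2 p\<bar> \<le> B1 * B2" for p q
  proof
    have "\<bar>h1 p * h2 p - h1 q * h2 q\<bar> = \<bar>(h1 p - h1 q) * h2 p + h1 q * (h2 p - h2 q)\<bar>"
      by (simp add: algebra_simps)
    also have "\<dots> \<le> \<bar>h1 p - h1 q\<bar> * \<bar>h2 p\<bar> + \<bar>h1 q\<bar> * \<bar>h2 p - h2 q\<bar>"
      unfolding abs_mult[symmetric] by (rule abs_triangle_ineq)
    also have "\<dots> \<le> (K1 * dist p q) * B2 + B1 * (K2 * dist p q)"
      using 1 2 by (intro add_mono mult_mono) auto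
    finally show "\<bar>h1 p * h2 p - h1 q * h2 q\<bar> \<le> (K1 * B2 + B1 * K2) * dist p q"
      by (simp add: algebra_simps)
    show "\<bar>h1 p * h2 p\<bar> \<le> B1 * B2" unfolding abs_mult using 1 2 by (intro mult_mono) auto
  qed
  then show ?thesis unfolding bounded_lipschitz_def by blast
qed

lemma bounded_lipschitz_diff:
  "bounded_lipschitz h1 \<Longrightarrow> bounded_lipschitz h2 \<Longrightarrow> bounded_lipschitz (\<lambda>p. h1 p - h2 p)"
  using bounded_lipschitz_add[of h1 "\<lambda>p. (-1) * h2 p"]
    bounded_lipschitz_mult[OF bounded_lipschitz_const[of "-1"], of h2] by simp

lemma bounded_lipschitz_divide:
  assumes "bounded_lipschitz h1" "bounded_lipschitz h2" "0 < c" "\<And>p. c \<le> h2 p"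
  shows "bounded_lipschitz (\<lambda>p. h1 p / h2 p)"
proof -
  obtain K B where 2: "0 \<le> K" "0 \<le> B" "\<And>p q. \<bar>h2 p - h2 q\<bar> \<le> K * dist p q" "\<And>p. \<bar>h2 p\<bar> \<le> B"
    using bounded_lipschitzD[OF assms(2)] by metis
  have "\<bar>1 / h2 p - 1 / h2 q\<bar> \<le> K / c ^ 2 * dist p q \<and> \<bar>1 / h2 p\<bar> \<le> 1 / c" for p q
  proof
    have pos: "0 < h2 p" "0 < h2 q" using assms(3,4) less_le_trans by blast+
    then have "\<bar>1 / h2 p - 1 / h2 q\<bar> = \<bar>h2 p - h2 q\<bar> / (h2 p * h2 q)"
      by (simp add: field_simps abs_mult flip: abs_divide) (simp add: abs_minus_commute abs_mult)
    also have "\<dots> \<le> K * dist p q / (c * c)"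
      using assms(3,4) 2 pos by (intro frac_le mult_mono) auto
    finally show "\<bar>1 / h2 p - 1 / h2 q\<bar> \<le> K / c ^ 2 * dist p q" by (simp add: power2_eq_square)
    show "\<bar>1 / h2 p\<bar> \<le> 1 / c" using pos assms(3) assms(4)[of p] by (auto intro!: frac_le)
  qed
  then have "bounded_lipschitz (\<lambda>p. 1 / h2 p)" unfolding bounded_lipschitz_def by blast
  from bounded_lipschitz_mult[OF assms(1) this] show ?thesis by simp
qed

lemma bounded_lipschitz_Pair:
  assumes "bounded_lipschitz h1" "bounded_lipschitz h2"
  shows "\<exists>L. L-lipschitz_on UNIV (\<lambda>p. (h1 p, h2 p))"
proof -
  obtain K1 B1 where 1: "0 \<le> K1" "0 \<le> B1" "\<And>p q. \<bar>h1 p - h1 q\<bar> \<le> K1 * dist p q" "\<And>p. \<bar>h1 p\<bar> \<le> B1"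
    using bounded_lipschitzD[OF assms(1)] by metis
  obtain K2 B2 where 2: "0 \<le> K2" "0 \<le> B2" "\<And>p q. \<bar>h2 p - h2 q\<bar> \<le> K2 * dist p q" "\<And>p. \<bar>h2 p\<bar> \<le> B2"
    using bounded_lipschitzD[OF assms(2)] by metis
  have "dist (h1 p, h2 p) (h1 q, h2 q) \<le> (K1 + K2) * dist p q" for p q
  proof -
    have "dist (h1 p, h2 p) (h1 q, h2 q) \<le> \<bar>h1 p - h1 q\<bar> + \<bar>h2 p - h2 q\<bar>"
      unfolding dist_Pair_Pair dist_real_def using sqrt_sum_squares_le_sum_abs[of "\<bar>h1 p - h1 q\<bar>"] by simp
    then show ?thesis using 1(3)[of p q] 2(3)[of p q] by (simp add: distrib_right)
  qed
  then have "(K1 + K2)-lipschitz_on UNIV (\<lambda>p. (h1 p, h2 p))" using 1 2 by (intro lipschitz_onI) auto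
  then show ?thesis by blast
qed

lemma has_real_derivative_fst_snd:
  assumes "(\<gamma> has_vector_derivative (d :: real \<times> real)) F"
  shows "((\<lambda>t. fst (\<gamma> t)) has_real_derivative fst d) F" "((\<lambda>t. snd (\<gamma> t)) has_real_derivative snd d) F"
  using assms unfolding has_real_derivative_iff_has_vector_derivative has_vector_derivative_def
  by (auto intro!: derivative_eq_intros)

lemma planar_ode_exists:
  assumes "bounded_lipschitz h1" "bounded_lipschitz h2" "0 \<le> T"
  shows "\<exists>x y. x 0 = x0 \<and> y 0 = y0 \<and> (\<forall>t\<in>{0..T}. (x has_real_derivative h1 (x t, y t)) (at t within {0..T}) \<and>
    (y has_real_derivative h2 (x t, y t)) (at t within {0..T}))"
proof -
  obtain L where "L-lipschitz_on UNIV (\<lambda>p. (h1 p, h2 p))"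
    using bounded_lipschitz_Pair[OF assms(1,2)] by blast
  from picard_global[OF this, of "(x0, y0)"] assms(3) obtain \<gamma> h where \<gamma>: "\<gamma> 0 = (x0, y0)" "0 < h"
    "\<And>t. t \<in> {-h..T} \<Longrightarrow> (\<gamma> has_vector_derivative (h1 (\<gamma> t), h2 (\<gamma> t))) (at t within {-h..T})" by blast
  have "(\<gamma> has_vector_derivative (h1 (\<gamma> t), h2 (\<gamma> t))) (at t within {0..T})" if "t \<in> {0..T}" for t
    by (rule has_vector_derivative_within_subset[OF \<gamma>(3)]) (use that \<gamma>(2) in auto)
  from has_real_derivative_fst_snd[OF this] show ?thesis using \<gamma>(1)
    by (intro exI[of _ "\<lambda>t. fst (\<gamma> t)"] exI[of _ "\<lambda>t. snd (\<gamma> t)"]) auto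
qed

text \<open>The nonautonomous equation is an autonomous planar one with abscissa speed 1.\<close>

lemma scalar_ode_exists:
  assumes "bounded_lipschitz h" "a \<le> b"
  shows "\<exists>Y. Y a = y0 \<and> (\<forall>x\<in>{a..b}. (Y has_real_derivative h (x, Y x)) (at x within {a..b}))"
proof -
  obtain x y where xy: "x 0 = a" "y 0 = y0"
    "\<And>t. t \<in> {0..b - a} \<Longrightarrow> (x has_real_derivative 1) (at t within {0..b - a})"
    "\<And>t. t \<in> {0..b - a} \<Longrightarrow> (y has_real_derivative h (x t, y t)) (at t within {0..b - a})"
    using planar_ode_exists[OF bounded_lipschitz_const[of 1] assms(1), of "b - a" a y0] assms(2) by auto
  have x: "x t = a + t" if t: "t \<in> {0..b - a}" for t
  proof -
    have x': "(x has_real_derivative 1) (at u within {0..t})" if "u \<in> {0..t}" for u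
      by (rule has_field_derivative_subset[OF xy(3)]) (use t that in auto)
    have "x t - t \<le> x 0 - 0"
    proof (rule barrier_antimono[where H = "\<lambda>t. x t - t" and s = 0 and t = t and D = "\<lambda>_. 1 - 1"])
      show "((\<lambda>t. x t - t) has_real_derivative 1 - 1) (at u within {0..t})" if "u \<in> {0..t}" for u
        by (rule DERIV_diff[OF x'[OF that] DERIV_ident])
    qed (use t in auto)
    moreover have "t - x t \<le> 0 - x 0"
    proof (rule barrier_antimono[where H = "\<lambda>t. t - x t" and s = 0 and t = t and D = "\<lambda>_. 1 - 1"])
      show "((\<lambda>t. t - x t) has_real_derivative 1 - 1) (at u within {0..t})" if "u \<in> {0..t}" for u
        by (rule DERIV_diff[OF DERIV_ident x'[OF that]])
    qed (use t in auto)
    ultimately show ?thesis using xy by simp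
  qed
  have "((\<lambda>x. y (x - a)) has_real_derivative h (z, y (z - a))) (at z within {a..b})" if z: "z \<in> {a..b}" for z
  proof -
    have "(y has_real_derivative h (x (z - a), y (z - a))) (at (z - a) within (\<lambda>x. x - a) ` {a..b})"
      by (rule has_field_derivative_subset[OF xy(4)]) (use z in auto)
    moreover have "((\<lambda>x. x - a) has_real_derivative 1) (at z within {a..b})"
      by (auto intro!: derivative_eq_intros)
    ultimately show ?thesis using DERIV_image_chain x[of "z - a"] z by (fastforce simp: o_def)
  qed
  then show ?thesis using xy by (intro exI[of _ "\<lambda>x. y (x - a)"]) auto
qed

section \<open>Powers and exponentials as \<epsilon> tends to 0\<close>

lemma eventually_powr_less:
  fixes e K :: real
  assumes "0 < e" "0 < K"
  shows "\<forall>\<^sub>F \<epsilon> in at_right 0. \<epsilon> powr e < K"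
proof -
  have "\<forall>\<^sub>F \<epsilon> in at_right 0. \<epsilon> \<in> {0<..<K powr (1 / e)}"
    using assms by (intro eventually_at_right_real) auto
  then show ?thesis
  proof eventually_elim
    case (elim \<epsilon>)
    then have "\<epsilon> powr e < (K powr (1 / e)) powr e" using assms by (intro powr_less_mono2) auto
    then show ?case using assms by (simp add: powr_powr)
  qed
qed

text \<open>One term of the exponential series, with exponent \<open>p\<close> such that
  \<open>q * p \<ge> 2\<close>, bounds the left side by a multiple of
  \<open>\<epsilon> * \<epsilon>\<close>; one factor \<open>\<epsilon>\<close> then absorbs the
  constant.\<close>

lemma eventually_exp_powr_le:
  fixes c q r :: real
  assumes "0 < c" "0 < q" "0 < r"
  shows "\<forall>\<^sub>F \<epsilon> in at_right 0. r * exp (- c / \<epsilon> powr q) \<le> \<epsilon>"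
proof -
  obtain p :: nat where p: "2 / q \<le> real p" using real_arch_simple by blast
  then have pq: "2 \<le> q * p" using assms by (simp add: field_simps)
  define C where "C = r * (fact p / c ^ p)"
  have C: "0 < C" using assms by (simp add: C_def)
  have "\<forall>\<^sub>F \<epsilon> in at_right 0. \<epsilon> \<in> {0<..<min 1 (1 / C)}" using C by (intro eventually_at_right_real) auto
  then show ?thesis
  proof eventually_elim
    case (elim \<epsilon>)
    define z where "z = 1 / \<epsilon> powr q"
    have z: "0 < z" using elim by (simp add: z_def)
    have "z ^ p \<le> fact p / c ^ p * exp (c * z)" using power_le_exp[of c z p] assms z by auto
    then have "r * exp (- c * z) \<le> C / z ^ p"
      using z assms by (simp add: C_def exp_minus field_simps)
    also have "z ^ p = 1 / \<epsilon> powr (q * p)"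
      using elim by (simp add: z_def power_divide powr_powr flip: powr_realpow)
    also have "C / (1 / \<epsilon> powr (q * p)) = C * \<epsilon> powr (q * p)" by simp
    also have "\<epsilon> powr (q * p) \<le> \<epsilon> powr 2" using elim pq by (intro powr_mono') auto
    also have "\<epsilon> powr 2 = \<epsilon> * \<epsilon>" using elim by (simp add: power2_eq_square powr_numeral)
    finally have "r * exp (- c * z) \<le> C * \<epsilon> * \<epsilon>" using C by simp
    also have "\<dots> \<le> 1 * \<epsilon>" using elim C by (intro mult_right_mono) (auto simp: field_simps)
    finally show ?case by (simp add: z_def)
  qed
qed

section \<open>Existence of the upper curve and of the trajectories below it\<close>

locale sliding_lipschitz = sliding +
  assumes X1_bl: "bounded_lipschitz (\<lambda>p. X1 (fst p) (snd p))"
    and f_bl: "bounded_lipschitz (\<lambda>p. f (fst p) (snd p))"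
    and P_lip: "\<exists>K. \<forall>v v'. \<bar>P v - P v'\<bar> \<le> K * \<bar>v - v'\<bar>"
    and R: "0 < R" and jn: "j \<le> n"
begin

lemma bounded_lipschitz_P: "bounded_lipschitz (\<lambda>p. P (snd p / \<epsilon>))"
proof -
  obtain K where K: "\<And>v v'. \<bar>P v - P v'\<bar> \<le> K * \<bar>v - v'\<bar>" using P_lip by blast
  have K0: "0 \<le> K" using K[of 0 1] by auto
  have "\<bar>P (snd p / \<epsilon>) - P (snd q / \<epsilon>)\<bar> \<le> K / \<bar>\<epsilon>\<bar> * dist p q \<and> \<bar>P (snd p / \<epsilon>)\<bar> \<le> 1" for p q :: "real \<times> real"
  proof
    have "\<bar>P (snd p / \<epsilon>) - P (snd q / \<epsilon>)\<bar> \<le> K * \<bar>snd p / \<epsilon> - snd q / \<epsilon>\<bar>" by (rule K)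
    also have "\<dots> = K / \<bar>\<epsilon>\<bar> * dist (snd p) (snd q)" by (simp add: dist_real_def flip: diff_divide_distrib)
    also have "\<dots> \<le> K / \<bar>\<epsilon>\<bar> * dist p q" using K0 by (intro mult_left_mono dist_snd_le) auto
    finally show "\<bar>P (snd p / \<epsilon>) - P (snd q / \<epsilon>)\<bar> \<le> K / \<bar>\<epsilon>\<bar> * dist p q" .
    show "\<bar>P (snd p / \<epsilon>)\<bar> \<le> 1" using P01 by auto
  qed
  then show ?thesis unfolding bounded_lipschitz_def by blast
qed

lemma bounded_lipschitz_slow: "bounded_lipschitz (\<lambda>p. slow \<epsilon> (fst p) (snd p))"
proof -
  have "bounded_lipschitz (\<lambda>p. max (P (snd p / \<epsilon>)) p0)"
  proof -
    obtain K B where "0 \<le> K" "0 \<le> B" and KB: "\<And>p q :: real \<times> real. \<bar>P (snd p / \<epsilon>) - P (snd q / \<epsilon>)\<bar> \<le> K * dist p q"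
      and "\<And>p :: real \<times> real. \<bar>P (snd p / \<epsilon>)\<bar> \<le> B"
      using bounded_lipschitzD[OF bounded_lipschitz_P[of \<epsilon>]] by metis
    have "\<bar>max (P (snd p / \<epsilon>)) p0 - max (P (snd q / \<epsilon>)) p0\<bar> \<le> K * dist p q \<and> \<bar>max (P (snd p / \<epsilon>)) p0\<bar> \<le> 1" for p q :: "real \<times> real"
      using KB[of p q] P01[of "snd p / \<epsilon>"] P01[of "snd q / \<epsilon>"] P01[of v1] by (auto simp: max_def)
    then show ?thesis unfolding bounded_lipschitz_def by blast
  qed
  then show ?thesis
    unfolding slow_def g_def
    by (intro bounded_lipschitz_add f_bl bounded_lipschitz_divide[OF _ X1_bl m X1(1)]
        bounded_lipschitz_divide[OF _ _ p0] bounded_lipschitz_diff bounded_lipschitz_const bounded_lipschitz_P) auto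
qed

lemma top_exists:
  assumes "0 < \<epsilon>" "0 < \<rho>" "\<rho> \<le> R"
  shows "\<exists>Y. sliding_top j n X1 f P m M L a A R c0 C0 c1 v1 \<epsilon> \<rho> \<rho> Y"
proof -
  obtain Y where "Y (-\<rho>) = \<epsilon> * v1"
    "\<And>x. x \<in> {-\<rho>..\<rho>} \<Longrightarrow> (Y has_real_derivative slow \<epsilon> x (Y x)) (at x within {-\<rho>..\<rho>})"
    using scalar_ode_exists[OF bounded_lipschitz_slow[of \<epsilon>], of "-\<rho>" \<rho> "\<epsilon> * v1"] assms by auto
  then show ?thesis using assms by (intro exI[of _ Y], unfold_locales) auto
qed

definition Zx where "Zx \<epsilon> p = P (snd p / \<epsilon>) * X1 (fst p) (snd p)"

definition Zy where "Zy \<epsilon> p = P (snd p / \<epsilon>) * X1 (fst p) (snd p) * f (fst p) (snd p) + (1 - P (snd p / \<epsilon>))"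

lemma Z_bl: "bounded_lipschitz (Zx \<epsilon>)" "bounded_lipschitz (Zy \<epsilon>)"
  unfolding Zx_def Zy_def
  by (intro bounded_lipschitz_add bounded_lipschitz_mult bounded_lipschitz_diff bounded_lipschitz_const
      bounded_lipschitz_P X1_bl f_bl)+

text \<open>The planar solution is run up to a time \<open>T\<close> by which \<open>x + y\<close>
  would, by \<open>speed\<close>, exceed what \<open>Y_upper\<close> allows for abscissas up to
  \<open>x1\<close>. Hence \<open>\<theta>\<close> has been reached, and the intermediate value
  theorem gives the hitting time.\<close>

lemma flow_exists:
  assumes "sliding_top j n X1 f P m M L a A R c0 C0 c1 v1 \<epsilon> \<rho> x1 Y"
    and r': "0 \<le> r'" "r' \<le> \<rho>" and \<theta>: "- r' < \<theta>" "\<theta> \<le> x1"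
  shows "\<exists>x y T. 0 < T \<and> x T = \<theta> \<and> sliding_flow j n X1 f P m M L a A R c0 C0 c1 v1 \<epsilon> \<rho> x1 Y x y T r'"
proof -
  interpret sliding_top j n X1 f P m M L a A R c0 C0 c1 v1 \<epsilon> \<rho> x1 Y by fact
  define \<sigma> where "\<sigma> = min (m / 2) 1"
  have \<sigma>: "0 < \<sigma>" using m by (simp add: \<sigma>_def)
  define T where "T = (r' + \<epsilon> + x1 + (\<epsilon> + (x1 + \<rho>) / 2) + 1) / \<sigma>"
  have T: "0 < T" using \<sigma> r' \<epsilon> x1 \<rho> by (simp add: T_def add_nonneg_pos)
  obtain x y where xy: "x 0 = - r'" "y 0 = - \<epsilon>"
    "\<And>t. t \<in> {0..T} \<Longrightarrow> (x has_real_derivative Zx \<epsilon> (x t, y t)) (at t within {0..T})"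
    "\<And>t. t \<in> {0..T} \<Longrightarrow> (y has_real_derivative Zy \<epsilon> (x t, y t)) (at t within {0..T})"
    using planar_ode_exists[OF Z_bl(1)[of \<epsilon>] Z_bl(2)[of \<epsilon>], of T "- r'" "- \<epsilon>"] T by auto
  have mono: "x s \<le> x t" if "0 \<le> s" "s \<le> t" "t \<le> T" for s t
  proof -
    have "- x t \<le> - x s"
    proof (rule barrier_antimono[OF that(2)])
      fix u assume u: "u \<in> {s..t}"
      have "(x has_real_derivative Zx \<epsilon> (x u, y u)) (at u within {s..t})"
        by (rule has_field_derivative_subset[OF xy(3)]) (use u that in auto)
      then show "((\<lambda>u. - x u) has_real_derivative - Zx \<epsilon> (x u, y u)) (at u within {s..t})"
        by (rule DERIV_minus)
      show "- Zx \<epsilon> (x u, y u) \<le> 0" using P01 less_imp_le[OF X1_pos] by (auto simp: Zx_def)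
    qed
    then show ?thesis by simp
  qed
  have flow: "sliding_flow j n X1 f P m M L a A R c0 C0 c1 v1 \<epsilon> \<rho> x1 Y x y T' r'"
    if T': "0 \<le> T'" "T' \<le> T" "x T' \<le> x1" for T'
  proof unfold_locales
    fix t assume t: "t \<in> {0..T'}"
    show "(x has_real_derivative P (y t / \<epsilon>) * X1 (x t) (y t)) (at t within {0..T'})"
      using has_field_derivative_subset[OF xy(3), of t "{0..T'}"] t T' by (auto simp: Zx_def)
    show "(y has_real_derivative P (y t / \<epsilon>) * X1 (x t) (y t) * f (x t) (y t) + (1 - P (y t / \<epsilon>))) (at t within {0..T'})"
      using has_field_derivative_subset[OF xy(4), of t "{0..T'}"] t T' by (auto simp: Zy_def)
    show "x t \<le> x1" using mono[of t T'] t T' by auto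
  qed (use T' xy r' in auto)
  have "\<theta> \<le> x T"
  proof (rule ccontr)
    assume less: "\<not> \<theta> \<le> x T"
    then interpret F: sliding_flow j n X1 f P m M L a A R c0 C0 c1 v1 \<epsilon> \<rho> x1 Y x y T r'
      using T \<theta> by (intro flow) auto
    have "\<sigma> * T - r' - \<epsilon> \<le> x T + y T" unfolding \<sigma>_def by (rule F.speed) (use T in auto)
    moreover have "\<sigma> * T = r' + \<epsilon> + x1 + (\<epsilon> + (x1 + \<rho>) / 2) + 1" using \<sigma> by (simp add: T_def)
    moreover have "y T \<le> Y (x T)" using F.\<Delta>_nonneg[of T] T by (simp add: F.\<Delta>_def)
    moreover have "Y (x T) \<le> \<epsilon> + (x T + \<rho>) / 2" using F.x_range[of T] T by (intro Y_upper) auto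
    moreover have "x T \<le> x1" using less \<theta> by auto
    ultimately show False by (simp add: field_simps)
  qed
  moreover have "continuous_on {0..T} x" using xy(3) by (meson DERIV_continuous continuous_on_eq_continuous_within)
  ultimately obtain T' where T': "0 \<le> T'" "T' \<le> T" "x T' = \<theta>"
    using IVT'[of x 0 \<theta> T] xy \<theta> T by auto
  then have "T' \<noteq> 0" using xy \<theta> by auto
  then show ?thesis using flow[of T'] T' \<theta> by (intro exI[of _ x] exI[of _ y] exI[of _ T']) auto
qed

end

section \<open>Asymptotics as \<open>\<epsilon> \<rightarrow> 0\<close>\<close>

context sliding_lipschitz
begin

text \<open>The denominator of \<open>\<lambda>*\<close>: with \<open>\<delta> = \<epsilon> powr (1 / scale_order)\<close> all scales near the fold are
  natural powers of \<open>\<delta>\<close>.\<close>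

definition scale_order :: nat where "scale_order = Suc j * (n - 1) + 1"

lemma scale_order: "scale_order = j * (n - 1) + n" "0 < scale_order" "n * j \<le> scale_order"
proof -
  obtain n' where n': "n = Suc n'" using n by (cases n) auto
  show "scale_order = j * (n - 1) + n" "0 < scale_order" unfolding scale_order_def by (simp_all add: n')
  show "n * j \<le> scale_order" unfolding scale_order_def using jn by (simp add: n')
qed

text \<open>\<open>\<delta> ^ n\<close> is the length scale \<open>N\<close> and
  \<open>\<delta> ^ j\<close> the thickness scale \<open>s\<close> of \<open>Y_entry\<close>. The
  last inequality rests on \<open>j \<le> n\<close>.\<close>

lemma scales:
  assumes "0 < \<epsilon>" "\<epsilon> \<le> 1"
  defines "\<delta> \<equiv> \<epsilon> powr (1 / scale_order)"
  shows "0 < \<delta>" "\<delta> \<le> 1" "\<delta> ^ scale_order = \<epsilon>" "\<epsilon> powr (n / scale_order) = \<delta> ^ n"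
    "(\<delta> ^ j) ^ (n - 1) * \<delta> ^ n = \<epsilon>" "\<epsilon> * \<delta> ^ j = (\<delta> ^ n) ^ Suc j" "(\<delta> ^ j) ^ n = (\<delta> ^ n) ^ j"
    "\<epsilon> \<le> (\<delta> ^ n) ^ j"
proof -
  have pw: "\<delta> ^ i = \<epsilon> powr (i / scale_order)" for i
    using assms(1) by (simp add: \<delta>_def powr_powr flip: powr_realpow)
  show \<delta>: "0 < \<delta>" "\<delta> \<le> 1" using assms by (auto simp: \<delta>_def powr_le1)
  show \<epsilon>: "\<delta> ^ scale_order = \<epsilon>" using pw[of scale_order] scale_order(2) assms(1) by simp
  show "\<epsilon> powr (n / scale_order) = \<delta> ^ n" using pw by simp
  show "(\<delta> ^ j) ^ (n - 1) * \<delta> ^ n = \<epsilon>"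
    unfolding \<epsilon>[symmetric] scale_order(1) by (simp add: power_add power_mult)
  have "scale_order + j = n * Suc j" unfolding scale_order_def using n by (cases n) simp_all
  then show "\<epsilon> * \<delta> ^ j = (\<delta> ^ n) ^ Suc j"
    unfolding \<epsilon>[symmetric] power_add[symmetric] power_mult[symmetric] by simp
  show "(\<delta> ^ j) ^ n = (\<delta> ^ n) ^ j" by (simp add: mult.commute flip: power_mult)
  show "\<epsilon> \<le> (\<delta> ^ n) ^ j"
    unfolding \<epsilon>[symmetric] power_mult[symmetric] using scale_order(3) \<delta> by (intro power_decreasing) auto
qed

text \<open>The arbitrary lower bound \<open>\<eta>0\<close> leaves room for the condition on
  \<open>\<eta>\<close> in \<open>abscissa_form\<close>; \<open>\<eta>\<close> and \<open>K\<close>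
  are fixed before \<open>\<epsilon>\<close>. Positivity of \<open>f x \<epsilon>\<close> is
  recorded for the transversality of the exit section.\<close>

lemma eventually_exit:
  assumes \<rho>: "0 < \<rho>" "\<rho> \<le> R"
  shows "\<exists>\<eta>>\<eta>0. 0 < \<eta> \<and> (\<exists>K\<ge>0. \<forall>\<^sub>F \<epsilon> in at_right 0. \<forall>Y.
    sliding_top j n X1 f P m M L a A R c0 C0 c1 v1 \<epsilon> \<rho> \<rho> Y \<longrightarrow>
      \<eta> * \<epsilon> powr (n / scale_order) \<le> \<rho> \<and>
      (\<forall>x\<in>{\<eta> * \<epsilon> powr (n / scale_order)..\<rho>}. \<epsilon> \<le> Y x \<and> 0 < f x \<epsilon>) \<and>
      Y (\<eta> * \<epsilon> powr (n / scale_order)) \<le> \<epsilon> + K * (\<eta> * \<epsilon> powr (n / scale_order)) ^ Suc j)"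
proof -
  define c where "c = c0 / M"
  have c: "0 < c" using c0 mM by (simp add: c_def)
  define K1 where "K1 = A * (fact j / (c / 2) ^ j) + L + c"
  have K1: "A * z ^ j + L + c \<le> K1 * exp (c / 2 * z)" if "0 \<le> z" for z
  proof -
    have "A * z ^ j \<le> A * (fact j / (c / 2) ^ j * exp (c / 2 * z))"
      using A c that by (intro mult_left_mono power_le_exp) auto
    moreover have "(L + c) * 1 \<le> (L + c) * exp (c / 2 * z)"
      using L c that by (intro mult_left_mono) auto
    ultimately show ?thesis by (simp add: K1_def algebra_simps)
  qed
  have K1_pos: "0 \<le> K1" using A L c by (simp add: K1_def)
  define K0 where "K0 = 1 + 2 * K1 / c"
  have K0: "1 \<le> K0" using K1_pos c by (simp add: K0_def)
  \<comment> \<open>The last bound, together with \<open>\<eta> \<le> \<eta> ^ j\<close>, gives the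
    requirement on \<open>\<eta>\<close> in \<open>Y_exit\<close>.\<close>
  define \<eta> where "\<eta> = max (max 1 (\<eta>0 + 1)) ((K0 + L) * Suc j / a)"
  have \<eta>: "1 \<le> \<eta>" "\<eta>0 < \<eta>" unfolding \<eta>_def by (auto simp: max_def)
  have "(K0 + L) * Suc j / a \<le> \<eta>" by (simp add: \<eta>_def)
  also have "\<eta> \<le> \<eta> ^ j" using \<eta> j self_le_power[of \<eta> j] by auto
  finally have \<eta>j: "(K0 + L) * Suc j \<le> a * \<eta> ^ j" using a by (simp add: field_simps)
  have \<eta>2: "K0 + L \<le> a * \<eta> ^ j / Suc j" using \<eta>j by (simp add: pos_le_divide_eq del: of_nat_Suc)
  have "(K0 + L) * 2 \<le> (K0 + L) * Suc j" using K0 L j by (intro mult_left_mono) auto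
  with \<eta>j have \<eta>3: "2 * L \<le> a * \<eta> ^ j" "L < a * \<eta> ^ j" using K0 L by auto
  define C where "C = 2 * (A * \<eta> ^ j + 2 * L) * \<eta>"
  have C: "0 \<le> C" using A L \<eta> by (simp add: C_def)
  define E where "E = fact (Suc j) / (c * \<rho>) ^ Suc j"
  have E: "0 < E" using c \<rho> by (simp add: E_def)
  \<comment> \<open>In this order: the start of \<open>Y\<close> is forgotten, the exit lies left of
    \<open>\<rho>\<close>, and the overshoot is at most \<open>\<epsilon> / 2\<close>.\<close>
  define D where "D = min (1 / ((1 - v1) * E)) (min (\<rho> / \<eta>) (1 / (2 * C + 1)))"
  have v1': "0 < 1 - v1" using v1 by simp
  then have D: "0 < D" using E \<rho> \<eta> C by (simp add: D_def)
  have "\<forall>\<^sub>F \<epsilon> in at_right 0. \<forall>Y. sliding_top j n X1 f P m M L a A R c0 C0 c1 v1 \<epsilon> \<rho> \<rho> Y \<longrightarrow>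
      \<eta> * \<epsilon> powr (n / scale_order) \<le> \<rho> \<and>
      (\<forall>x\<in>{\<eta> * \<epsilon> powr (n / scale_order)..\<rho>}. \<epsilon> \<le> Y x \<and> 0 < f x \<epsilon>) \<and>
      Y (\<eta> * \<epsilon> powr (n / scale_order)) \<le> \<epsilon> + C * (\<eta> * \<epsilon> powr (n / scale_order)) ^ Suc j"
    using eventually_powr_less[OF _ D, of "1 / scale_order", simplified, OF scale_order(2)]
      eventually_at_right_real[of 0 1, simplified]
  proof eventually_elim
    case (elim \<epsilon>)
    define \<delta> where "\<delta> = \<epsilon> powr (1 / scale_order)"
    have \<epsilon>: "0 < \<epsilon>" "\<epsilon> \<le> 1" using elim by auto
    note sc = scales[OF \<epsilon>, folded \<delta>_def]
    have \<delta>D: "\<delta> < D" using elim by (simp add: \<delta>_def)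
    have \<delta>n: "\<delta> ^ n \<le> \<delta>" "\<delta> ^ j \<le> \<delta>"
      using sc(1,2) n j power_decreasing[of 1 n \<delta>] power_decreasing[of 1 j \<delta>] by auto
    define N where "N = \<delta> ^ n"
    define s where "s = \<delta> ^ j"
    have Ns: "0 < N" "0 < s" using sc by (auto simp: N_def s_def)
    have N: "\<eta> * N \<le> \<rho>"
    proof -
      have "N \<le> \<rho> / \<eta>" using \<delta>n \<delta>D by (simp add: N_def D_def)
      then show ?thesis using \<eta> by (simp add: field_simps)
    qed
    have small: "2 * C * N ^ Suc j \<le> \<epsilon>"
    proof -
      have "\<delta> < 1 / (2 * C + 1)" using \<delta>D by (simp add: D_def)
      then have "s < 1 / (2 * C + 1)" using \<delta>n by (simp add: s_def)
      then have "2 * C * s \<le> 1" using C Ns by (simp add: field_simps)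
      then have "\<epsilon> * (2 * C * s) \<le> \<epsilon> * 1" using \<epsilon> by (intro mult_left_mono) auto
      moreover have "\<epsilon> * (2 * C * s) = 2 * C * N ^ Suc j" unfolding N_def sc(6)[symmetric] s_def by simp
      ultimately show ?thesis by simp
    qed
    \<comment> \<open>The exponential beats \<open>Suc j\<close> powers of \<open>\<delta>\<close>;
      \<open>j\<close> of them cancel \<open>s\<close>, and the remaining one makes the quotient
      small.\<close>
    have start: "exp (- (c * \<rho> / N)) * (1 - v1) / s \<le> 1"
    proof -
      define z where "z = 1 / \<delta>"
      have z: "0 < z" using sc by (simp add: z_def)
      have "z \<le> 1 / N" using \<delta>n Ns unfolding z_def N_def by (intro frac_le) auto
      then have "c * \<rho> * z \<le> c * \<rho> * (1 / N)" using c \<rho> by (intro mult_left_mono) auto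
      then have "exp (- (c * \<rho> / N)) \<le> exp (- (c * \<rho> * z))" by simp
      also have "z ^ Suc j \<le> E * exp (c * \<rho> * z)"
        unfolding E_def using c \<rho> z by (intro power_le_exp) auto
      then have "exp (- (c * \<rho> * z)) \<le> E / z ^ Suc j"
        using z by (simp add: exp_minus field_simps)
      also have "E / z ^ Suc j = E * \<delta> * s" by (simp add: z_def s_def power_divide)
      finally have "exp (- (c * \<rho> / N)) * (1 - v1) / s \<le> E * \<delta> * s * (1 - v1) / s"
        using Ns v1' by (intro divide_right_mono mult_right_mono) auto
      also have "\<dots> = \<delta> * ((1 - v1) * E)" using Ns by simp
      also have "\<dots> \<le> 1"
      proof -
        have "\<delta> \<le> 1 / ((1 - v1) * E)" using \<delta>D by (simp add: D_def)
        then show ?thesis using v1' E by (simp add: pos_le_divide_eq)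
      qed
      finally show ?thesis .
    qed
    show ?case
    proof (intro allI impI)
      fix Y assume "sliding_top j n X1 f P m M L a A R c0 C0 c1 v1 \<epsilon> \<rho> \<rho> Y"
      then interpret T: sliding_top j n X1 f P m M L a A R c0 C0 c1 v1 \<epsilon> \<rho> \<rho> Y .
      have "(\<epsilon> - Y 0) / (\<epsilon> * s) \<le> K0"
        unfolding K0_def using Ns sc start K1 by (intro T.Y_entry[of N]) (auto simp: N_def s_def c_def)
      then have exit: "\<epsilon> \<le> Y x" if "x \<in> {\<eta> * N..\<rho>}" for x
        using Ns sc K0 \<eta> \<eta>2 that by (intro T.Y_exit[of N s K0 \<eta>]) (auto simp: N_def s_def)
      have fx: "0 < f x \<epsilon>" if x: "x \<in> {\<eta> * N..\<rho>}" for x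
      proof -
        have x0: "0 \<le> \<eta> * N" using Ns \<eta> by auto
        have "L * \<epsilon> \<le> L * N ^ j" using sc(8) L by (intro mult_left_mono) (auto simp: N_def)
        also have "\<dots> < a * \<eta> ^ j * N ^ j" using \<eta>3 Ns by (intro mult_strict_right_mono) auto
        also have "\<dots> = a * (\<eta> * N) ^ j" by (simp add: power_mult_distrib)
        also have "\<dots> \<le> a * x ^ j" using x x0 a by (intro mult_left_mono power_mono) auto
        also have "\<dots> \<le> f x 0" using x x0 \<rho> by (intro f_pos) auto
        finally show ?thesis using f_ge[of x \<epsilon>] \<epsilon> by auto
      qed
      have "Y (\<eta> * N) \<le> \<epsilon> + C * N ^ Suc j"
        unfolding C_def using Ns sc \<eta> \<eta>3 N small
        by (intro T.Y_at_exit) (auto simp: N_def C_def mult_ac)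
      also have "\<dots> \<le> \<epsilon> + C * (\<eta> * N) ^ Suc j"
        using C \<eta> Ns mult_right_mono[of 1 \<eta> N] by (intro add_left_mono mult_left_mono power_mono) auto
      finally show "\<eta> * \<epsilon> powr (n / scale_order) \<le> \<rho> \<and>
        (\<forall>x\<in>{\<eta> * \<epsilon> powr (n / scale_order)..\<rho>}. \<epsilon> \<le> Y x \<and> 0 < f x \<epsilon>) \<and>
        Y (\<eta> * \<epsilon> powr (n / scale_order)) \<le> \<epsilon> + C * (\<eta> * \<epsilon> powr (n / scale_order)) ^ Suc j"
        unfolding sc(4) N_def[symmetric] using N exit fx by blast
    qed
  qed
  then show ?thesis using \<eta> C by (intro exI[of _ \<eta>] conjI exI[of _ C]) auto
qed

text \<open>Up to distance \<open>\<xi> / 2\<close> from the fold the curve stays a relative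
  distance \<open>w\<close> of order \<open>\<xi> powr (j / n)\<close> below the edge, so the
  damping over the length \<open>\<xi> / 2\<close> is of order
  \<open>\<xi> powr e / \<epsilon>\<close>. With \<open>e = scale_order / n\<close> and
  \<open>\<xi> = \<epsilon> powr l\<close> this is the required power of
  \<open>1 / \<epsilon>\<close>. The constants \<open>c\<close> and \<open>r\<close> are fixed
  before \<open>l\<close>.\<close>

lemma eventually_contraction:
  assumes \<rho>: "0 < \<rho>" "\<rho> \<le> R"
  shows "\<exists>c>0. \<exists>r>0. \<forall>l. 0 < l \<and> l < n / scale_order \<longrightarrow> (\<forall>\<^sub>F \<epsilon> in at_right 0. \<forall>Y x y T r'.
    sliding_flow j n X1 f P m M L a A R c0 C0 c1 v1 \<epsilon> \<rho> \<rho> Y x y T r' \<and> \<epsilon> powr l \<le> r' \<and> 0 \<le> x T \<longrightarrow>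
      Y (x T) - y T \<le> r * exp (- c / \<epsilon> powr (1 - l / (n / scale_order))))"
proof -
  define e where "e = real scale_order / n"
  have e: "0 < e" using n scale_order(2) by (simp add: e_def)
  have e_eq: "real j / n * real (n - 1) + 1 = e"
    using n by (simp_all add: e_def scale_order(1) of_nat_diff field_simps)
  \<comment> \<open>Chosen so that the upward push uses up only half of the downward slope; the
    other half absorbs \<open>2 * L * \<epsilon>\<close>.\<close>
  define \<kappa> where "\<kappa> = min 1 (a * p0 * m / (2 * C0))"
  have \<kappa>: "0 < \<kappa>" "\<kappa> \<le> 1" "C0 * \<kappa> / (p0 * m) \<le> a / 2"
  proof -
    show "0 < \<kappa>" "\<kappa> \<le> 1" using a p0 m C0 by (auto simp: \<kappa>_def)
    have "\<kappa> \<le> a * p0 * m / (2 * C0)" by (simp add: \<kappa>_def)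
    then show "C0 * \<kappa> / (p0 * m) \<le> a / 2" using a p0 m C0 by (simp add: field_simps)
  qed
  define c where "c = c1 * \<kappa> ^ (n - 1) / M * (1 / 2) powr e"
  have c: "0 < c" using c1 \<kappa> mM by (simp add: c_def)
  define r where "r = 2 * exp (2 * (L + L / (p0 * m ^ 2)) * R)"
  have r: "0 < r" by (simp add: r_def)
  have "\<forall>\<^sub>F \<epsilon> in at_right 0. \<forall>Y x y T r'.
    sliding_flow j n X1 f P m M L a A R c0 C0 c1 v1 \<epsilon> \<rho> \<rho> Y x y T r' \<and> \<epsilon> powr l \<le> r' \<and> 0 \<le> x T \<longrightarrow>
      Y (x T) - y T \<le> r * exp (- c / \<epsilon> powr (1 - l / (n / scale_order)))"
    if l: "0 < l" "l < n / scale_order" for l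
  proof -
    \<comment> \<open>Since \<open>l * j < 1\<close>, \<open>\<epsilon>\<close> is small compared
      with \<open>\<xi> ^ j\<close>, whose exponent in \<open>\<epsilon>\<close> is
      \<open>l * j\<close>.\<close>
    have "l * j < n / scale_order * j" using l j by (intro mult_strict_right_mono) auto
    also have "\<dots> \<le> 1" using scale_order(2,3) by (simp add: field_simps flip: of_nat_mult)
    finally have lj: "0 < 1 - l * j" by simp
    define K where "K = a / (4 * (L + 1) * 2 ^ j)"
    have K: "0 < K" using a L by (simp add: K_def)
    have KL: "2 * (L + 1) * K = a / 2 / 2 ^ j"
    proof -
      have *: "2 * z * (a / (4 * z * 2 ^ j)) = a / 2 / 2 ^ j" if "z \<noteq> 0" for z using that by simp
      show ?thesis unfolding K_def by (rule *) (use L in simp)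
    qed
    show ?thesis
      using eventually_powr_less[OF lj K] eventually_at_right_real[of 0 1, simplified]
    proof eventually_elim
      case (elim \<epsilon>)
      have \<epsilon>: "0 < \<epsilon>" "\<epsilon> \<le> 1" using elim by auto
      define \<xi> where "\<xi> = \<epsilon> powr l"
      have \<xi>: "0 < \<xi>" "\<xi> \<le> 1" using \<epsilon> l by (auto simp: \<xi>_def powr_le1)
      define w where "w = \<kappa> * (\<xi> / 2) powr (j / n)"
      have w: "0 \<le> w" "w \<le> 1"
        using \<kappa> \<xi> by (auto simp: w_def intro!: mult_le_one powr_le1)
      have wn: "w ^ n = \<kappa> ^ n * (\<xi> / 2) ^ j"
        using \<xi> n by (simp add: w_def power_mult_distrib powr_powr flip: powr_realpow)
      have "C0 * w ^ n / (p0 * m) = C0 * \<kappa> ^ n / (p0 * m) * (\<xi> / 2) ^ j" by (simp add: wn)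
      also have "\<dots> \<le> C0 * \<kappa> / (p0 * m) * (\<xi> / 2) ^ j"
        using C0 p0 m \<xi> \<kappa> n power_decreasing[of 1 n \<kappa>]
        by (intro mult_right_mono divide_right_mono mult_left_mono) auto
      also have "\<dots> \<le> a / 2 * (\<xi> / 2) ^ j" using \<kappa> \<xi> by (intro mult_right_mono) auto
      finally have 1: "C0 * w ^ n / (p0 * m) \<le> a / 2 * (\<xi> / 2) ^ j" .
      have \<xi>j: "(\<xi> / 2) ^ j = \<epsilon> powr (l * j) / 2 ^ j"
        using \<epsilon> by (simp add: \<xi>_def power_divide powr_powr flip: powr_realpow)
      have "2 * L * \<epsilon> \<le> 2 * (L + 1) * \<epsilon>" using \<epsilon> by (simp add: algebra_simps)
      also have "\<dots> = 2 * (L + 1) * (\<epsilon> powr (l * j) * \<epsilon> powr (1 - l * j))"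
        using \<epsilon> by (simp flip: powr_add)
      also have "\<dots> \<le> 2 * (L + 1) * (\<epsilon> powr (l * j) * K)"
        using elim L by (intro mult_left_mono) auto
      also have "\<dots> = (2 * (L + 1) * K) * \<epsilon> powr (l * j)" by simp
      also have "\<dots> = a / 2 * (\<xi> / 2) ^ j" unfolding KL \<xi>j by simp
      finally have 2: "C0 * w ^ n / (p0 * m) + 2 * L * \<epsilon> \<le> a * (\<xi> / 2) ^ j" using 1 by linarith
      have "w ^ (n - 1) * (\<xi> / 2) = \<kappa> ^ (n - 1) * ((\<xi> / 2) powr (j / n * real (n - 1)) * (\<xi> / 2) powr 1)"
        using \<xi> by (simp add: w_def power_mult_distrib powr_powr flip: powr_realpow)
      also have "\<dots> = \<kappa> ^ (n - 1) * (\<xi> / 2) powr e" unfolding powr_add[symmetric] e_eq ..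
      also have "(\<xi> / 2) powr e = (1 / 2) powr e * \<epsilon> powr (l * e)"
        using \<xi> \<epsilon> powr_mult[of "1 / 2" \<xi> e] by (simp add: \<xi>_def powr_powr)
      finally have rate: "c1 * w ^ (n - 1) / (\<epsilon> * M) * (\<xi> / 2) = c * (\<epsilon> powr (l * e) / \<epsilon>)"
        by (simp add: c_def mult_ac)
      also have "\<epsilon> powr (l * e) / \<epsilon> = 1 / \<epsilon> powr (1 - l / (n / scale_order))"
        using \<epsilon> by (simp add: e_def powr_diff)
      finally have rate: "- (c1 * w ^ (n - 1) / (\<epsilon> * M)) * (\<xi> / 2) = - c / \<epsilon> powr (1 - l / (n / scale_order))"
        by simp
      show ?case
      proof (intro allI impI)
        fix Y x y T r'
        assume *: "sliding_flow j n X1 f P m M L a A R c0 C0 c1 v1 \<epsilon> \<rho> \<rho> Y x y T r' \<and> \<epsilon> powr l \<le> r' \<and> 0 \<le> x T"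
        then interpret F: sliding_flow j n X1 f P m M L a A R c0 C0 c1 v1 \<epsilon> \<rho> \<rho> Y x y T r' by simp
        have "F.\<Delta> T \<le> 2 * \<epsilon> * exp (2 * F.C' * R) * exp (- (c1 * w ^ (n - 1) / (\<epsilon> * M)) * (\<xi> / 2))"
        proof (rule F.\<Delta>_exponentially_small)
          show "\<xi> \<le> r'" using * by (simp add: \<xi>_def)
          have "0 \<le> x T" using * by simp
          then show "- (\<xi> / 2) \<le> x T" using \<xi>(1) by linarith
          show "Y z \<le> \<epsilon> * (1 - w)" if "z \<in> {-\<rho>..- (\<xi> / 2)}" for z
            using w \<xi> 2 that by (intro F.Y_below[where \<xi> = "\<xi> / 2"]) auto
        qed (use w \<xi> in auto)
        also have "\<dots> \<le> 2 * 1 * exp (2 * F.C' * R) * exp (- (c1 * w ^ (n - 1) / (\<epsilon> * M)) * (\<xi> / 2))"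
          using \<epsilon> by (intro mult_right_mono mult_left_mono) auto
        finally show "Y (x T) - y T \<le> r * exp (- c / \<epsilon> powr (1 - l / (n / scale_order)))"
          unfolding rate r_def F.C'_def F.\<Delta>_def by simp
      qed
    qed
  qed
  then show ?thesis using c r by blast
qed

end

section \<open>Sections, flow maps and the fold arc\<close>

lemma closed_segment_vertical:
  fixes y1 y2 :: real
  assumes "y1 \<le> y2"
  shows "closed_segment (\<theta>, y1) (\<theta>, y2) = {\<theta> :: real} \<times> {y1..y2}"
proof -
  have "(1 - u) *\<^sub>R (\<theta>, y1) + u *\<^sub>R (\<theta>, y2) = (\<theta>, (1 - u) * y1 + u * y2)" for u
    by (simp add: algebra_simps)
  then have "closed_segment (\<theta>, y1) (\<theta>, y2) = Pair \<theta> ` closed_segment y1 y2"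
    unfolding closed_segment_def by auto
  then show ?thesis using assms by (auto simp: closed_segment_eq_real_ivl)
qed

lemma closed_segment_horizontal:
  fixes x1 x2 :: real
  assumes "x1 \<le> x2"
  shows "closed_segment (x1, y) (x2, y) = {x1..x2} \<times> {y :: real}"
proof -
  have "(1 - u) *\<^sub>R (x1, y) + u *\<^sub>R (x2, y) = ((1 - u) * x1 + u * x2, y)" for u
    by (simp add: algebra_simps)
  then have "closed_segment (x1, y) (x2, y) = (\<lambda>x. (x, y)) ` closed_segment x1 x2"
    unfolding closed_segment_def by auto
  then show ?thesis using assms by (auto simp: closed_segment_eq_real_ivl)
qed

lemma transversal_section_vertical:
  fixes y1 y2 \<theta> :: real
  assumes "y1 < y2" "{\<theta>} \<times> {y1..y2} \<subseteq> D" "\<And>v. v \<in> {y1..y2} \<Longrightarrow> fst (Z (\<theta>, v)) \<noteq> 0"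
  shows "transversal_section D Z (\<theta>, y1) (\<theta>, y2)"
  using assms unfolding transversal_section_def closed_segment_vertical[OF less_imp_le[OF assms(1)]]
  by (force simp: span_singleton)

lemma transversal_section_horizontal:
  fixes x1 x2 y :: real
  assumes "x1 < x2" "{x1..x2} \<times> {y} \<subseteq> D" "\<And>u. u \<in> {x1..x2} \<Longrightarrow> snd (Z (u, y)) \<noteq> 0"
  shows "transversal_section D Z (x1, y) (x2, y)"
  using assms unfolding transversal_section_def closed_segment_horizontal[OF less_imp_le[OF assms(1)]]
  by (force simp: span_singleton)

lemma has_vector_derivative_Pair_real:
  fixes x y :: "real \<Rightarrow> real"
  assumes "(x has_real_derivative d) (at t within S)" "(y has_real_derivative e) (at t within S)"
  shows "((\<lambda>t. (x t, y t)) has_vector_derivative (d, e)) (at t within S)"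
  using assms unfolding has_real_derivative_iff_has_vector_derivative
  by (rule has_vector_derivative_Pair)

text \<open>The competing trajectory may leave \<open>Q\<close>, but up to the smaller of the two
  hitting times it coincides with \<open>\<gamma>\<close>. If the times differed, one curve would
  meet \<open>B\<close> before its own first hitting time.\<close>

lemma first_hit_unique:
  fixes G Z :: "'a::real_inner \<Rightarrow> 'a"
  assumes lip: "L-lipschitz_on UNIV G" and Q: "open Q" "\<And>p. p \<in> Q \<Longrightarrow> Z p = G p"
    and T: "0 < T" "\<And>t. t \<in> {0..T} \<Longrightarrow> (\<gamma> has_vector_derivative G (\<gamma> t)) (at t within {0..T})"
      "\<And>t. t \<in> {0..T} \<Longrightarrow> \<gamma> t \<in> Q" "\<gamma> T \<in> B" "\<And>t. t \<in> {0<..<T} \<Longrightarrow> \<gamma> t \<notin> B"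
    and hit: "first_hit D Z B (\<gamma> 0) q"
  shows "q = \<gamma> T"
proof -
  obtain T' \<gamma>' where T': "0 < T'" "\<gamma>' 0 = \<gamma> 0" "\<gamma>' T' = q" "q \<in> B" "\<And>t. t \<in> {0<..<T'} \<Longrightarrow> \<gamma>' t \<notin> B"
    and \<gamma>': "\<And>t. t \<in> {0..T'} \<Longrightarrow> (\<gamma>' has_vector_derivative Z (\<gamma>' t)) (at t within {0..T'})"
    using hit unfolding first_hit_def trajectory_on_def by blast
  define \<tau> where "\<tau> = min T T'"
  have sub: "{0..\<tau>} \<subseteq> {0..T}" "{0..\<tau>} \<subseteq> {0..T'}" by (auto simp: \<tau>_def)
  have "\<gamma>' \<tau> = \<gamma> \<tau>"
  proof (rule ode_unique_on_open[OF lip Q])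
    show "(\<gamma> has_vector_derivative G (\<gamma> t)) (at t within {0..\<tau>})" if "t \<in> {0..\<tau>}" for t
      using has_vector_derivative_within_subset[OF T(2) sub(1)] sub that by blast
    show "(\<gamma>' has_vector_derivative Z (\<gamma>' t)) (at t within {0..\<tau>})" if "t \<in> {0..\<tau>}" for t
      using has_vector_derivative_within_subset[OF \<gamma>' sub(2)] sub that by blast
  qed (use T(1,3) T'(1,2) sub in \<open>auto simp: \<tau>_def\<close>)
  moreover have "T = T'"
  proof (rule ccontr)
    assume "T \<noteq> T'"
    then consider "T < T'" | "T' < T" by linarith
    then show False
      using T(1,4) T'(1,3,4) T'(5)[of T] T(5)[of T'] \<open>\<gamma>' \<tau> = \<gamma> \<tau>\<close>
      by cases (auto simp: \<tau>_def min_def split: if_splits)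
  qed
  ultimately show ?thesis using T' by (simp add: \<tau>_def)
qed

lemma flow_defines_mapI:
  fixes G Z :: "'a::real_inner \<Rightarrow> 'a"
  assumes lip: "L-lipschitz_on UNIV G" and Q: "open Q" "Q \<subseteq> D" "\<And>p. p \<in> Q \<Longrightarrow> Z p = G p"
    and ex: "\<And>p. p \<in> A \<Longrightarrow> \<exists>T \<gamma>. 0 < T \<and> \<gamma> 0 = p \<and> \<gamma> T \<in> B \<and> (\<forall>t\<in>{0<..<T}. \<gamma> t \<notin> B) \<and>
      (\<forall>t\<in>{0..T}. \<gamma> t \<in> Q \<and> (\<gamma> has_vector_derivative G (\<gamma> t)) (at t within {0..T}))"
  shows "\<exists>g. flow_defines_map D Z A B g"
proof -
  have "\<exists>q. q \<in> B \<and> (\<forall>q'. first_hit D Z B p q' \<longleftrightarrow> q' = q)" if p: "p \<in> A" for p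
  proof -
    obtain T \<gamma> where T: "0 < T" "\<gamma> 0 = p" "\<gamma> T \<in> B" "\<And>t. t \<in> {0<..<T} \<Longrightarrow> \<gamma> t \<notin> B"
      "\<And>t. t \<in> {0..T} \<Longrightarrow> \<gamma> t \<in> Q"
      "\<And>t. t \<in> {0..T} \<Longrightarrow> (\<gamma> has_vector_derivative G (\<gamma> t)) (at t within {0..T})"
      using ex[OF p] by blast
    have "first_hit D Z B p (\<gamma> T)"
      unfolding first_hit_def trajectory_on_def
      using T Q by (intro exI[of _ T] conjI exI[of _ \<gamma>]) auto
    moreover have "q' = \<gamma> T" if "first_hit D Z B p q'" for q'
      by (rule first_hit_unique[OF lip Q(1,3) T(1,6,5,3,4)]) (use that T in auto)
    ultimately show ?thesis using T by blast
  qed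
  then obtain g where "\<And>p. p \<in> A \<Longrightarrow> g p \<in> B \<and> (\<forall>q'. first_hit D Z B p q' \<longleftrightarrow> q' = g p)" by metis
  then show ?thesis unfolding flow_defines_map_def by (intro exI[of _ g]) blast
qed

lemma increasing_if_pos_derivative:
  fixes x d :: "real \<Rightarrow> real"
  assumes "s < t" "\<And>u. u \<in> {s..t} \<Longrightarrow> (x has_real_derivative d u) (at u within {s..t})"
    and "\<And>u. u \<in> {s..t} \<Longrightarrow> 0 < d u"
  shows "x s < x t"
proof (rule DERIV_pos_imp_increasing_open[OF assms(1)])
  show "\<exists>y. (x has_real_derivative y) (at u) \<and> 0 < y" if "s < u" "u < t" for u
    using assms(2)[of u] assms(3)[of u] that by (auto simp: at_within_Icc_at)
  show "continuous_on {s..t} x"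
    using assms(2) by (meson DERIV_continuous continuous_on_eq_continuous_within)
qed

text \<open>Settles the definite description in \<open>ybar\<close>. A competitor, anywhere in
  \<open>V\<close> with positive abscissa speed, cannot use negative time, since its abscissa would
  be negative; at positive times it agrees with \<open>\<gamma>\<close> up to the smaller end time,
  and strictly increasing abscissas force the end times to agree.\<close>

lemma ybar_eqI:
  fixes F X :: "real \<times> real \<Rightarrow> real \<times> real"
  assumes lip: "L-lipschitz_on UNIV F" and Q: "open Q" "Q \<subseteq> V" "\<And>p. p \<in> Q \<Longrightarrow> X p = F p"
      "\<And>p. p \<in> Q \<Longrightarrow> 0 < fst (X p)"
    and T: "0 < T" "\<gamma> 0 = (0, 0)" "\<gamma> T = (\<theta>, y)"
      "\<And>t. t \<in> {0..T} \<Longrightarrow> (\<gamma> has_vector_derivative F (\<gamma> t)) (at t within {0..T})"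
      "\<And>t. t \<in> {0..T} \<Longrightarrow> \<gamma> t \<in> Q"
  shows "ybar V X \<theta> = y"
  unfolding ybar_def
proof (rule the_equality)
  have inc: "fst (\<delta> s) < fst (\<delta> t)" if "s < t"
    "\<And>u. u \<in> {s..t} \<Longrightarrow> (\<delta> has_vector_derivative X (\<delta> u)) (at u within {s..t})"
    "\<And>u. u \<in> {s..t} \<Longrightarrow> 0 < fst (X (\<delta> u))" for \<delta> s t
    by (rule increasing_if_pos_derivative[where x = "\<lambda>u. fst (\<delta> u)" and d = "\<lambda>u. fst (X (\<delta> u))",
          OF that(1) has_real_derivative_fst_snd(1)[OF that(2)] that(3)])
  have X\<gamma>: "(\<gamma> has_vector_derivative X (\<gamma> t)) (at t within {0..T})" if "t \<in> {0..T}" for t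
    using T(4,5)[OF that] Q(3) by simp
  show "\<exists>t \<gamma>. trajectory_on (closed_segment 0 t) {p \<in> V. 0 < fst (X p)} X \<gamma> \<and> \<gamma> 0 = (0, 0) \<and> \<gamma> t = (\<theta>, y)"
    using T X\<gamma> Q
    by (intro exI[of _ T] exI[of _ \<gamma>]) (auto simp: trajectory_on_def closed_segment_eq_real_ivl)
  have "fst (\<gamma> 0) < fst (\<gamma> T)" by (rule inc) (use T X\<gamma> Q in auto)
  then have \<theta>: "0 < \<theta>" using T by simp
  fix z assume "\<exists>t \<gamma>. trajectory_on (closed_segment 0 t) {p \<in> V. 0 < fst (X p)} X \<gamma> \<and> \<gamma> 0 = (0, 0) \<and> \<gamma> t = (\<theta>, z)"
  then obtain t \<delta> where \<delta>: "trajectory_on (closed_segment 0 t) {p \<in> V. 0 < fst (X p)} X \<delta>"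
    "\<delta> 0 = (0, 0)" "\<delta> t = (\<theta>, z)" by blast
  have t: "0 < t"
  proof (rule ccontr)
    assume "\<not> 0 < t"
    moreover have "t \<noteq> 0" using \<delta> \<theta> by auto
    ultimately have "t < 0" by simp
    then have "fst (\<delta> t) < fst (\<delta> 0)"
      using \<delta>(1) by (intro inc) (auto simp: trajectory_on_def closed_segment_eq_real_ivl)
    then show False using \<delta> \<theta> by simp
  qed
  have \<delta>': "(\<delta> has_vector_derivative X (\<delta> u)) (at u within {0..t})" "0 < fst (X (\<delta> u))" if "u \<in> {0..t}" for u
    using \<delta>(1) t that by (auto simp: trajectory_on_def closed_segment_eq_real_ivl)
  define \<tau> where "\<tau> = min T t"
  have sub: "{0..\<tau>} \<subseteq> {0..T}" "{0..\<tau>} \<subseteq> {0..t}" by (auto simp: \<tau>_def)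
  have eq: "\<delta> \<tau> = \<gamma> \<tau>"
  proof (rule ode_unique_on_open[OF lip Q(1,3)])
    show "(\<gamma> has_vector_derivative F (\<gamma> u)) (at u within {0..\<tau>})" if "u \<in> {0..\<tau>}" for u
      using has_vector_derivative_within_subset[OF T(4) sub(1)] sub that by blast
    show "(\<delta> has_vector_derivative X (\<delta> u)) (at u within {0..\<tau>})" if "u \<in> {0..\<tau>}" for u
      using has_vector_derivative_within_subset[OF \<delta>'(1) sub(2)] sub that by blast
  qed (use T(1,2,5) t \<delta>(2) sub in \<open>auto simp: \<tau>_def\<close>)
  consider "t < T" | "T < t" | "t = T" by linarith
  then show "z = y"
  proof cases
    case 1
    then have "fst (\<gamma> t) < fst (\<gamma> T)"
    proof (rule inc)
      show "(\<gamma> has_vector_derivative X (\<gamma> u)) (at u within {t..T})" if "u \<in> {t..T}" for u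
        by (rule has_vector_derivative_within_subset[OF X\<gamma>]) (use that t in auto)
      show "0 < fst (X (\<gamma> u))" if "u \<in> {t..T}" for u
        using T(5)[of u] Q(4) that t by auto
    qed
    moreover have "\<gamma> t = (\<theta>, z)" using eq 1 \<delta>(3) by (simp add: \<tau>_def)
    ultimately show ?thesis using T(3) by simp
  next
    case 2
    then have "fst (\<delta> T) < fst (\<delta> t)"
      using T(1) by (intro inc) (auto intro: has_vector_derivative_within_subset[OF \<delta>'(1)] \<delta>'(2))
    moreover have "\<delta> T = (\<theta>, y)" using eq 2 T(3) by (simp add: \<tau>_def)
    ultimately show ?thesis using \<delta>(3) by simp
  next
    case 3
    then show ?thesis using eq \<delta>(3) T(3) by (simp add: \<tau>_def)
  qed
qed

text \<open>\<open>Y\<close> is compared with a graph \<open>B\<close>, whereas \<open>ybar\<close>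
  is defined by planar trajectories. A Gronwall estimate for \<open>(y t - B (x t))\<^sup>2\<close>
  along the planar solution identifies the two; the bound on the ordinate keeps the arc in the
  box.\<close>

lemma (in sliding_lipschitz) fold_arc_planar:
  assumes B0: "B 0 = 0" and B: "\<And>x. x \<in> {0..x1} \<Longrightarrow> (B has_real_derivative f x (B x)) (at x within {0..x1})"
    and \<theta>: "0 < \<theta>" "\<theta> \<le> x1"
  shows "\<exists>\<gamma> T. 0 < T \<and> \<gamma> 0 = (0, 0) \<and> \<gamma> T = (\<theta>, B \<theta>) \<and> (\<forall>t\<in>{0..T}. fst (\<gamma> t) \<in> {0..\<theta>} \<and>
    \<bar>snd (\<gamma> t)\<bar> \<le> fst (\<gamma> t) / 2 \<and> (\<gamma> has_vector_derivative
      (X1 (fst (\<gamma> t)) (snd (\<gamma> t)), X1 (fst (\<gamma> t)) (snd (\<gamma> t)) * f (fst (\<gamma> t)) (snd (\<gamma> t)))) (at t within {0..T}))"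
proof -
  \<comment> \<open>The abscissa speed is at least \<open>m\<close>, so \<open>\<theta>\<close> is
    reached by this time.\<close>
  define T0 where "T0 = \<theta> / m"
  have T0: "0 < T0" using \<theta> m by (simp add: T0_def)
  obtain x y where xy: "x 0 = 0" "y 0 = 0"
    "\<And>t. t \<in> {0..T0} \<Longrightarrow> (x has_real_derivative X1 (x t) (y t)) (at t within {0..T0})"
    "\<And>t. t \<in> {0..T0} \<Longrightarrow> (y has_real_derivative X1 (x t) (y t) * f (x t) (y t)) (at t within {0..T0})"
    using planar_ode_exists[OF X1_bl bounded_lipschitz_mult[OF X1_bl f_bl], of T0 0 0] T0 by auto
  have x_sub: "(x has_real_derivative X1 (x u) (y u)) (at u within {s..t})"
    and y_sub: "(y has_real_derivative X1 (x u) (y u) * f (x u) (y u)) (at u within {s..t})"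
    if "0 \<le> s" "t \<le> T0" "u \<in> {s..t}" for s t u
    by (rule has_field_derivative_subset[OF xy(3)] has_field_derivative_subset[OF xy(4)]; use that in auto)+
  have inc: "x s < x t" if "0 \<le> s" "s < t" "t \<le> T0" for s t
    by (rule increasing_if_pos_derivative[OF that(2) x_sub[OF that(1,3)]]) (use X1_pos in auto)
  have "m * T0 - x T0 \<le> m * 0 - x 0"
  proof (rule barrier_antimono[where H = "\<lambda>t. m * t - x t" and s = 0 and t = T0
        and D = "\<lambda>t. m - X1 (x t) (y t)"])
    show "((\<lambda>t. m * t - x t) has_real_derivative m - X1 (x u) (y u)) (at u within {0..T0})" if "u \<in> {0..T0}" for u
      by (rule derivative_eq_intros xy(3)[OF that] refl)+ simp
  qed (use T0 X1 in auto)
  then have "\<theta> \<le> x T0" using xy m by (simp add: T0_def)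
  moreover have "continuous_on {0..T0} x" using xy(3) by (meson DERIV_continuous continuous_on_eq_continuous_within)
  ultimately obtain T where T: "0 \<le> T" "T \<le> T0" "x T = \<theta>"
    using IVT'[of x 0 \<theta> T0] xy(1) \<theta> T0 by auto
  have "T \<noteq> 0" using T xy \<theta> by auto
  then have T_pos: "0 < T" using T by simp
  have x_range: "x t \<in> {0..\<theta>}" if "t \<in> {0..T}" for t
    using inc[of 0 t] inc[of t T] that T xy by (cases "t = 0"; cases "t = T") auto
  note x_T = x_sub[OF order_refl T(2)] and y_T = y_sub[OF order_refl T(2)]
  have y_abs: "y t * \<sigma> \<le> x t / 2" if t: "t \<in> {0..T}" and \<sigma>: "\<sigma> = 1 \<or> \<sigma> = -1" for t \<sigma>
  proof -
    have tT: "t \<le> T0" using t T by auto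
    have "y t * \<sigma> - x t / 2 \<le> y 0 * \<sigma> - x 0 / 2"
    proof (rule barrier_antimono[where H = "\<lambda>t. y t * \<sigma> - x t / 2" and s = 0 and t = t
          and D = "\<lambda>t. X1 (x t) (y t) * (f (x t) (y t) * \<sigma> - 1 / 2)"])
      fix u assume u: "u \<in> {0..t}"
      show "((\<lambda>t. y t * \<sigma> - x t / 2) has_real_derivative X1 (x u) (y u) * (f (x u) (y u) * \<sigma> - 1 / 2)) (at u within {0..t})"
        using DERIV_diff[OF DERIV_cmult_right[OF y_sub[OF order_refl tT u]] DERIV_cdivide[OF x_sub[OF order_refl tT u], of 2], of \<sigma>]
        by (simp add: algebra_simps)
      have "f (x u) (y u) * \<sigma> - 1 / 2 \<le> 0" using f[of "x u" "y u"] \<sigma> by auto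
      then show "X1 (x u) (y u) * (f (x u) (y u) * \<sigma> - 1 / 2) \<le> 0"
        using X1_pos[of "x u" "y u"] by (simp add: mult_le_0_iff)
    qed (use t in auto)
    then show ?thesis using xy by simp
  qed
  have "(y t - B (x t))\<^sup>2 * exp (- (2 * M * L * t)) \<le> 0" if t: "t \<in> {0..T}" for t
  proof -
    have tT: "t \<le> T0" using t T by auto
    have "(y t - B (x t))\<^sup>2 * exp (- (2 * M * L * t)) \<le> (y 0 - B (x 0))\<^sup>2 * exp (- (2 * M * L * 0))"
    proof (rule barrier_antimono[where H = "\<lambda>t. (y t - B (x t))\<^sup>2 * exp (- (2 * M * L * t))" and s = 0 and t = t
          and D = "\<lambda>t. (2 * (y t - B (x t)) * (X1 (x t) (y t) * f (x t) (y t) - f (x t) (B (x t)) * X1 (x t) (y t))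
            - 2 * M * L * (y t - B (x t))\<^sup>2) * exp (- (2 * M * L * t))"])
      fix u assume u: "u \<in> {0..t}"
      have "(B has_real_derivative f (x u) (B (x u))) (at (x u) within x ` {0..t})"
        by (rule has_field_derivative_subset[OF B]) (use x_range u t \<theta> in force)+
      from DERIV_image_chain[OF this x_sub[OF order_refl tT u]]
      have B': "((\<lambda>t. B (x t)) has_real_derivative f (x u) (B (x u)) * X1 (x u) (y u)) (at u within {0..t})"
        by (simp add: o_def)
      show "((\<lambda>t. (y t - B (x t))\<^sup>2 * exp (- (2 * M * L * t))) has_real_derivative
          (2 * (y u - B (x u)) * (X1 (x u) (y u) * f (x u) (y u) - f (x u) (B (x u)) * X1 (x u) (y u))
            - 2 * M * L * (y u - B (x u))\<^sup>2) * exp (- (2 * M * L * u))) (at u within {0..t})"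
        by (rule derivative_eq_intros B' y_sub[OF order_refl tT u] refl)+
           (simp add: algebra_simps power2_eq_square)
      let ?d = "y u - B (x u)" and ?df = "f (x u) (y u) - f (x u) (B (x u))"
      have "?d * (X1 (x u) (y u) * ?df) \<le> \<bar>?d\<bar> * (X1 (x u) (y u) * \<bar>?df\<bar>)"
        using X1_pos[of "x u" "y u"] abs_ge_self[of "?d * (X1 (x u) (y u) * ?df)"] by (simp add: abs_mult)
      also have "\<dots> \<le> \<bar>?d\<bar> * (M * (L * \<bar>?d\<bar>))"
        using X1[of "x u" "y u"] f_lip[of "x u" "y u" "B (x u)"] mM
        by (intro mult_left_mono mult_mono) auto
      also have "\<dots> = M * L * ?d\<^sup>2" by (simp add: power2_eq_square)
      finally have "2 * ?d * (X1 (x u) (y u) * f (x u) (y u) - f (x u) (B (x u)) * X1 (x u) (y u)) - 2 * M * L * ?d\<^sup>2 \<le> 0"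
        by (simp add: algebra_simps)
      then show "(2 * ?d * (X1 (x u) (y u) * f (x u) (y u) - f (x u) (B (x u)) * X1 (x u) (y u))
          - 2 * M * L * ?d\<^sup>2) * exp (- (2 * M * L * u)) \<le> 0" by (simp add: mult_le_0_iff)
    qed (use t in auto)
    then show ?thesis using xy B0 by simp
  qed
  from this[of T] have yB: "y T = B \<theta>" using T by (simp add: mult_le_0_iff)
  have "\<bar>y t\<bar> \<le> x t / 2" if "t \<in> {0..T}" for t
    using y_abs[OF that, of 1] y_abs[OF that, of "-1"] by auto
  then have *: "fst (x t, y t) \<in> {0..\<theta>} \<and> \<bar>snd (x t, y t)\<bar> \<le> fst (x t, y t) / 2 \<and> ((\<lambda>t. (x t, y t)) has_vector_derivative
      (X1 (fst (x t, y t)) (snd (x t, y t)), X1 (fst (x t, y t)) (snd (x t, y t)) * f (fst (x t, y t)) (snd (x t, y t))))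
        (at t within {0..T})" if "t \<in> {0..T}" for t
    unfolding fst_conv snd_conv using that
    by (intro conjI x_range has_vector_derivative_Pair_real x_T y_T) assumption+
  have **: "(x 0, y 0) = (0, 0)" "(x T, y T) = (\<theta>, B \<theta>)" using xy T yB by simp_all
  show ?thesis
    by (intro exI[of _ "\<lambda>t. (x t, y t)"] exI[of _ T] conjI T_pos ** ballI[OF *])
qed

section \<open>A box around the fold with uniform bounds\<close>

lemma eventually_nhds_box:
  assumes "\<forall>\<^sub>F p in nhds (0 :: real, 0 :: real). P p"
  shows "\<exists>R>0. \<forall>p\<in>{-R..R} \<times> {-R..R}. P p"
proof -
  obtain d where d: "d > 0" "\<And>p. dist p (0, 0) < d \<Longrightarrow> P p"
    using assms unfolding eventually_nhds_metric by blast
  have "P p" if p: "p \<in> {-(d / 3)..d / 3} \<times> {-(d / 3)..d / 3}" for p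
  proof (rule d(2))
    have "dist p (0, 0) \<le> \<bar>fst p\<bar> + \<bar>snd p\<bar>"
      by (cases p) (simp add: dist_Pair_Pair sqrt_sum_squares_le_sum_abs)
    also have "\<bar>fst p\<bar> \<le> d / 3" "\<bar>snd p\<bar> \<le> d / 3" using p by auto
    then have "\<bar>fst p\<bar> + \<bar>snd p\<bar> < d" using d(1) by linarith
    finally show "dist p (0, 0) < d" .
  qed
  then show ?thesis using d(1) by (intro exI[of _ "d / 3"]) auto
qed

text \<open>The field is clamped twice: first to a box of radius \<open>R1\<close> on which it is
  Lipschitz, to obtain the contact estimate; then to a smaller box where, because the vertical speed
  vanishes at the origin, that speed is at most half the horizontal one. The second clamped field
  satisfies the bounds on the whole plane.\<close>

lemma fold_neighbourhood:
  assumes "1 \<le> k" and filippov: "filippov_system (2 * k) V S W h Xp Xm" and hypA: "hypothesis_A k S W h Xp Xm"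
  shows "\<exists>R F K m M a A. 0 < R \<and> K-lipschitz_on UNIV F \<and> {-R..R} \<times> {-R..R} \<subseteq> W \<and>
    (\<forall>p\<in>{-R..R} \<times> {-R..R}. F p = Xp p \<and> Xm p = (0, 1) \<and> h p = snd p) \<and> 0 < m \<and>
    (\<forall>p. m \<le> fst (F p) \<and> fst (F p) \<le> M \<and> \<bar>snd (F p)\<bar> \<le> m / 2) \<and> 0 < a \<and> 0 \<le> A \<and>
    (\<forall>x. \<bar>x\<bar> \<le> R \<longrightarrow> a * \<bar>x\<bar> ^ (2 * k - 1) \<le> sgn x * snd (F (x, 0)) \<and>
      \<bar>snd (F (x, 0))\<bar> \<le> A * \<bar>x\<bar> ^ (2 * k - 1))"
proof -
  obtain U where U: "open U" "(0, 0) \<in> U" "U \<subseteq> W" "\<And>p. p \<in> U \<Longrightarrow> Xm p = (0, 1)" "\<And>p. p \<in> U \<Longrightarrow> h p = snd p"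
    and contact: "visible_contact k Xp h (0, 0)" and X10: "0 < fst (Xp (0, 0))"
    using hypA unfolding hypothesis_A_def by blast
  have V: "W \<subseteq> V" "Ck_on (2 * k) Xp V" using filippov by (auto simp: filippov_system_def)
  have CU: "Ck_on (2 * k) Xp U" using Ck_on_subset[OF V(2)] U V by auto
  obtain R1 where R1: "0 < R1" "{-R1..R1} \<times> {-R1..R1} \<subseteq> U"
    using eventually_nhds_box[OF eventually_nhds_in_open[OF U(1,2)]] by blast
  obtain L where L: "L-lipschitz_on ({-R1..R1} \<times> {-R1..R1}) Xp"
    using Ck_on_lipschitz_box[OF CU _ R1(2)] \<open>1 \<le> k\<close> by auto
  have lip: "L-lipschitz_on UNIV (\<lambda>p. Xp (box_clamp R p))" if R: "0 \<le> R" "R \<le> R1" for R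
  proof -
    have "range (box_clamp R) \<subseteq> {-R1..R1} \<times> {-R1..R1}"
    proof (rule image_subsetI)
      fix p show "box_clamp R p \<in> {-R1..R1} \<times> {-R1..R1}"
        using box_clamp_in[OF R(1), of p] R(2) by (auto simp: mem_Times_iff)
    qed
    from lipschitz_on_compose2[OF lipschitz_box_clamp lipschitz_on_subset[OF L this]]
    show ?thesis unfolding mult_1_left mult_1_right .
  qed
  define D where "D = {-R1<..<R1} \<times> {-R1<..<R1}"
  have D: "open D" "(0, 0) \<in> D" "D \<subseteq> U" "D \<subseteq> {-R1..R1} \<times> {-R1..R1}"
    using R1 by (auto simp: D_def intro!: open_Times)
  define F1 where "F1 = (\<lambda>p. Xp (box_clamp R1 p))"
  have hD: "h p = snd p" if "p \<in> D" for p using U(5) D(3) that by blast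
  have FD: "F1 p = Xp p" if "p \<in> D" for p
    unfolding F1_def using box_clamp_id[OF subsetD[OF D(4) that]] by (rule arg_cong)
  have lip1: "L-lipschitz_on UNIV F1" unfolding F1_def using R1 by (intro lip) auto
  obtain a A r where a: "0 < a" and r: "0 < r" and est: "\<And>x. \<bar>x\<bar> \<le> r \<Longrightarrow>
      a * \<bar>x\<bar> ^ (2 * k - 1) \<le> sgn x * snd (F1 (x, 0)) \<and> \<bar>snd (F1 (x, 0))\<bar> \<le> A * \<bar>x\<bar> ^ (2 * k - 1)"
    using fold_contact_estimate[OF D(1) Ck_on_subset[OF CU D(3)] \<open>1 \<le> k\<close> D(2) hD contact X10 lip1 FD] by blast
  have X20: "snd (Xp (0, 0)) = 0"
    using est[of 0] r \<open>1 \<le> k\<close> FD[OF D(2)] by (simp add: zero_power)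
  define m where "m = fst (Xp (0, 0)) / 2"
  define M where "M = 2 * fst (Xp (0, 0))"
  have m: "0 < m" using X10 by (simp add: m_def)
  have "continuous_on U Xp" by (rule Ck_on_imp_continuous_on[OF CU])
  then have "isCont Xp (0, 0)" using U(1,2) continuous_on_eq_continuous_at by blast
  then have lim: "(Xp \<longlongrightarrow> Xp (0, 0)) (nhds (0, 0))" using tendsto_at_iff_tendsto_nhds[of Xp] by (simp add: isCont_def)
  have "\<forall>\<^sub>F p in nhds (0, 0). p \<in> D \<and> m < fst (Xp p) \<and> fst (Xp p) < M \<and> \<bar>snd (Xp p)\<bar> < m / 2"
    using m X10 X20
    by (intro eventually_conj eventually_nhds_in_open D order_tendstoD[OF tendsto_fst[OF lim]]
        order_tendstoD(2)[OF tendsto_rabs[OF tendsto_snd[OF lim]]]) (auto simp: m_def M_def)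
  from eventually_nhds_box[OF this] obtain R2 where R2: "0 < R2"
    "\<And>p. p \<in> {-R2..R2} \<times> {-R2..R2} \<Longrightarrow> p \<in> D \<and> m < fst (Xp p) \<and> fst (Xp p) < M \<and> \<bar>snd (Xp p)\<bar> < m / 2" by blast
  define R where "R = min (min R1 R2) r"
  have R: "0 < R" "R \<le> R1" "R \<le> R2" "R \<le> r" using R1 R2 r by (auto simp: R_def)
  define F where "F = (\<lambda>p. Xp (box_clamp R p))"
  have box: "box_clamp R p \<in> {-R2..R2} \<times> {-R2..R2}" for p using box_clamp_in[of R p] R by auto
  have FX: "F p = Xp p" if "p \<in> {-R..R} \<times> {-R..R}" for p using that by (simp add: F_def box_clamp_id)
  have sub: "{-R..R} \<times> {-R..R} \<subseteq> U"
  proof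
    fix p assume "p \<in> {-R..R} \<times> {-R..R}"
    then have "p \<in> {-R2..R2} \<times> {-R2..R2}" using R by auto
    then show "p \<in> U" using R2(2) D(3) by blast
  qed
  \<comment> \<open>The constant from the contact estimate carries no sign condition, hence
    \<open>max A 0\<close>.\<close>
  have est': "a * \<bar>x\<bar> ^ (2 * k - 1) \<le> sgn x * snd (F (x, 0)) \<and> \<bar>snd (F (x, 0))\<bar> \<le> max A 0 * \<bar>x\<bar> ^ (2 * k - 1)"
    if x: "\<bar>x\<bar> \<le> R" for x
  proof -
    have "F (x, 0) = F1 (x, 0)"
    proof -
      have "-R \<le> x" "x \<le> R" "-R1 \<le> x" "x \<le> R1" using x R by auto
      then show ?thesis
        using R box_clamp_id[of "(x, 0)" R] box_clamp_id[of "(x, 0)" R1] by (auto simp: F_def F1_def)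
    qed
    moreover have "A * \<bar>x\<bar> ^ (2 * k - 1) \<le> max A 0 * \<bar>x\<bar> ^ (2 * k - 1)" by (intro mult_right_mono) auto
    ultimately show ?thesis using est[of x] x R by auto
  qed
  have bd: "m \<le> fst (F p) \<and> fst (F p) \<le> M \<and> \<bar>snd (F p)\<bar> \<le> m / 2" for p
    using R2(2)[OF box[of p]] by (auto simp: F_def)
  have "L-lipschitz_on UNIV F" unfolding F_def using R by (intro lip) auto
  moreover have "{-R..R} \<times> {-R..R} \<subseteq> W" using sub U(3) by blast
  moreover have "\<forall>p\<in>{-R..R} \<times> {-R..R}. F p = Xp p \<and> Xm p = (0, 1) \<and> h p = snd p"
    using sub U(4,5) FX by blast
  moreover have "0 \<le> max A 0" by simp
  ultimately show ?thesis using R(1) m bd a est' by blast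
qed

section \<open>The flow map of the regularized system\<close>

theorem theorem2:
  fixes k n :: nat
    and V W S :: "(real \<times> real) set"
    and h :: "real \<times> real \<Rightarrow> real"
    and Xp Xm :: "real \<times> real \<Rightarrow> real \<times> real"
    and \<Phi> :: "real \<Rightarrow> real"
  assumes "k \<ge> 1"
    and "filippov_system (2 * k) V S W h Xp Xm"
    and "hypothesis_A k S W h Xp Xm"
    and "n \<ge> 2 * k - 1"
    and "\<Phi> \<in> transition_functions n"
  shows "\<exists>\<rho>0>0. \<exists>\<theta>0>0. \<exists>c>0. \<exists>r>0. \<exists>\<eta> x y.
    abscissa_form k n Xp \<eta> x \<and>
    ordinate_form k V Xp \<theta>0 x y \<and>
    (\<forall>l\<in>{0<..<lambda_star k n}.
      \<forall>\<^sub>F \<epsilon> in at_right 0.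
        let q = 1 - l / lambda_star k n;
            d = r * exp (- c / \<epsilon> powr q);
            Z = regularization \<Phi> h Xp Xm \<epsilon>
        in \<forall>\<rho>\<in>{\<epsilon> powr l<..\<rho>0}. \<forall>\<theta>\<in>{x \<epsilon> + d..\<theta>0}.
          transversal_section W Z (\<theta>, y \<epsilon> \<theta> - d) (\<theta>, y \<epsilon> \<theta>) \<and>
          transversal_section W Z (- \<rho>, - \<epsilon>) (- (\<epsilon> powr l), - \<epsilon>) \<and>
          transversal_section W Z (x \<epsilon>, \<epsilon>) (x \<epsilon> + d, \<epsilon>) \<and>
          (\<exists>L. flow_defines_map W Z
            (closed_segment (- \<rho>, - \<epsilon>) (- (\<epsilon> powr l), - \<epsilon>))
            (closed_segment (\<theta>, y \<epsilon> \<theta> - d) (\<theta>, y \<epsilon> \<theta>)) L))"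
proof -
  obtain R F K m M a A where R: "0 < R" and lipF: "K-lipschitz_on UNIV F" and boxW: "{-R..R} \<times> {-R..R} \<subseteq> W"
    and box: "\<And>p. p \<in> {-R..R} \<times> {-R..R} \<Longrightarrow> F p = Xp p \<and> Xm p = (0, 1) \<and> h p = snd p"
    and m: "0 < m" and F: "\<And>p. m \<le> fst (F p) \<and> fst (F p) \<le> M \<and> \<bar>snd (F p)\<bar> \<le> m / 2"
    and a: "0 < a" and A: "0 \<le> A" and est: "\<And>x. \<bar>x\<bar> \<le> R \<Longrightarrow> a * \<bar>x\<bar> ^ (2 * k - 1) \<le> sgn x * snd (F (x, 0)) \<and>
      \<bar>snd (F (x, 0))\<bar> \<le> A * \<bar>x\<bar> ^ (2 * k - 1)"
    using fold_neighbourhood[OF assms(1-3)] by blast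
  have "m \<le> M" using F[of undefined] by linarith
  then have M: "0 < M" using m by linarith
  have n: "1 \<le> n" and WV: "W \<subseteq> V" using assms by (auto simp: filippov_system_def)
  obtain \<phi> where "transition n \<Phi> \<phi>" using transitionI[OF assms(5) n] by blast
  then interpret \<Phi>: transition n \<Phi> \<phi> .
  define P where "P = (\<lambda>v. (1 + \<Phi> v) / 2)"
  \<comment> \<open>The two thresholds translate into \<open>P v1 \<le> 1 / 4\<close> and
    \<open>P v1 \<le> 1 / M\<close>.\<close>
  obtain v1 where v1: "v1 \<in> {-1<..0}" "\<Phi> v1 < -1 + min (1 / 2) (2 / M)"
    using \<Phi>.\<Phi>_near_minus_one[of "min (1 / 2) (2 / M)"] M by auto
  have Pv1: "P v1 \<le> 1 / 4" "P v1 * M \<le> 1"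
  proof -
    show "P v1 \<le> 1 / 4" using v1 by (simp add: P_def)
    have "P v1 \<le> 1 / M" using v1 by (simp add: P_def)
    then show "P v1 * M \<le> 1" using M by (simp add: field_simps)
  qed
  obtain c0 C0 where c0: "0 < c0" "0 < C0"
    "\<And>s. s \<in> {0..2} \<Longrightarrow> c0 * s ^ n \<le> 1 - \<Phi> (1 - s) \<and> 1 - \<Phi> (1 - s) \<le> C0 * s ^ n"
    using \<Phi>.\<Phi>_tangency_order by blast
  obtain c1 where c1: "0 < c1" "\<And>w v v'. w \<in> {0..1} \<Longrightarrow> v \<in> {v1..1 - w} \<Longrightarrow> v' \<in> {-1..v} \<Longrightarrow>
    c1 * w ^ (n - 1) * (v - v') \<le> \<Phi> v - \<Phi> v'"
    using \<Phi>.\<Phi>_increment[of v1] v1(1) by auto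
  define X1 where "X1 = (\<lambda>x y. fst (F (x, y)))"
  define f where "f = (\<lambda>x y. snd (F (x, y)) / fst (F (x, y)))"
  have distF: "dist (F p) (F q) \<le> K * dist p q" for p q using lipschitz_onD[OF lipF] by simp
  have bl1: "bounded_lipschitz (\<lambda>p. fst (F p))"
  proof -
    have "\<bar>fst (F p) - fst (F q)\<bar> \<le> K * dist p q" "\<bar>fst (F p)\<bar> \<le> M" for p q
      using order_trans[OF dist_fst_le distF[of p q]] F[of p] m by (auto simp: dist_real_def)
    then show ?thesis unfolding bounded_lipschitz_def by blast
  qed
  have bl2: "bounded_lipschitz (\<lambda>p. snd (F p))"
  proof -
    have "\<bar>snd (F p) - snd (F q)\<bar> \<le> K * dist p q" "\<bar>snd (F p)\<bar> \<le> m / 2" for p q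
      using order_trans[OF dist_snd_le distF[of p q]] F[of p] by (auto simp: dist_real_def)
    then show ?thesis unfolding bounded_lipschitz_def by blast
  qed
  have blf: "bounded_lipschitz (\<lambda>p. snd (F p) / fst (F p))"
    by (rule bounded_lipschitz_divide[OF bl2 bl1 m]) (use F in blast)
  obtain K1 where K1: "0 \<le> K1" "\<And>p q. \<bar>fst (F p) - fst (F q)\<bar> \<le> K1 * dist p q"
    using bounded_lipschitzD[OF bl1] by blast
  obtain K2 where K2: "0 \<le> K2" "\<And>p q. \<bar>snd (F p) / fst (F p) - snd (F q) / fst (F q)\<bar> \<le> K2 * dist p q"
    using bounded_lipschitzD[OF blf] by blast
  define L where "L = max K1 K2"
  have Ff: "0 < fst (F p)" for p using F[of p] m by linarith
  \<comment> \<open>Division by the abscissa speed, which lies between \<open>m\<close> and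
    \<open>M\<close>, turns the bounds on the vertical speed into bounds on the slope; the halves
    come from \<open>P = (1 + \<Phi>) / 2\<close>.\<close>
  interpret S: sliding_lipschitz "2 * k - 1" n X1 f P m M L "a / M" "A / m" R "c0 / 2" "C0 / 2" "c1 / 2" v1
  proof unfold_locales
    fix x y z :: real
    show "m \<le> X1 x y" "X1 x y \<le> M" using F by (auto simp: X1_def)
    have "\<bar>snd (F (x, y))\<bar> * 2 \<le> fst (F (x, y))" using F[of "(x, y)"] by auto
    then show "\<bar>f x y\<bar> \<le> 1 / 2" using Ff[of "(x, y)"] by (simp add: f_def abs_divide field_simps)
    have d: "dist (x, y) (x, z) = \<bar>y - z\<bar>" by (simp add: dist_Pair_Pair dist_real_def)
    have "K1 * \<bar>y - z\<bar> \<le> L * \<bar>y - z\<bar>" "K2 * \<bar>y - z\<bar> \<le> L * \<bar>y - z\<bar>"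
      by (auto simp: L_def intro: mult_right_mono)
    then show "\<bar>X1 x y - X1 x z\<bar> \<le> L * \<bar>y - z\<bar>" "\<bar>f x y - f x z\<bar> \<le> L * \<bar>y - z\<bar>"
      using K1(2)[of "(x, y)" "(x, z)"] K2(2)[of "(x, y)" "(x, z)"] unfolding d X1_def f_def by linarith+
  next
    have aM: "a / M * \<bar>x\<bar> ^ (2 * k - 1) \<le> sgn x * f x 0" if "\<bar>x\<bar> \<le> R" for x
    proof -
      have "a / M * \<bar>x\<bar> ^ (2 * k - 1) \<le> a * \<bar>x\<bar> ^ (2 * k - 1) / fst (F (x, 0))"
        using F[of "(x, 0)"] Ff[of "(x, 0)"] M a by (simp add: frac_le)
      also have "\<dots> \<le> sgn x * snd (F (x, 0)) / fst (F (x, 0))"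
        using est[OF that] Ff[of "(x, 0)"] by (intro divide_right_mono) auto
      finally show ?thesis by (simp add: f_def)
    qed
    show f_abs: "\<bar>f x 0\<bar> \<le> A / m * \<bar>x\<bar> ^ (2 * k - 1)" if "\<bar>x\<bar> \<le> R" for x
    proof -
      have "\<bar>snd (F (x, 0))\<bar> / fst (F (x, 0)) \<le> A * \<bar>x\<bar> ^ (2 * k - 1) / m"
        using est[OF that] F[of "(x, 0)"] m A by (intro frac_le) auto
      then show ?thesis using Ff[of "(x, 0)"] by (simp add: f_def abs_divide)
    qed
    show "a / M * x ^ (2 * k - 1) \<le> f x 0" if "0 \<le> x" "x \<le> R" for x
      using aM[of x] f_abs[of 0] that R \<open>1 \<le> k\<close> by (cases "x = 0") (auto simp: zero_power)
    show "f x 0 \<le> - (a / M * \<bar>x\<bar> ^ (2 * k - 1))" if "- R \<le> x" "x \<le> 0" for x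
      using aM[of x] f_abs[of 0] that R \<open>1 \<le> k\<close> by (cases "x = 0") (auto simp: zero_power)
  next
    show "P v \<le> P v'" if "v \<le> v'" for v v' using \<Phi>.mono_\<Phi>[OF that] by (simp add: P_def)
    show "P v = 0" if "v \<le> -1" for v using \<Phi>.outside[of v] that by (simp add: P_def)
    show "P v = 1" if "1 \<le> v" for v using \<Phi>.outside[of v] that by (simp add: P_def)
    show "0 < P v" if "-1 < v" for v using \<Phi>.\<Phi>_gt[OF that] by (simp add: P_def)
    show "c0 / 2 * s ^ n \<le> 1 - P (1 - s)" "1 - P (1 - s) \<le> C0 / 2 * s ^ n" if "0 \<le> s" "s \<le> 2" for s
      using c0(3)[of s] that by (auto simp: P_def field_simps)
    show "c1 / 2 * w ^ (n - 1) * (v - v') \<le> P v - P v'"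
      if "0 \<le> w" "w \<le> 1" "v1 \<le> v" "v \<le> 1 - w" "-1 \<le> v'" "v' \<le> v" for w v v'
      using c1(2)[of w v v'] that by (auto simp: P_def field_simps)
    show "\<exists>K. \<forall>v v'. \<bar>P v - P v'\<bar> \<le> K * \<bar>v - v'\<bar>"
    proof -
      obtain K where "K-lipschitz_on UNIV \<Phi>" using \<Phi>.lipschitz_\<Phi> by blast
      then have *: "\<bar>\<Phi> v - \<Phi> v'\<bar> \<le> K * \<bar>v - v'\<bar>" for v v'
        using lipschitz_onD[of K UNIV \<Phi> v v'] by (simp add: dist_real_def)
      have eq: "P v - P v' = (\<Phi> v - \<Phi> v') / 2" for v v' by (simp add: P_def flip: diff_divide_distrib)
      have "\<bar>P v - P v'\<bar> \<le> K / 2 * \<bar>v - v'\<bar>" for v v'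
        unfolding eq using *[of v v'] by (simp add: abs_divide)
      then show ?thesis by blast
    qed
  qed (use assms n m M a A c0 c1 v1 Pv1 R bl1 blf K1 in \<open>auto simp: X1_def f_def L_def\<close>)

  \<comment> \<open>A quarter of \<open>R\<close> keeps the curves in the box: \<open>Y\<close> is
    at most \<open>\<epsilon> + \<rho>\<close>, and \<open>\<epsilon>\<close> will be below
    \<open>R / 4\<close>.\<close>
  define \<rho> where "\<rho> = R / 4"
  have \<rho>: "0 < \<rho>" "\<rho> \<le> R" "\<rho> + \<rho> < R" using R by (auto simp: \<rho>_def)
  define Q where "Q = {-R<..<R} \<times> {-R<..<R}"
  have Q: "open Q" "Q \<subseteq> {-R..R} \<times> {-R..R}" by (auto simp: Q_def intro!: open_Times)
  have QW: "Q \<subseteq> W" and QV: "Q \<subseteq> V" using Q(2) boxW WV by blast+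
  have F_eq: "F p = (X1 (fst p) (snd p), X1 (fst p) (snd p) * f (fst p) (snd p))" for p
    unfolding X1_def f_def prod.collapse using Ff[of p] by (simp add: prod_eq_iff)

  obtain B where B: "B 0 = 0" "\<And>x. x \<in> {0..\<rho>} \<Longrightarrow> (B has_real_derivative f x (B x)) (at x within {0..\<rho>})"
    using scalar_ode_exists[OF S.f_bl, of 0 \<rho> 0] \<rho> by auto
  have ybar: "ybar V Xp \<theta> = B \<theta>" if \<theta>: "0 < \<theta>" "\<theta> \<le> \<rho>" for \<theta>
  proof -
    obtain \<gamma> T where \<gamma>: "0 < T" "\<gamma> 0 = (0, 0)" "\<gamma> T = (\<theta>, B \<theta>)"
      "\<And>t. t \<in> {0..T} \<Longrightarrow> fst (\<gamma> t) \<in> {0..\<theta>} \<and> \<bar>snd (\<gamma> t)\<bar> \<le> fst (\<gamma> t) / 2"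
      "\<And>t. t \<in> {0..T} \<Longrightarrow> (\<gamma> has_vector_derivative F (\<gamma> t)) (at t within {0..T})"
      using S.fold_arc_planar[OF B \<theta>] unfolding F_eq by blast
    have "\<gamma> t \<in> Q" if "t \<in> {0..T}" for t
      using \<gamma>(4)[OF that] \<theta> \<rho> by (auto simp: Q_def mem_Times_iff abs_le_iff)
    then show ?thesis
    proof (intro ybar_eqI[OF lipF Q(1) QV _ _ \<gamma>(1,2,3,5)])
      show XF: "Xp p = F p" if "p \<in> Q" for p using box[of p] Q(2) that by auto
      show "0 < fst (Xp p)" if "p \<in> Q" for p using Ff[of p] XF[OF that] by simp
    qed
  qed

  let ?top = "\<lambda>\<epsilon> Y. sliding_top (2 * k - 1) n X1 f P m M L (a / M) (A / m) R (c0 / 2) (C0 / 2) (c1 / 2) v1 \<epsilon> \<rho> \<rho> Y"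
  \<comment> \<open>One curve per \<open>\<epsilon>\<close>, chosen before \<open>l\<close>, the
    starting segment and \<open>\<theta>\<close>, so that the ordinate depends on
    \<open>\<epsilon>\<close> and \<open>\<theta>\<close> alone.\<close>
  define y where "y = (\<lambda>\<epsilon>. SOME Y. ?top \<epsilon> Y)"
  have y: "?top \<epsilon> (y \<epsilon>)" if "0 < \<epsilon>" for \<epsilon>
    unfolding y_def by (rule someI_ex[OF S.top_exists[OF that \<rho>(1,2)]])
  have Suc_j: "Suc (2 * k - 1) = 2 * k" using \<open>1 \<le> k\<close> by simp
  define \<mu> where "\<mu> = lambda_star k n"
  have \<mu>: "real n / S.scale_order = \<mu>"
    unfolding S.scale_order_def Suc_j \<mu>_def lambda_star_def using n by (simp add: of_nat_diff)
  \<comment> \<open>With \<open>\<eta>\<close> above both bounds the condition in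
    \<open>abscissa_form\<close> holds whatever the relation between \<open>n\<close> and
    \<open>k\<close>.\<close>
  obtain \<eta> C where \<eta>: "- root (2 * k - 1) (deriv (\<lambda>y. slope Xp (0, y)) 0 / alpha k Xp) < \<eta>" "0 < \<eta>" and C: "0 \<le> C"
    and exit: "\<forall>\<^sub>F \<epsilon> in at_right 0. \<forall>Y. ?top \<epsilon> Y \<longrightarrow> \<eta> * \<epsilon> powr \<mu> \<le> \<rho> \<and>
      (\<forall>x\<in>{\<eta> * \<epsilon> powr \<mu>..\<rho>}. \<epsilon> \<le> Y x \<and> 0 < f x \<epsilon>) \<and>
      Y (\<eta> * \<epsilon> powr \<mu>) \<le> \<epsilon> + C * (\<eta> * \<epsilon> powr \<mu>) ^ (2 * k)"
    using S.eventually_exit[OF \<rho>(1,2), unfolded \<mu> Suc_j] by blast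
  obtain c r where c: "0 < c" "0 < r" and contract: "\<And>l. 0 < l \<Longrightarrow> l < \<mu> \<Longrightarrow> \<forall>\<^sub>F \<epsilon> in at_right 0. \<forall>Y x y T r'.
    sliding_flow (2 * k - 1) n X1 f P m M L (a / M) (A / m) R (c0 / 2) (C0 / 2) (c1 / 2) v1 \<epsilon> \<rho> \<rho> Y x y T r' \<and>
      \<epsilon> powr l \<le> r' \<and> 0 \<le> x T \<longrightarrow> Y (x T) - y T \<le> r * exp (- c / \<epsilon> powr (1 - l / \<mu>))"
    using S.eventually_contraction[OF \<rho>(1,2), unfolded \<mu>] by blast
  \<comment> \<open>An exact multiple of the power, so the error term of
    \<open>abscissa_form\<close> is 0.\<close>
  define x where "x = (\<lambda>\<epsilon>. \<eta> * \<epsilon> powr \<mu>)"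
  have x_pos: "0 < x \<epsilon>" if "0 < \<epsilon>" for \<epsilon> using \<eta> that by (simp add: x_def)

  have abscissa: "abscissa_form k n Xp \<eta> x"
    using \<eta> by (simp add: abscissa_form_def x_def \<mu>_def mult.commute)

  have ordinate: "ordinate_form k V Xp \<rho> x y"
    unfolding ordinate_form_def
  proof (intro exI)
    define E where "E = exp (L * R) * (L + A / m * exp (L * R) + C)"
    show "\<forall>\<^sub>F \<epsilon> in at_right 0. \<forall>\<theta>\<in>{x \<epsilon>..\<rho>}. \<bar>y \<epsilon> \<theta> - (ybar V Xp \<theta> + \<epsilon>)\<bar> \<le>
      E * (\<epsilon> * \<bar>\<theta>\<bar> + (\<Sum>i=1..2 * k - 1. \<bar>\<theta>\<bar> ^ (2 * k + 1 - i) * \<bar>x \<epsilon>\<bar> ^ i) + \<bar>x \<epsilon>\<bar> ^ (2 * k))"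
      using exit eventually_at_right_less[of "0 :: real"]
    proof eventually_elim
      case (elim \<epsilon>)
      note top = y[OF elim(2)]
      interpret T: sliding_top "2 * k - 1" n X1 f P m M L "a / M" "A / m" R "c0 / 2" "C0 / 2" "c1 / 2" v1 \<epsilon> \<rho> \<rho> "y \<epsilon>"
        by (rule top)
      have e: "x \<epsilon> \<le> \<rho>" "\<And>z. z \<in> {x \<epsilon>..\<rho>} \<Longrightarrow> \<epsilon> \<le> y \<epsilon> z" "y \<epsilon> (x \<epsilon>) \<le> \<epsilon> + C * x \<epsilon> ^ Suc (2 * k - 1)"
        using elim(1)[rule_format, OF top] unfolding Suc_j by (auto simp: x_def)
      show ?case
      proof
        fix \<theta> assume "\<theta> \<in> {x \<epsilon>..\<rho>}"
        then have \<theta>: "x \<epsilon> \<le> \<theta>" "\<theta> \<le> \<rho>" "0 < \<theta>" "0 < x \<epsilon>" using x_pos[OF elim(2)] by auto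
        have LE: "0 \<le> exp (L * R) * L" "0 \<le> exp (L * R) * (A / m * exp (L * R) + C)"
          using S.L A m C by auto
        have "\<bar>y \<epsilon> \<theta> - (B \<theta> + \<epsilon>)\<bar> \<le> exp (L * R) * (L * \<epsilon> * \<theta> + (A / m * exp (L * R) + C) * x \<epsilon> ^ Suc (2 * k - 1))"
          by (rule T.Y_close_to_fold_arc[OF \<theta>(4,1,2) B e(2,3) C])
        also have "\<dots> = exp (L * R) * L * (\<epsilon> * \<theta>) + exp (L * R) * (A / m * exp (L * R) + C) * x \<epsilon> ^ (2 * k)"
          unfolding Suc_j by (simp add: algebra_simps)
        also have "\<dots> \<le> E * (\<epsilon> * \<theta>) + E * x \<epsilon> ^ (2 * k)"
          using LE \<theta> elim(2) by (intro add_mono mult_right_mono) (auto simp: E_def algebra_simps)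
        also have "\<dots> = E * (\<epsilon> * \<theta> + 0 + x \<epsilon> ^ (2 * k))" by (simp add: algebra_simps)
        \<comment> \<open>The mixed sum is nonnegative and may simply be added.\<close>
        also have "\<dots> \<le> E * (\<epsilon> * \<theta> + (\<Sum>i=1..2 * k - 1. \<bar>\<theta>\<bar> ^ (2 * k + 1 - i) * \<bar>x \<epsilon>\<bar> ^ i) + x \<epsilon> ^ (2 * k))"
          using LE by (intro mult_left_mono add_mono order_refl sum_nonneg) (auto simp: E_def algebra_simps)
        finally show "\<bar>y \<epsilon> \<theta> - (ybar V Xp \<theta> + \<epsilon>)\<bar> \<le>
            E * (\<epsilon> * \<bar>\<theta>\<bar> + (\<Sum>i=1..2 * k - 1. \<bar>\<theta>\<bar> ^ (2 * k + 1 - i) * \<bar>x \<epsilon>\<bar> ^ i) + \<bar>x \<epsilon>\<bar> ^ (2 * k))"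
          unfolding ybar[OF \<theta>(3,2)] using \<theta> by simp
      qed
    qed
  qed

  have flow: "\<forall>\<^sub>F \<epsilon> in at_right 0.
        let q = 1 - l / lambda_star k n;
            d = r * exp (- c / \<epsilon> powr q);
            Z = regularization \<Phi> h Xp Xm \<epsilon>
        in \<forall>\<rho>'\<in>{\<epsilon> powr l<..\<rho>}. \<forall>\<theta>\<in>{x \<epsilon> + d..\<rho>}.
          transversal_section W Z (\<theta>, y \<epsilon> \<theta> - d) (\<theta>, y \<epsilon> \<theta>) \<and>
          transversal_section W Z (- \<rho>', - \<epsilon>) (- (\<epsilon> powr l), - \<epsilon>) \<and>
          transversal_section W Z (x \<epsilon>, \<epsilon>) (x \<epsilon> + d, \<epsilon>) \<and>
          (\<exists>L. flow_defines_map W Z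
            (closed_segment (- \<rho>', - \<epsilon>) (- (\<epsilon> powr l), - \<epsilon>))
            (closed_segment (\<theta>, y \<epsilon> \<theta> - d) (\<theta>, y \<epsilon> \<theta>)) L)"
    if "l \<in> {0<..<lambda_star k n}" for l
  proof -
    have l: "0 < l" "l < \<mu>" using that by (auto simp: \<mu>_def)
    then have q: "0 < 1 - l / \<mu>" by (simp add: field_simps)
    have small: "\<forall>\<^sub>F \<epsilon> in at_right 0. \<epsilon> \<in> {0<..<R / 4}" using R by (intro eventually_at_right_real) auto
    show ?thesis
      unfolding Let_def \<mu>_def[symmetric]
      using exit contract[OF l] eventually_exp_powr_le[OF c(1) q c(2)] small
    proof eventually_elim
      case (elim \<epsilon>)
      define d where "d = r * exp (- c / \<epsilon> powr (1 - l / \<mu>))"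
      define Z where "Z = regularization \<Phi> h Xp Xm \<epsilon>"
      have \<epsilon>: "0 < \<epsilon>" "\<epsilon> < R / 4" using elim(4) by auto
      have d: "0 < d" "d \<le> \<epsilon>" using c elim(3) by (auto simp: d_def)
      note top = y[OF \<epsilon>(1)]
      interpret T: sliding_top "2 * k - 1" n X1 f P m M L "a / M" "A / m" R "c0 / 2" "C0 / 2" "c1 / 2" v1 \<epsilon> \<rho> \<rho> "y \<epsilon>"
        by (rule top)
      have e: "\<epsilon> \<le> y \<epsilon> z" "0 < f z \<epsilon>" if "z \<in> {x \<epsilon>..\<rho>}" for z
        using elim(1)[rule_format, OF top] that by (auto simp: x_def)
      show ?case
        unfolding d_def[symmetric] Z_def[symmetric]
      proof (intro ballI)
        fix \<rho>' \<theta> assume "\<rho>' \<in> {\<epsilon> powr l<..\<rho>}" "\<theta> \<in> {x \<epsilon> + d..\<rho>}"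
        then have \<theta>: "x \<epsilon> + d \<le> \<theta>" "\<theta> \<le> \<rho>" "0 < x \<epsilon>" "x \<epsilon> \<le> \<theta>" "0 < \<theta>"
          and \<rho>': "\<epsilon> powr l < \<rho>'" "\<rho>' \<le> \<rho>" "0 < \<epsilon> powr l"
          using x_pos[OF \<epsilon>(1)] d \<epsilon> by auto
        have y_up: "y \<epsilon> z < R" if "z \<in> {-\<rho>..\<rho>}" for z
        proof -
          have "y \<epsilon> z \<le> \<epsilon> + (z + \<rho>) / 2" by (rule T.Y_upper[OF that])
          also have "(z + \<rho>) / 2 \<le> \<rho>" using that by simp
          finally show ?thesis using \<epsilon> R by (simp add: \<rho>_def)
        qed
        have y\<theta>: "\<epsilon> \<le> y \<epsilon> \<theta>" "y \<epsilon> \<theta> < R" using e[of \<theta>] y_up[of \<theta>] \<theta> by auto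
        have ZQ: "Z p = (S.Zx \<epsilon> p, S.Zy \<epsilon> p)" if "p \<in> Q" for p
        proof -
          have p: "Xp p = F p" "Xm p = (0, 1)" "h p = snd p" using box[of p] Q(2) that by auto
          have P: "(1 + \<Phi> v) / 2 = P v" "(1 - \<Phi> v) / 2 = 1 - P v" for v by (simp_all add: P_def field_simps)
          show ?thesis
            unfolding Z_def regularization_def p F_eq P S.Zx_def S.Zy_def by simp
        qed
        have V: "transversal_section W Z (\<theta>, y \<epsilon> \<theta> - d) (\<theta>, y \<epsilon> \<theta>)"
        proof (rule transversal_section_vertical)
          have inQ: "(\<theta>, v) \<in> Q" if "v \<in> {y \<epsilon> \<theta> - d..y \<epsilon> \<theta>}" for v
            using that y\<theta> d \<theta> \<rho> R by (auto simp: Q_def)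
          then show "{\<theta>} \<times> {y \<epsilon> \<theta> - d..y \<epsilon> \<theta>} \<subseteq> W" using QW by auto
          fix v assume v: "v \<in> {y \<epsilon> \<theta> - d..y \<epsilon> \<theta>}"
          \<comment> \<open>Since \<open>d \<le> \<epsilon> \<le> y \<epsilon> \<theta>\<close>, the
            section lies in \<open>v \<ge> 0\<close>, where \<open>P\<close> is positive.\<close>
          then have "-1 < v / \<epsilon>" using y\<theta> d \<epsilon> by (auto simp: field_simps)
          then show "fst (Z (\<theta>, v)) \<noteq> 0"
            using ZQ[OF inQ[OF v]] S.P_pos[of "v / \<epsilon>"] S.X1_pos[of \<theta> v] by (auto simp: S.Zx_def)
        qed (use d in auto)
        have H: "transversal_section W Z (- \<rho>', - \<epsilon>) (- (\<epsilon> powr l), - \<epsilon>)"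
        proof (rule transversal_section_horizontal)
          have inQ: "(u, - \<epsilon>) \<in> Q" if "u \<in> {- \<rho>'..- (\<epsilon> powr l)}" for u
          proof -
            have "u \<le> - (\<epsilon> powr l)" "- \<rho>' \<le> u" using that by auto
            then have "- R < u" "u < R" using \<rho>' \<rho> R by linarith+
            then show ?thesis using \<epsilon> by (auto simp: Q_def)
          qed
          then show "{- \<rho>'..- (\<epsilon> powr l)} \<times> {- \<epsilon>} \<subseteq> W" using QW by auto
          \<comment> \<open>On the lower edge the regularized field is (0, 1).\<close>
          show "snd (Z (u, - \<epsilon>)) \<noteq> 0" if "u \<in> {- \<rho>'..- (\<epsilon> powr l)}" for u
            using ZQ[OF inQ[OF that]] S.P_lo[of "-1"] \<epsilon> by (simp add: S.Zy_def)
        qed (use \<rho>' in auto)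
        have E: "transversal_section W Z (x \<epsilon>, \<epsilon>) (x \<epsilon> + d, \<epsilon>)"
        proof (rule transversal_section_horizontal)
          have inQ: "(u, \<epsilon>) \<in> Q" if "u \<in> {x \<epsilon>..x \<epsilon> + d}" for u
            using that \<theta> \<rho> \<epsilon> R by (auto simp: Q_def)
          then show "{x \<epsilon>..x \<epsilon> + d} \<times> {\<epsilon>} \<subseteq> W" using QW by auto
          \<comment> \<open>On the upper edge it is the upper field, whose vertical speed
            \<open>X1 * f\<close> is positive from the exit abscissa on.\<close>
          show "snd (Z (u, \<epsilon>)) \<noteq> 0" if "u \<in> {x \<epsilon>..x \<epsilon> + d}" for u
            using ZQ[OF inQ[OF that]] S.P_hi[of 1] e(2)[of u] S.X1_pos[of u \<epsilon>] that \<theta> \<epsilon>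
            by (simp add: S.Zy_def)
        qed (use d in auto)
        have segV: "closed_segment (\<theta>, y \<epsilon> \<theta> - d) (\<theta>, y \<epsilon> \<theta>) = {\<theta>} \<times> {y \<epsilon> \<theta> - d..y \<epsilon> \<theta>}"
          using d by (intro closed_segment_vertical) auto
        have segH: "closed_segment (- \<rho>', - \<epsilon>) (- (\<epsilon> powr l), - \<epsilon>) = {- \<rho>'..- (\<epsilon> powr l)} \<times> {- \<epsilon>}"
          using \<rho>' by (intro closed_segment_horizontal) auto
        obtain K where lipZ: "K-lipschitz_on UNIV (\<lambda>p. (S.Zx \<epsilon> p, S.Zy \<epsilon> p))"
          using bounded_lipschitz_Pair[OF S.Z_bl] by blast
        have "\<exists>L. flow_defines_map W Z (closed_segment (- \<rho>', - \<epsilon>) (- (\<epsilon> powr l), - \<epsilon>))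
          (closed_segment (\<theta>, y \<epsilon> \<theta> - d) (\<theta>, y \<epsilon> \<theta>)) L"
        proof (rule flow_defines_mapI[OF lipZ Q(1) QW ZQ])
          fix p assume "p \<in> closed_segment (- \<rho>', - \<epsilon>) (- (\<epsilon> powr l), - \<epsilon>)"
          then obtain r' where r': "p = (- r', - \<epsilon>)" "\<epsilon> powr l \<le> r'" "r' \<le> \<rho>'"
            unfolding segH by (cases p) (auto intro: that[of "- fst p"])
          obtain u v T where T: "0 < T" "u T = \<theta>" and
            flow: "sliding_flow (2 * k - 1) n X1 f P m M L (a / M) (A / m) R (c0 / 2) (C0 / 2) (c1 / 2) v1 \<epsilon> \<rho> \<rho> (y \<epsilon>) u v T r'"
            using S.flow_exists[OF top, of r' \<theta>] r' \<rho>' \<theta> by auto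
          interpret Fl: sliding_flow "2 * k - 1" n X1 f P m M L "a / M" "A / m" R "c0 / 2" "C0 / 2" "c1 / 2" v1 \<epsilon> \<rho> \<rho> "y \<epsilon>" u v T r'
            by (rule flow)
          have \<Delta>: "v t \<le> y \<epsilon> (u t)" if "t \<in> {0..T}" for t
            using Fl.\<Delta>_nonneg[OF that] by (simp add: Fl.\<Delta>_def)
          have "y \<epsilon> (u T) - v T \<le> d"
            unfolding d_def by (rule elim(2)[rule_format]) (use flow r'(2) T \<theta> in auto)
          then have hit: "(u T, v T) \<in> closed_segment (\<theta>, y \<epsilon> \<theta> - d) (\<theta>, y \<epsilon> \<theta>)"
            unfolding segV using \<Delta>[of T] T by auto
          \<comment> \<open>The trajectory stays between the lower edge and \<open>Y\<close>, hence
            in the box where the cut-off field is the regularized one.\<close>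
          have inQ: "(u t, v t) \<in> Q" if "t \<in> {0..T}" for t
            using Fl.x_range[OF that] Fl.y_ge[OF that] \<Delta>[OF that] y_up[of "u t"] \<rho> \<epsilon> by (auto simp: Q_def)
          \<comment> \<open>The abscissa is strictly increasing, so the line of abscissa
            \<open>\<theta>\<close> is met at time \<open>T\<close> only.\<close>
          have "(u t, v t) \<notin> closed_segment (\<theta>, y \<epsilon> \<theta> - d) (\<theta>, y \<epsilon> \<theta>)" if "t \<in> {0<..<T}" for t
            unfolding segV using Fl.x_strict[of t T] that T by auto
          moreover have "((\<lambda>t. (u t, v t)) has_vector_derivative (S.Zx \<epsilon> (u t, v t), S.Zy \<epsilon> (u t, v t))) (at t within {0..T})"
            if "t \<in> {0..T}" for t
            using has_vector_derivative_Pair_real[OF Fl.x_der[OF that] Fl.y_der[OF that]]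
            by (simp add: S.Zx_def S.Zy_def)
          ultimately show "\<exists>T \<gamma>. 0 < T \<and> \<gamma> 0 = p \<and> \<gamma> T \<in> closed_segment (\<theta>, y \<epsilon> \<theta> - d) (\<theta>, y \<epsilon> \<theta>) \<and>
              (\<forall>t\<in>{0<..<T}. \<gamma> t \<notin> closed_segment (\<theta>, y \<epsilon> \<theta> - d) (\<theta>, y \<epsilon> \<theta>)) \<and>
              (\<forall>t\<in>{0..T}. \<gamma> t \<in> Q \<and> (\<gamma> has_vector_derivative (S.Zx \<epsilon> (\<gamma> t), S.Zy \<epsilon> (\<gamma> t))) (at t within {0..T}))"
            using T(1) hit inQ r'(1) Fl.start by (intro exI[of _ T] exI[of _ "\<lambda>t. (u t, v t)"]) auto
        qed
        with V H E show "transversal_section W Z (\<theta>, y \<epsilon> \<theta> - d) (\<theta>, y \<epsilon> \<theta>) \<and>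
            transversal_section W Z (- \<rho>', - \<epsilon>) (- (\<epsilon> powr l), - \<epsilon>) \<and>
            transversal_section W Z (x \<epsilon>, \<epsilon>) (x \<epsilon> + d, \<epsilon>) \<and>
            (\<exists>L. flow_defines_map W Z
              (closed_segment (- \<rho>', - \<epsilon>) (- (\<epsilon> powr l), - \<epsilon>))
              (closed_segment (\<theta>, y \<epsilon> \<theta> - d) (\<theta>, y \<epsilon> \<theta>)) L)"
          by blast
      qed
    qed
  qed
  show ?thesis
    by (rule exI[of _ \<rho>], rule conjI[OF \<rho>(1)], rule exI[of _ \<rho>], rule conjI[OF \<rho>(1)],
        rule exI[of _ c], rule conjI[OF c(1)], rule exI[of _ r], rule conjI[OF c(2)],
        rule exI[of _ \<eta>], rule exI[of _ x], rule exI[of _ y],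
        rule conjI[OF abscissa conjI[OF ordinate ballI[OF flow]]])
qed

end
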